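(* Let $n\ge 3$, let $K\subset\mathbb{R}^n$ be a bounded convex domain containing the origin $0$, with $B(0,R)\subset \operatorname{int}(K)$ for some $R>0$, and let $\delta(x)=\operatorname{dist}(x,\partial K)$. Let $0<\beta<1$ and $0<M<\infty$. Then there is a constant $T'=T'(M,\lambda)$, dependent on $M$ and the ellipticity constant $\lambda$ only (with $n$, $\beta$, the domain $K$ and its origin fixed), such that the following holds. Let $\mathcal{B}:K\to\mathbb{R}^n$ be a drift satisfying $$|\mathcal{B}(x)|\,\delta(x)^{1-\beta}\le M \quad\text{for } x\in K,$$ $$-\frac{M^2}{\delta(x)^{2-2\beta}}\le \nabla\cdot\mathcal{B}(x)\le 0 \quad\text{for } x\in K,$$ and suppose that for some $\alpha>0$ one has $\mathcal{B}\in C^{0,\alpha}(\Omega')$ for every subdomain $\Omega'$ compactly contained in $K$. Let $\mathcal{G}$ be the Dirichlet Green's function in $K$ of the operator $Lu=-\Delta u+\mathcal{B}\cdot\nabla u$. Then for every $x\in K$ with $x\neq 0$ and $|x|\le \frac12$, $$\mathcal{G}(x,0)\le \frac{T'(M,\lambda)}{|x|^{n-2}}.$$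
   Context: $\mathcal{G}(x,y)$ denotes the Dirichlet Green's function of $L$ on $K$ with pole $y$: $L\,\mathcal{G}(\cdot,y)=\delta_y$ (the Dirac mass at $y$) in $K$, with $\mathcal{G}(\cdot,y)=0$ on $\partial K$. The Green's function $\mathcal{G}_T$ of the adjoint operator $L^Tu=-\nabla\cdot(\nabla u+\mathcal{B}u)$ satisfies $\mathcal{G}(x,y)=\mathcal{G}_T(y,x)$. The constant $\lambda>0$ is the lower ellipticity constant of the principal part of the operator; since the principal part of $L$ is the Laplacian, one has $\lambda=1$ here. The divergence $\nabla\cdot\mathcal{B}$ is understood in the weak (distributional) sense, as a function satisfying the stated pointwise bounds. *)

theory Defs
  imports "HOL-Analysis.Analysis"
begin

definition gradient :: "(real ^ 'n \<Rightarrow> real) \<Rightarrow> real ^ 'n \<Rightarrow> real ^ 'n" where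
  "gradient f x = (\<chi> i. frechet_derivative f (at x) (axis i 1))"

primrec class_C :: "nat \<Rightarrow> (real ^ 'n \<Rightarrow> real) \<Rightarrow> bool" where
  "class_C 0 f \<longleftrightarrow> continuous_on UNIV f"
| "class_C (Suc k) f \<longleftrightarrow>
     (\<forall>x. f differentiable (at x)) \<and> (\<forall>i. class_C k (\<lambda>x. gradient f x $ i))"

definition test_functions :: "(real ^ 'n) set \<Rightarrow> (real ^ 'n \<Rightarrow> real) set" where
  "test_functions K = {\<phi>. (\<forall>k. class_C k \<phi>) \<and>
     compact (closure {x. \<phi> x \<noteq> 0}) \<and> closure {x. \<phi> x \<noteq> 0} \<subseteq> K}"

definition locally_integrable ::
    "(real ^ 'n) set \<Rightarrow> (real ^ 'n \<Rightarrow> 'b :: {banach, second_countable_topology}) \<Rightarrow> bool" where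
  "locally_integrable K f \<longleftrightarrow> (\<forall>C. compact C \<and> C \<subseteq> K \<longrightarrow> set_integrable lebesgue C f)"

definition has_weak_gradient ::
    "(real ^ 'n) set \<Rightarrow> (real ^ 'n \<Rightarrow> real) \<Rightarrow> (real ^ 'n \<Rightarrow> real ^ 'n) \<Rightarrow> bool" where
  "has_weak_gradient K u V \<longleftrightarrow> locally_integrable K u \<and> locally_integrable K V \<and>
     (\<forall>\<phi> \<in> test_functions K.
        (LINT x:K|lebesgue. u x *\<^sub>R gradient \<phi> x) = - (LINT x:K|lebesgue. \<phi> x *\<^sub>R V x))"

definition has_weak_divergence ::
    "(real ^ 'n) set \<Rightarrow> (real ^ 'n \<Rightarrow> real ^ 'n) \<Rightarrow> (real ^ 'n \<Rightarrow> real) \<Rightarrow> bool" where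
  "has_weak_divergence K B D \<longleftrightarrow> locally_integrable K B \<and> locally_integrable K D \<and>
     (\<forall>\<phi> \<in> test_functions K.
        (LINT x:K|lebesgue. B x \<bullet> gradient \<phi> x) = - (LINT x:K|lebesgue. \<phi> x * D x))"

definition holder_on :: "real \<Rightarrow> (real ^ 'n) set \<Rightarrow> (real ^ 'n \<Rightarrow> real ^ 'n) \<Rightarrow> bool" where
  "holder_on \<alpha> U B \<longleftrightarrow> (\<exists>C. \<forall>x\<in>U. \<forall>y\<in>U. norm (B x - B y) \<le> C * dist x y powr \<alpha>)"

text \<open>\<open>G x y\<close> has its pole at \<open>y\<close>. The equation \<open>- \<Delta>u + B \<bullet> \<nabla>u = \<delta>\<^sub>y\<close> for
  \<open>u = G(\<cdot>, y)\<close> is the weak one: after one integration by parts,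
  \<open>\<integral> \<nabla>u \<bullet> \<nabla>\<phi> + (B \<bullet> \<nabla>u) \<phi> = \<phi>(y)\<close> for all test functions. Here \<open>u\<close> is the representative
  continuous off the pole, and \<open>u = 0\<close> on the boundary means that \<open>u\<close> tends to \<open>0\<close> there.
  The value \<open>G y y\<close> is left unconstrained.\<close>

definition dirichlet_green ::
    "(real ^ 'n) set \<Rightarrow> (real ^ 'n \<Rightarrow> real ^ 'n) \<Rightarrow> (real ^ 'n \<Rightarrow> real ^ 'n \<Rightarrow> real) \<Rightarrow> bool" where
  "dirichlet_green K B G \<longleftrightarrow> (\<forall>y\<in>K.
     continuous_on (K - {y}) (\<lambda>x. G x y) \<and>
     (\<exists>V. has_weak_gradient K (\<lambda>x. G x y) V \<and>
        (\<forall>\<phi> \<in> test_functions K.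
           (LINT x:K|lebesgue. V x \<bullet> gradient \<phi> x + (B x \<bullet> V x) * \<phi> x) = \<phi> y)) \<and>
     (\<forall>z \<in> frontier K. ((\<lambda>x. G x y) \<longlongrightarrow> 0) (at z within K)))"

end

theory Submission
  imports Defs
begin

text \<open>The bound follows by comparing \<open>u = G(\<cdot>, 0)\<close> with an explicit supersolution. Near the pole it is
  \<open>A (q powr - m + q powr (1/4 - m))\<close> with \<open>q = |x|\<^sup>2 + \<epsilon>\<^sup>2\<close> and \<open>m = (n - 2) / 2\<close>: the first term
  produces an approximate Dirac mass and the second absorbs the drift, which is bounded there. Near
  the boundary it is \<open>N (1 - exp (- k (1 - g) powr \<beta>))\<close>, where \<open>g\<close> is the (smoothed) gauge of \<open>K\<close>; since
  \<open>g\<close> is convex and \<open>\<delta> \<ge> r (1 - g)\<close>, its concavity beats a drift of size \<open>M \<delta> powr (\<beta> - 1)\<close>.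

  As \<open>u\<close> is only a \<open>W\<^sup>1\<^sup>,\<^sup>1\<close> solution, the comparison is made for its mollification, which solves the
  equation up to a commutator that tends to \<open>0\<close> in \<open>L\<^sup>1\<close> because \<open>B\<close> is locally Hoelder continuous. The sign
  of \<open>div B\<close> gives a maximum principle that tolerates \<open>L\<^sup>1\<close> errors, so no regularity theory is needed:
  \<open>-\<Delta>z + B \<bullet> \<nabla>z \<le> e\<close> is integrated against a function \<open>\<phi> > 0\<close> with \<open>-\<Delta>\<phi> - B \<bullet> \<nabla>\<phi> > 0\<close>.\<close>

subsection \<open>Smooth bump functions\<close>

text \<open>The constant depends on \<open>M\<close> alone, for a fixed domain, because of the order
  of choices. The barrier fixes its constants before the drift, the comparison domain and the
  mollification radius are known. What depends on the particular solution, namely the Hoelder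
  constant, the local bound of \<open>B\<close> and the L1 norm of the weak gradient
  \<open>V\<close>, enters only the error, and the radius is chosen after these.

  An error that is small merely in L1 is what the setting offers: the commutator is bounded by the
  oscillation of \<open>B\<close> times a mollification of \<open>|V|\<close>, and \<open>V\<close>
  is only integrable, so a pointwise maximum principle has nothing to act on.

  One radius \<epsilon> serves the mollifier and the regularised pole: the mollified Dirac mass has
  height at most \<open>C / \<epsilon>^n\<close> on the ball of radius \<epsilon>, which up to a
  factor is the source of the regularised fundamental solution there.

  The two halves of the barrier help each other. The gradient of the smoothed gauge may vanish near
  the origin, so the boundary term can fail there by a bounded amount, which the large source of the
  pole term covers. Away from the pole the drift spoils the pole term, and the boundary term pays
  for it.\<close>

lemma class_C_imp_continuous: "class_C k f \<Longrightarrow> continuous_on UNIV f"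
  by (cases k) (auto intro!: continuous_at_imp_continuous_on differentiable_imp_continuous_within)

lemma class_C_Suc_D: "class_C (Suc k) f \<Longrightarrow> class_C k f"
  by (induction k arbitrary: f) (use class_C_imp_continuous[of "Suc 0"] in auto)

lemma gradient_eqI:
  assumes "(f has_derivative f') (at x)"
  shows "gradient f x $ i = f' (axis i 1)"
  using frechet_derivative_at[OF assms] by (simp add: gradient_def)

lemma gradient_has_derivative:
  fixes f :: "real ^ 'n \<Rightarrow> real"
  assumes "f differentiable (at x)"
  shows "(f has_derivative (\<lambda>h. gradient f x \<bullet> h)) (at x)"
proof -
  let ?D = "frechet_derivative f (at x)"
  have D: "(f has_derivative ?D) (at x)" using assms frechet_derivative_works by blast
  then interpret bounded_linear ?D by (rule has_derivative_bounded_linear)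
  have "?D h = gradient f x \<bullet> h" for h
  proof -
    have "?D h = ?D (\<Sum>i\<in>UNIV. h $ i *\<^sub>R axis i 1)" by (simp add: basis_expansion scalar_mult_eq_scaleR[symmetric])
    also have "\<dots> = gradient f x \<bullet> h"
      by (simp add: sum scaleR gradient_def inner_vec_def mult.commute)
    finally show ?thesis .
  qed
  then have "?D = (\<lambda>h. gradient f x \<bullet> h)" by blast
  then show ?thesis using D by simp
qed

section \<open>Closure properties of the smoothness classes\<close>

lemma class_C_const [simp]: "class_C k (\<lambda>x. c)"
proof (induction k arbitrary: c)
  case (Suc k)
  have "gradient (\<lambda>x. c) x $ i = 0" for x :: "real ^ 'a" and i
    by (subst gradient_eqI[of _ "\<lambda>h. 0"]) auto
  then show ?case using Suc by simp
qed simp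

lemma class_C_component: "class_C k (\<lambda>x. x $ i)"
proof (cases k)
  case (Suc l)
  have d: "((\<lambda>x. x $ i) has_derivative (\<lambda>h. h $ i)) (at x)" for x :: "real ^ 'a"
    by (auto intro!: derivative_eq_intros bounded_linear_vec_nth bounded_linear_imp_has_derivative)
  then have "gradient (\<lambda>x. x $ i) x $ j = axis j 1 $ i" for x :: "real ^ 'a" and j
    by (subst gradient_eqI[OF d]) auto
  with d show ?thesis unfolding Suc by (auto simp: differentiable_def)
qed (auto intro!: continuous_intros)

lemma class_C_add: "class_C k f \<Longrightarrow> class_C k g \<Longrightarrow> class_C k (\<lambda>x. f x + g x)"
proof (induction k arbitrary: f g)
  case (Suc k)
  have d: "gradient (\<lambda>x. f x + g x) x $ i = gradient f x $ i + gradient g x $ i" for x i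
    using Suc.prems
    by (subst gradient_eqI[OF has_derivative_add[OF gradient_has_derivative gradient_has_derivative]])
       (auto simp: inner_axis)
  show ?case using Suc by (auto simp: d)
qed (auto intro!: continuous_intros)

lemma class_C_mult: "class_C k f \<Longrightarrow> class_C k g \<Longrightarrow> class_C k (\<lambda>x. f x * g x)"
proof (induction k arbitrary: f g)
  case (Suc k)
  have d: "gradient (\<lambda>x. f x * g x) x $ i = f x * gradient g x $ i + gradient f x $ i * g x" for x i
    using Suc.prems
    by (subst gradient_eqI[OF has_derivative_mult[OF gradient_has_derivative gradient_has_derivative]])
       (auto simp: inner_axis)
  have *: "class_C k f" "class_C k g" using Suc.prems class_C_Suc_D by blast+
  have "class_C k (\<lambda>x. gradient (\<lambda>x. f x * g x) x $ i)" for i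
    unfolding d using * Suc.prems by (intro class_C_add Suc.IH) auto
  then show ?case using Suc.prems by (simp add: differentiable_mult)
qed (auto intro!: continuous_intros)

lemma class_C_uminus: "class_C k f \<Longrightarrow> class_C k (\<lambda>x. - f x)"
  using class_C_mult[of k "\<lambda>_. -1" f] by simp

lemma integrable_continuous_compact_support:
  fixes f :: "real ^ 'n \<Rightarrow> real"
  assumes "continuous_on UNIV f" "compact C" "\<And>x. x \<notin> C \<Longrightarrow> f x = 0"
  shows "integrable lborel f" "integrable lebesgue f"
proof -
  have "integrable lborel (\<lambda>x. indicator C x *\<^sub>R f x)"
    by (rule borel_integrable_compact[OF assms(2) continuous_on_subset[OF assms(1)]]) simp
  moreover have "(\<lambda>x. indicator C x *\<^sub>R f x) = f" using assms(3) by (intro ext) (auto simp: indicator_def)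
  ultimately show "integrable lborel f" by simp
  then show "integrable lebesgue f" by (simp add: integrable_completion)
qed

lemma continuous_borel_measurable:
  fixes f :: "real ^ 'n \<Rightarrow> 'b :: real_normed_vector"
  assumes "continuous_on UNIV f"
  shows "f \<in> borel_measurable lborel" "f \<in> borel_measurable lebesgue"
proof -
  show "f \<in> borel_measurable lborel" using borel_measurable_continuous_onI[OF assms] by simp
  then show "f \<in> borel_measurable lebesgue" by (rule measurable_completion)
qed

text \<open>The powers of \<open>inverse t\<close> close the family under differentiation up to
  linear combinations, so a single induction reaches all derivatives of the standard cut-off
  \<open>m = 0\<close>.\<close>

definition flat :: "nat \<Rightarrow> real \<Rightarrow> real" where
  "flat m t = (if t \<le> 0 then 0 else inverse t ^ m * exp (- inverse t))"

lemma flat_tendsto_0: "(flat m \<longlongrightarrow> 0) (at 0)"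
proof -
  have "((\<lambda>t::real. inverse t ^ m / exp (inverse t)) \<longlongrightarrow> 0) (at_right 0)"
    by (rule filterlim_compose[OF tendsto_power_div_exp_0 filterlim_inverse_at_top_right])
  moreover have "\<forall>\<^sub>F t in at_right 0. inverse t ^ m / exp (inverse t) = flat m t"
    by (auto simp: eventually_at_filter flat_def exp_minus divide_simps)
  ultimately have "(flat m \<longlongrightarrow> 0) (at_right 0)" by (rule Lim_transform_eventually)
  moreover have "(flat m \<longlongrightarrow> 0) (at_left 0)"
    by (rule tendsto_eventually) (auto simp: eventually_at_filter flat_def)
  ultimately show ?thesis by (simp add: filterlim_split_at)
qed

lemma flat_DERIV: "(flat m has_real_derivative flat (m + 2) t - real m * flat (m + 1) t) (at t)"
proof (cases t "0 :: real" rule: linorder_cases)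
  case less
  have "((\<lambda>_. 0) has_real_derivative 0) (at t)" by simp
  then have "(flat m has_real_derivative 0) (at t)"
    by (rule DERIV_cong_ev[OF refl _ refl, THEN iffD1, rotated])
       (use less in \<open>auto simp: flat_def eventually_nhds intro!: exI[of _ "{..<0}"]\<close>)
  with less show ?thesis by (simp add: flat_def)
next
  case equal
  \<comment> \<open>The difference quotient of \<open>flat m\<close> at 0 is
    \<open>flat (m + 1)\<close> itself.\<close>
  have "((\<lambda>h. flat (m + 1) h) \<longlongrightarrow> 0) (at 0)" by (rule flat_tendsto_0)
  then have "((\<lambda>h. (flat m (0 + h) - flat m 0) / h) \<longlongrightarrow> 0) (at 0)"
    by (rule Lim_transform_eventually)
       (auto simp: eventually_at_filter flat_def field_simps)
  then show ?thesis unfolding DERIV_def using equal by (simp add: flat_def)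
next
  case greater
  have "((\<lambda>t. inverse t ^ m * exp (- inverse t)) has_real_derivative
      flat (m + 2) t - real m * flat (m + 1) t) (at t)"
    by (cases m; rule derivative_eq_intros refl | use greater in
      \<open>simp add: flat_def field_simps power2_eq_square\<close>)+
  then show ?thesis
    by (rule DERIV_cong_ev[OF refl _ refl, THEN iffD1, rotated])
       (use greater in \<open>auto simp: flat_def eventually_nhds intro!: exI[of _ "{0<..}"]\<close>)
qed

text \<open>A partial derivative is a linear function of \<open>x\<close> times a combination of the
  members \<open>m + 1\<close> and \<open>m + 2\<close>; hence the induction on \<open>k\<close>
  keeps \<open>m\<close> arbitrary.\<close>

lemma class_C_flat_bump: "class_C k (\<lambda>x :: real ^ 'n. flat m (1 - c * (x \<bullet> x)))"
proof (induction k arbitrary: m)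
  case 0
  have "continuous_on UNIV (flat m)"
    by (intro continuous_at_imp_continuous_on) (blast intro: DERIV_isCont flat_DERIV)
  then show ?case by (auto intro!: continuous_intros continuous_on_compose2[of UNIV "flat m"])
next
  case (Suc k)
  have "((\<lambda>x. flat m (1 - c * (x \<bullet> x))) has_derivative
     (\<lambda>h. (flat (m + 2) (1 - c * (x \<bullet> x)) - real m * flat (m + 1) (1 - c * (x \<bullet> x))) *
        (- (c * (2 * (x \<bullet> h)))))) (at x)" for x :: "real ^ 'n"
    by (rule DERIV_compose_FDERIV[OF flat_DERIV, THEN has_derivative_eq_rhs])
       (auto intro!: derivative_eq_intros simp: inner_commute algebra_simps fun_eq_iff)
  note d = this
  have g: "gradient (\<lambda>x. flat m (1 - c * (x \<bullet> x))) x $ i =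
     (flat (m + 2) (1 - c * (x \<bullet> x)) + (- real m) * flat (m + 1) (1 - c * (x \<bullet> x))) *
        ((- 2 * c) * x $ i)" for x :: "real ^ 'n" and i
    by (subst gradient_eqI[OF d]) (simp add: inner_axis)
  have "class_C k (\<lambda>x. gradient (\<lambda>x. flat m (1 - c * (x \<bullet> x))) x $ i)" for i :: 'n
    unfolding g by (intro class_C_mult class_C_add Suc class_C_const class_C_component)
  then show ?case using d by (auto simp: differentiable_def)
qed

text \<open>Sign and mass are left to \<open>mollifier\<close>, so that the partial derivatives of a
  bump are bumps again.\<close>

definition bump :: "real \<Rightarrow> (real ^ 'n \<Rightarrow> real) \<Rightarrow> bool" where
  "bump \<epsilon> \<rho> \<longleftrightarrow> (\<forall>k. class_C k \<rho>) \<and> (\<forall>x. norm x > \<epsilon> \<longrightarrow> \<rho> x = 0)"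

definition mollifier :: "real \<Rightarrow> (real ^ 'n \<Rightarrow> real) \<Rightarrow> bool" where
  "mollifier \<epsilon> \<rho> \<longleftrightarrow> bump \<epsilon> \<rho> \<and> (\<forall>x. 0 \<le> \<rho> x) \<and> integral\<^sup>L lebesgue \<rho> = 1"

text \<open>One \<open>C\<close> for all radii is the point: through it a barrier regularised at
  scale \<epsilon> can dominate the mollified Dirac mass.\<close>

lemma mollifiers_exist:
  obtains C where "C > 0"
    "\<And>\<epsilon>. \<epsilon> > 0 \<Longrightarrow> \<exists>\<rho> :: real ^ 'n \<Rightarrow> real. mollifier \<epsilon> \<rho> \<and> (\<forall>x. \<rho> x \<le> C / \<epsilon> ^ CARD('n))"
proof -
  define v where "v = measure lebesgue (ball 0 1 :: (real ^ 'n) set)"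
  have v: "v > 0" unfolding v_def by (simp add: content_ball_pos)
  define C where "C = exp 2 * 2 ^ CARD('n) / v"
  have "\<exists>\<rho> :: real ^ 'n \<Rightarrow> real. mollifier \<epsilon> \<rho> \<and> (\<forall>x. \<rho> x \<le> C / \<epsilon> ^ CARD('n))" if e: "\<epsilon> > 0" for \<epsilon>
  proof -
    define b :: "real ^ 'n \<Rightarrow> real" where "b = (\<lambda>x. flat 0 (1 - inverse (\<epsilon>\<^sup>2) * (x \<bullet> x)))"
    have bC: "class_C k b" for k unfolding b_def by (rule class_C_flat_bump)
    have b0: "b x = 0" if "norm x \<ge> \<epsilon>" for x
    proof -
      have "x \<bullet> x \<ge> \<epsilon>\<^sup>2" using that e by (simp add: dot_square_norm)
      then have "inverse (\<epsilon>\<^sup>2) * (x \<bullet> x) \<ge> 1" using e by (simp add: field_simps)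
      then show ?thesis by (simp add: b_def flat_def)
    qed
    have bpos: "0 \<le> b x" "b x \<le> 1" for x by (auto simp: b_def flat_def)
    have bcont: "continuous_on UNIV b" using bC class_C_imp_continuous by blast
    have intb: "integrable lebesgue b"
      by (rule integrable_continuous_compact_support[OF bcont compact_cball[of 0 \<epsilon>]]) (auto intro: b0)
    define I where "I = integral\<^sup>L lebesgue b"
    \<comment> \<open>On the half ball the argument of \<open>flat 0\<close> is at least 3/4, so
      \<open>b\<close> is at least \<open>exp (-4/3)\<close> there. This bounds the mass
      \<open>I\<close> from below by a multiple of \<open>\<epsilon>^n\<close> and yields
      \<open>C\<close> after normalisation.\<close>
    have lo: "exp (-2) * indicator (ball 0 (\<epsilon>/2)) x \<le> b x" for x
    proof (cases "x \<in> ball 0 (\<epsilon>/2)")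
      case True
      then have "norm x ^ 2 \<le> (\<epsilon>/2)^2" by (intro power_mono) auto
      then have "inverse (\<epsilon>\<^sup>2) * (x \<bullet> x) \<le> 1/4"
        using e by (simp add: dot_square_norm field_simps power2_eq_square)
      then have s: "1 - inverse (\<epsilon>\<^sup>2) * (x \<bullet> x) \<ge> 3/4" by simp
      then have "inverse (1 - inverse (\<epsilon>\<^sup>2) * (x \<bullet> x)) \<le> inverse (3/4)"
        by (intro le_imp_inverse_le) auto
      then show ?thesis using True s by (simp add: b_def flat_def)
    qed (simp add: bpos)
    have "exp (-2) * measure lebesgue (ball 0 (\<epsilon>/2) :: (real ^ 'n) set) \<le> I"
    proof -
      have "integral\<^sup>L lebesgue (\<lambda>x :: real ^ 'n. exp (-2) * indicator (ball 0 (\<epsilon>/2)) x) \<le> I"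
        unfolding I_def by (intro integral_mono intb lo integrable_mult_right integrable_real_indicator)
          (use emeasure_bounded_finite[OF bounded_ball, of "0 :: real ^ 'n" "\<epsilon>/2"] in auto)
      then show ?thesis by simp
    qed
    moreover have "measure lebesgue (ball 0 (\<epsilon>/2) :: (real ^ 'n) set) = (\<epsilon>/2) ^ CARD('n) * v"
      unfolding v_def using content_ball_conv_unit_ball[of "\<epsilon>/2" "0 :: real ^ 'n"] e by simp
    ultimately have I: "exp (-2) * (\<epsilon>/2) ^ CARD('n) * v \<le> I" by simp
    have "0 < exp (-2) * (\<epsilon>/2) ^ CARD('n) * v" using e v by simp
    with I have Ip: "I > 0" by linarith
    define \<rho> where "\<rho> = (\<lambda>x. inverse I * b x)"
    have "\<rho> x \<le> C / \<epsilon> ^ CARD('n)" for x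
    proof -
      have "\<rho> x \<le> inverse I * 1" unfolding \<rho>_def using Ip bpos by (intro mult_left_mono) auto
      also have "\<dots> \<le> inverse (exp (-2) * (\<epsilon>/2) ^ CARD('n) * v)"
        unfolding mult_1_right using I e v by (intro le_imp_inverse_le) auto
      also have "\<dots> = C / \<epsilon> ^ CARD('n)"
        unfolding C_def exp_minus power_divide inverse_mult_distrib inverse_inverse_eq inverse_divide
        by (simp only: divide_inverse mult_ac inverse_mult_distrib)
      finally show ?thesis .
    qed
    moreover have "class_C k \<rho>" for k unfolding \<rho>_def by (intro class_C_mult class_C_const bC)
    moreover have "integral\<^sup>L lebesgue \<rho> = 1" using Ip unfolding \<rho>_def I_def by simp
    moreover have "\<forall>x. 0 \<le> \<rho> x" "\<forall>x. norm x > \<epsilon> \<longrightarrow> \<rho> x = 0"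
      using Ip bpos b0 by (auto simp: \<rho>_def)
    ultimately show ?thesis unfolding mollifier_def bump_def by blast
  qed
  moreover have "C > 0" using v by (simp add: C_def)
  ultimately show ?thesis using that by blast
qed

subsection \<open>Convolution with bump functions\<close>

lemma bump_differentiable: "bump \<epsilon> \<rho> \<Longrightarrow> \<rho> differentiable (at x)"
  unfolding bump_def by (metis class_C.simps(2))

lemma bump_continuous: "bump \<epsilon> \<rho> \<Longrightarrow> continuous_on UNIV \<rho>"
  unfolding bump_def using class_C_imp_continuous by blast

lemma bump_gradient:
  assumes "bump \<epsilon> \<rho>"
  shows "bump \<epsilon> (\<lambda>x. gradient \<rho> x $ i)"
proof -
  have "gradient \<rho> x $ i = 0" if "norm x > \<epsilon>" for x
  proof -
    have "(\<rho> has_derivative (\<lambda>h. 0)) (at x)"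
    proof (rule has_derivative_transform_within_open[where f = "\<lambda>_. 0" and s = "- cball 0 \<epsilon>"])
      show "\<And>y. y \<in> - cball 0 \<epsilon> \<Longrightarrow> 0 = \<rho> y" using assms by (simp add: bump_def)
    qed (use that in auto)
    then show ?thesis by (subst gradient_eqI) auto
  qed
  moreover have "class_C k (\<lambda>x. gradient \<rho> x $ i)" for k
    using assms unfolding bump_def by (metis class_C.simps(2))
  ultimately show ?thesis by (simp add: bump_def)
qed

lemma bump_integrable:
  assumes "bump \<epsilon> \<rho>"
  shows "integrable lebesgue \<rho>"
  using integrable_continuous_compact_support(2)[OF bump_continuous[OF assms] compact_cball[of 0 \<epsilon>]]
    assms by (simp add: bump_def)

lemma continuous_compact_support_bounded:
  fixes f :: "real ^ 'n \<Rightarrow> 'b :: real_normed_vector"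
  assumes "continuous_on UNIV f" "compact C" "\<And>x. x \<notin> C \<Longrightarrow> f x = 0"
  obtains M where "M > 0" "\<And>x. norm (f x) \<le> M"
proof -
  have "bounded (f ` C)"
    using assms by (intro compact_imp_bounded compact_continuous_image) (auto elim: continuous_on_subset)
  then obtain M where M: "M > 0" "\<And>x. x \<in> C \<Longrightarrow> norm (f x) \<le> M"
    by (auto simp: bounded_pos)
  then have "norm (f x) \<le> M" for x using assms(3)[of x] by (cases "x \<in> C") auto
  with M show ?thesis using that by blast
qed

lemma bump_bounded:
  assumes "bump \<epsilon> \<rho>"
  obtains M where "M > 0" "\<And>x. \<bar>\<rho> x\<bar> \<le> M"
  using continuous_compact_support_bounded[OF bump_continuous[OF assms] compact_cball[of 0 \<epsilon>]] assms
  by (auto simp: bump_def)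

lemma continuous_gradient:
  assumes "class_C (Suc 0) \<rho>"
  shows "continuous_on UNIV (gradient \<rho>)"
proof -
  have "continuous_on UNIV (\<lambda>x. \<chi> i. gradient \<rho> x $ i)"
    using assms by (intro continuous_on_vec_lambda) simp
  then show ?thesis by simp
qed

text \<open>With a Taylor remainder uniform in the base point, the remainder of a convolution is
  controlled by the L1 norm of the other factor alone.\<close>

lemma bump_uniform_differentiable:
  fixes \<rho> :: "real ^ 'n \<Rightarrow> real"
  assumes "bump \<epsilon> \<rho>" "e > 0"
  obtains d where "d > 0"
    "\<And>x h. norm h < d \<Longrightarrow> \<bar>\<rho> (x + h) - \<rho> x - gradient \<rho> x \<bullet> h\<bar> \<le> e * norm h"
proof -
  have c: "continuous_on UNIV (gradient \<rho>)"
    using assms by (intro continuous_gradient) (simp add: bump_def del: class_C.simps)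
  have g0: "gradient \<rho> x = 0" if "norm x > \<epsilon>" for x
    using bump_gradient[OF assms(1)] that by (simp add: bump_def vec_eq_iff)
  have "uniformly_continuous_on (cball 0 (\<epsilon> + 2)) (gradient \<rho>)"
    by (intro compact_uniformly_continuous continuous_on_subset[OF c]) auto
  then obtain d where d: "d > 0" "\<And>x y. x \<in> cball 0 (\<epsilon> + 2) \<Longrightarrow> y \<in> cball 0 (\<epsilon> + 2) \<Longrightarrow>
      dist y x < d \<Longrightarrow> dist (gradient \<rho> y) (gradient \<rho> x) < e"
    unfolding uniformly_continuous_on_def using assms(2) by metis
  \<comment> \<open>Two points at distance below 1 either both lie in the ball of radius
    \<open>\<epsilon> + 2\<close>, where uniform continuity applies, or both lie where the gradient
    vanishes.\<close>
  have u: "norm (gradient \<rho> y - gradient \<rho> x) \<le> e" if "norm (y - x) < min d 1" for x y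
  proof (cases "norm x \<le> \<epsilon> + 1")
    case True
    then have "norm y \<le> \<epsilon> + 2" using that norm_triangle_ineq[of x "y - x"] by simp
    then show ?thesis using d(2)[of x y] True that by (simp add: dist_norm)
  next
    case False
    then have "norm y > \<epsilon>" using that norm_triangle_ineq[of y "x - y"] by (simp add: norm_minus_commute)
    then show ?thesis using False assms(2) by (simp add: g0)
  qed
  have "\<bar>\<rho> (x + h) - \<rho> x - gradient \<rho> x \<bullet> h\<bar> \<le> e * norm h" if "norm h < min d 1" for x h
  proof -
    let ?k = "\<lambda>y. \<rho> y - gradient \<rho> x \<bullet> y"
    have "norm (?k (x + h) - ?k x) \<le> e * norm (x + h - x)"
    proof (rule differentiable_bound[OF convex_ball[of x "min d 1"]])
      show "(?k has_derivative (\<lambda>v. gradient \<rho> y \<bullet> v - gradient \<rho> x \<bullet> v)) (at y within ball x (min d 1))" for y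
        by (rule has_derivative_at_withinI[OF has_derivative_diff[OF gradient_has_derivative
            has_derivative_inner_right[OF has_derivative_ident]]]) (rule bump_differentiable[OF assms(1)])
      show "onorm (\<lambda>v. gradient \<rho> y \<bullet> v - gradient \<rho> x \<bullet> v) \<le> e" if y: "y \<in> ball x (min d 1)" for y
      proof (rule onorm_bound)
        fix v
        have "norm (gradient \<rho> y \<bullet> v - gradient \<rho> x \<bullet> v) \<le> norm (gradient \<rho> y - gradient \<rho> x) * norm v"
          by (simp add: inner_diff_left[symmetric] Cauchy_Schwarz_ineq2)
        also have "\<dots> \<le> e * norm v" using y u[of y x]
          by (intro mult_right_mono) (auto simp: dist_norm norm_minus_commute)
        finally show "norm (gradient \<rho> y \<bullet> v - gradient \<rho> x \<bullet> v) \<le> e * norm v" .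
      qed (use assms in auto)
    qed (use that d in \<open>auto simp: dist_norm\<close>)
    then show ?thesis by (simp add: inner_add_right algebra_simps)
  qed
  then show ?thesis using that[of "min d 1"] d(1) by auto
qed

definition conv :: "(real ^ 'n \<Rightarrow> real) \<Rightarrow> (real ^ 'n \<Rightarrow> real) \<Rightarrow> real ^ 'n \<Rightarrow> real" where
  "conv f \<rho> x = (LINT y|lebesgue. f y * \<rho> (x - y))"

lemma measurable_translate:
  fixes \<rho> :: "real ^ 'n \<Rightarrow> real"
  assumes "continuous_on UNIV \<rho>"
  shows "(\<lambda>y. \<rho> (x - y)) \<in> borel_measurable lebesgue"
proof -
  have "continuous_on UNIV (\<lambda>y. \<rho> (x - y))"
    by (rule continuous_on_compose2[OF assms]) (auto intro!: continuous_intros)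
  then show ?thesis by (rule continuous_borel_measurable(2))
qed

lemma integrable_mult_bounded:
  fixes f g :: "'a \<Rightarrow> real"
  assumes "integrable M f" "g \<in> borel_measurable M" "\<And>x. \<bar>g x\<bar> \<le> C"
  shows "integrable M (\<lambda>x. f x * g x)"
proof (rule Bochner_Integration.integrable_bound)
  show "integrable M (\<lambda>x. C * f x)" using assms by simp
  have "norm (f x * g x) \<le> norm (C * f x)" for x
  proof -
    have "\<bar>f x\<bar> * \<bar>g x\<bar> \<le> \<bar>f x\<bar> * \<bar>C\<bar>" using assms(3)[of x] by (intro mult_left_mono) auto
    then show ?thesis by (simp add: abs_mult mult.commute)
  qed
  then show "AE x in M. norm (f x * g x) \<le> norm (C * f x)" by blast
qed (use assms in measurable)

lemma integrable_conv:
  assumes "integrable lebesgue f" "bump \<epsilon> \<rho>"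
  shows "integrable lebesgue (\<lambda>y. f y * \<rho> (x - y))"
proof -
  obtain M where "\<And>x. \<bar>\<rho> x\<bar> \<le> M" using bump_bounded[OF assms(2)] by blast
  then show ?thesis
    using assms measurable_translate[OF bump_continuous] by (intro integrable_mult_bounded) auto
qed

lemma conv_add: "integrable lebesgue f \<Longrightarrow> integrable lebesgue g \<Longrightarrow> bump \<epsilon> \<rho> \<Longrightarrow>
    conv (\<lambda>x. f x + g x) \<rho> x = conv f \<rho> x + conv g \<rho> x"
  unfolding conv_def distrib_right by (intro Bochner_Integration.integral_add integrable_conv)

lemma conv_has_derivative:
  fixes \<rho> f :: "real ^ 'n \<Rightarrow> real"
  assumes f: "integrable lebesgue f" and b: "bump \<epsilon> \<rho>"
  shows "(conv f \<rho> has_derivative (\<lambda>h. \<Sum>i\<in>UNIV. conv f (\<lambda>x. gradient \<rho> x $ i) x * h $ i)) (at x)"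
proof -
  define L where "L = (LINT y|lebesgue. \<bar>f y\<bar>)"
  have "\<exists>d>0. \<forall>y. norm (y - x) < d \<longrightarrow> norm (conv f \<rho> y - conv f \<rho> x -
      (\<Sum>i\<in>UNIV. conv f (\<lambda>x. gradient \<rho> x $ i) x * (y - x) $ i)) \<le> e * norm (y - x)" if e: "e > 0" for e
  proof -
    have L0: "L \<ge> 0" unfolding L_def by (intro integral_nonneg_AE) auto
    \<comment> \<open>The summand 1 keeps the quotient defined when \<open>f\<close> vanishes almost
      everywhere.\<close>
    define e' where "e' = e / (L + 1)"
    have e': "e' > 0" "L * e' \<le> e" using e L0 by (auto simp: e'_def field_simps)
    obtain d where d: "d > 0" "\<And>x h. norm h < d \<Longrightarrow> \<bar>\<rho> (x + h) - \<rho> x - gradient \<rho> x \<bullet> h\<bar> \<le> e' * norm h"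
      using bump_uniform_differentiable[OF b e'(1)] by blast
    have "norm (conv f \<rho> y - conv f \<rho> x -
      (\<Sum>i\<in>UNIV. conv f (\<lambda>x. gradient \<rho> x $ i) x * (y - x) $ i)) \<le> e * norm (y - x)" if y: "norm (y - x) < d" for y
    proof -
      let ?r = "\<lambda>z. \<rho> (y - z) - \<rho> (x - z) - gradient \<rho> (x - z) \<bullet> (y - x)"
      have int: "integrable lebesgue (\<lambda>z. f z * gradient \<rho> (x - z) $ i * (y - x) $ i)" for i
        by (intro integrable_mult_left integrable_conv[OF f bump_gradient[OF b]])
      have eq: "conv f \<rho> y - conv f \<rho> x - (\<Sum>i\<in>UNIV. conv f (\<lambda>x. gradient \<rho> x $ i) x * (y - x) $ i)
          = (LINT z|lebesgue. f z * ?r z)"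
      proof -
        have "(\<Sum>i\<in>UNIV. conv f (\<lambda>x. gradient \<rho> x $ i) x * (y - x) $ i)
          = (LINT z|lebesgue. (\<Sum>i\<in>UNIV. f z * gradient \<rho> (x - z) $ i * (y - x) $ i))"
          unfolding conv_def using int by (simp add: Bochner_Integration.integral_sum)
        also have "\<dots> = (LINT z|lebesgue. f z * (gradient \<rho> (x - z) \<bullet> (y - x)))"
          by (simp add: inner_vec_def sum_distrib_left mult.assoc)
        finally have s: "(\<Sum>i\<in>UNIV. conv f (\<lambda>x. gradient \<rho> x $ i) x * (y - x) $ i) = \<dots>" .
        have i3: "integrable lebesgue (\<lambda>z. f z * (gradient \<rho> (x - z) \<bullet> (y - x)))"
          using Bochner_Integration.integrable_sum[of UNIV lebesgue, OF int]
          by (simp add: inner_vec_def sum_distrib_left mult.assoc)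
        show ?thesis unfolding s unfolding conv_def right_diff_distrib
          using integrable_conv[OF f b] i3 by (simp add: Bochner_Integration.integral_diff)
      qed
      have bd: "\<bar>f z * ?r z\<bar> \<le> \<bar>f z\<bar> * (e' * norm (y - x))" for z
        using d(2)[OF y, of "x - z"] by (simp add: abs_mult mult_left_mono)
      have "norm (LINT z|lebesgue. f z * ?r z) \<le> (LINT z|lebesgue. norm (f z * ?r z))"
        by (rule integral_norm_bound)
      also have "\<dots> \<le> (LINT z|lebesgue. \<bar>f z\<bar> * (e' * norm (y - x)))"
        by (rule integral_mono_AE') (use f bd e'(1) in \<open>auto intro!: mult_nonneg_nonneg\<close>)
      also have "\<dots> = L * e' * norm (y - x)" by (simp add: L_def)
      also have "\<dots> \<le> e * norm (y - x)" using e' by (intro mult_right_mono) auto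
      finally show ?thesis unfolding eq .
    qed
    then show ?thesis using d(1) by blast
  qed
  moreover have "bounded_linear (\<lambda>h. \<Sum>i\<in>UNIV. conv f (\<lambda>x. gradient \<rho> x $ i) x * h $ i)"
    by (intro bounded_linear_sum bounded_linear_const_mult bounded_linear_vec_nth)
  ultimately show ?thesis unfolding has_derivative_at_alt by blast
qed

lemma gradient_conv:
  assumes "integrable lebesgue f" "bump \<epsilon> \<rho>"
  shows "gradient (conv f \<rho>) x $ i = conv f (\<lambda>x. gradient \<rho> x $ i) x"
  by (subst gradient_eqI[OF conv_has_derivative[OF assms]]) (simp add: axis_def if_distrib cong: if_cong)

lemma class_C_conv:
  assumes "integrable lebesgue f" "bump \<epsilon> \<rho>"
  shows "class_C k (conv f \<rho>)"
  using assms(2)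
proof (induction k arbitrary: \<rho>)
  case 0
  then show ?case using conv_has_derivative[OF assms(1)]
    by (auto intro!: continuous_at_imp_continuous_on has_derivative_continuous)
next
  case (Suc k)
  have "class_C k (\<lambda>x. gradient (conv f \<rho>) x $ i)" for i
    using Suc.IH[OF bump_gradient[OF Suc.prems]] gradient_conv[OF assms(1) Suc.prems] by simp
  then show ?case using conv_has_derivative[OF assms(1) Suc.prems] by (auto simp: differentiable_def)
qed

subsection \<open>Partial derivatives and integration by parts\<close>

text \<open>A derivative along one coordinate line. The Laplacian needs only the diagonal second
  derivatives, and product and chain rules are inherited from one variable.\<close>

definition has_partial :: "(real ^ 'n \<Rightarrow> real) \<Rightarrow> 'n \<Rightarrow> real \<Rightarrow> real ^ 'n \<Rightarrow> bool" where
  "has_partial f i D x \<longleftrightarrow> ((\<lambda>t. f (x + t *\<^sub>R axis i 1)) has_real_derivative D) (at 0)"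

lemma has_partial_gradient:
  assumes "f differentiable (at x)"
  shows "has_partial f i (gradient f x $ i) x"
proof -
  have "((\<lambda>t::real. x + t *\<^sub>R axis i 1) has_derivative (\<lambda>t. t *\<^sub>R axis i 1)) (at 0)"
    by (auto intro!: derivative_eq_intros)
  moreover have "(f has_derivative (\<lambda>h. gradient f x \<bullet> h)) (at (x + 0 *\<^sub>R axis i 1))"
    using gradient_has_derivative[OF assms] by simp
  ultimately have "((\<lambda>t. f (x + t *\<^sub>R axis i 1)) has_derivative
      (\<lambda>t. gradient f x \<bullet> (t *\<^sub>R axis i 1))) (at 0)"
    by (rule has_derivative_compose)
  then show ?thesis unfolding has_partial_def has_field_derivative_def
    by (simp add: inner_axis mult.commute[of _ "gradient f x $ i"] fun_eq_iff)
qed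

lemma has_partial_const: "has_partial (\<lambda>x. c) i 0 x"
  by (simp add: has_partial_def)

lemma has_partial_add: "has_partial f i D x \<Longrightarrow> has_partial g i E x \<Longrightarrow>
    has_partial (\<lambda>x. f x + g x) i (D + E) x"
  unfolding has_partial_def by (rule DERIV_add)

lemma has_partial_diff: "has_partial f i D x \<Longrightarrow> has_partial g i E x \<Longrightarrow>
    has_partial (\<lambda>x. f x - g x) i (D - E) x"
  unfolding has_partial_def by (rule DERIV_diff)

lemma has_partial_mult: "has_partial f i D x \<Longrightarrow> has_partial g i E x \<Longrightarrow>
    has_partial (\<lambda>x. f x * g x) i (D * g x + E * f x) x"
  unfolding has_partial_def by (drule (1) DERIV_mult) simp

lemma has_partial_chain:
  assumes "has_partial f i D x" "(\<psi> has_real_derivative E) (at (f x))"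
  shows "has_partial (\<lambda>x. \<psi> (f x)) i (E * D) x"
proof -
  have "(\<psi> has_real_derivative E) (at (f (x + 0 *\<^sub>R axis i 1)))" using assms(2) by simp
  then show ?thesis
    using assms(1) unfolding has_partial_def
    by (rule DERIV_chain2[where f = \<psi> and g = "\<lambda>t. f (x + t *\<^sub>R axis i 1)"])
qed

lemma has_partial_eq: "has_partial f i D x \<Longrightarrow> D = E \<Longrightarrow> has_partial f i E x"
  by simp

lemma has_partial_component: "has_partial (\<lambda>x. x $ j) i (if i = j then 1 else 0) x"
  unfolding has_partial_def by (auto intro!: derivative_eq_intros simp: axis_def)

lemma has_partial_transform:
  assumes "has_partial f i D x" "open S" "x \<in> S" "\<And>y. y \<in> S \<Longrightarrow> f y = g y"
  shows "has_partial g i D x"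
proof -
  let ?l = "\<lambda>t::real. x + t *\<^sub>R axis i 1"
  have "open (?l -` S)" using assms(2) by (intro open_vimage) (auto intro!: continuous_intros)
  moreover have "0 \<in> ?l -` S" using assms(3) by simp
  ultimately have "\<forall>\<^sub>F t in nhds 0. t \<in> ?l -` S" by (rule eventually_nhds_in_open)
  then have "\<forall>\<^sub>F t in nhds 0. f (?l t) = g (?l t)" by eventually_elim (use assms(4) in auto)
  from DERIV_cong_ev[OF refl this refl] assms(1) show ?thesis unfolding has_partial_def by blast
qed

lemma has_partial_line:
  assumes "\<And>x. has_partial f i (D x) x"
  shows "((\<lambda>t. f (x + t *\<^sub>R axis i 1)) has_real_derivative D (x + s *\<^sub>R axis i 1)) (at s)"
proof -
  have "((\<lambda>t. f (x + s *\<^sub>R axis i 1 + t *\<^sub>R axis i 1)) has_real_derivative D (x + s *\<^sub>R axis i 1)) (at 0)"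
    using assms unfolding has_partial_def by blast
  then have "((\<lambda>t. f (x + (t + s) *\<^sub>R axis i 1)) has_real_derivative D (x + s *\<^sub>R axis i 1)) (at 0)"
    by (simp add: algebra_simps)
  then show ?thesis
    using DERIV_shift[of "\<lambda>t. f (x + t *\<^sub>R axis i 1)" "D (x + s *\<^sub>R axis i 1)" 0 s] by simp
qed

lemma lborel_integral_translate:
  fixes f :: "real ^ 'n \<Rightarrow> real"
  assumes "f \<in> borel_measurable lborel"
  shows "(LINT x|lborel. f (x + a)) = (LINT x|lborel. f x)"
proof -
  have "(LINT x|lborel. f x) = (LINT x|distr lborel borel ((+) a). f x)" by (simp add: lborel_distr_plus)
  also have "\<dots> = (LINT x|lborel. f (a + x))" using assms by (intro integral_distr) auto
  finally show ?thesis by (simp add: add.commute)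
qed

lemma has_partial_zero_outside:
  assumes "compact C" "\<And>x. x \<notin> C \<Longrightarrow> f x = 0" "has_partial f i D x" "x \<notin> C"
  shows "D = 0"
proof -
  have "has_partial f i 0 x"
    by (rule has_partial_transform[OF has_partial_const[of 0], of "- C"])
       (use assms in \<open>auto simp: compact_imp_closed open_Compl\<close>)
  with assms(3) show ?thesis unfolding has_partial_def using DERIV_unique by blast
qed

text \<open>By translation invariance every difference quotient of \<open>f\<close> has integral zero.\<close>

lemma integral_partial_eq_0:
  fixes f :: "real ^ 'n \<Rightarrow> real"
  assumes f: "continuous_on UNIV f" and D: "continuous_on UNIV D"
    and C: "compact C" "\<And>x. x \<notin> C \<Longrightarrow> f x = 0"
    and d: "\<And>x. has_partial f i (D x) x"
  shows "(LINT x|lebesgue. D x) = 0"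
proof -
  let ?e = "axis i 1 :: real ^ 'n"
  have D0: "D x = 0" if "x \<notin> C" for x
    using has_partial_zero_outside[OF C d that] .
  obtain M where M: "M > 0" "\<And>x. norm (D x) \<le> M"
    using continuous_compact_support_bounded[OF D C(1) D0] by blast
  \<comment> \<open>All steps \<open>t n\<close> are at most 1, so every difference quotient is
    supported in this neighbourhood, and the mean value theorem bounds it by \<open>M\<close>: a
    dominating function.\<close>
  define C' where "C' = (\<Union>x\<in>C. cball x 1)"
  have C': "compact C'" unfolding C'_def by (rule compact_minkowski_sum_cball[OF C(1)])
  define t where "t = (\<lambda>n. inverse (real (Suc n)))"
  have t: "0 < t n" "t n \<le> 1" for n by (auto simp: t_def field_simps)
  have t0: "t \<longlonglongrightarrow> 0" unfolding t_def by (rule LIMSEQ_inverse_real_of_nat)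
  define q where "q = (\<lambda>n x. (f (x + t n *\<^sub>R ?e) - f x) / t n)"
  have mf: "f \<in> borel_measurable lborel" by (rule continuous_borel_measurable(1)[OF f])
  have ci: "integrable lborel f" by (rule integrable_continuous_compact_support(1)[OF f C])
  have mt: "(\<lambda>x. f (x + a)) \<in> borel_measurable lborel" for a
    using mf by measurable
  have ct: "continuous_on UNIV (\<lambda>x. f (x + a))" for a
    by (rule continuous_on_compose2[OF f]) (auto intro!: continuous_intros)
  have cit: "integrable lborel (\<lambda>x. f (x + a))" for a
  proof (rule integrable_continuous_compact_support(1)[OF ct])
    show "compact ((\<lambda>x. x - a) ` C)" by (intro compact_continuous_image C continuous_intros)
    show "f (x + a) = 0" if "x \<notin> (\<lambda>x. x - a) ` C" for x
    proof (rule C(2), rule notI)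
      assume "x + a \<in> C"
      then show False using that by (metis add_diff_cancel_right' image_eqI)
    qed
  qed
  have q0: "(LINT x|lborel. q n x) = 0" for n
    unfolding q_def using ci cit[of "t n *\<^sub>R ?e"] lborel_integral_translate[OF mf, of "t n *\<^sub>R ?e"] by simp
  have "(\<lambda>n. LINT x|lborel. q n x) \<longlonglongrightarrow> (LINT x|lborel. D x)"
  proof (rule integral_dominated_convergence)
    show "D \<in> borel_measurable lborel" by (rule continuous_borel_measurable(1)[OF D])
    show "q n \<in> borel_measurable lborel" for n unfolding q_def using mf mt by measurable
    show "integrable lborel (\<lambda>x. M * indicator C' x)"
      using emeasure_compact_finite[OF C'] C' by (intro integrable_mult_right integrable_real_indicator) (auto simp: borel_compact)
    have "(\<lambda>n. q n x) \<longlonglongrightarrow> D x" for x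
    proof -
      have "((\<lambda>h. (f (x + h *\<^sub>R ?e) - f x) / h) \<longlongrightarrow> D x) (at 0)"
        using d[of x] unfolding has_partial_def DERIV_def by simp
      moreover have "filterlim t (at 0) sequentially"
        using t0 t(1) by (auto simp: filterlim_at intro!: always_eventually less_imp_neq[symmetric])
      ultimately show ?thesis unfolding q_def by (rule filterlim_compose)
    qed
    then show "AE x in lborel. (\<lambda>n. q n x) \<longlonglongrightarrow> D x" by simp
    have "norm (q n x) \<le> M * indicator C' x" for n x
    proof (cases "x \<in> C'")
      case True
      have "\<exists>z>0. z < t n \<and> f (x + t n *\<^sub>R ?e) - f (x + 0 *\<^sub>R ?e) = (t n - 0) * D (x + z *\<^sub>R ?e)"
        using t by (intro MVT2 has_partial_line[OF d]) auto
      then obtain z where "f (x + t n *\<^sub>R ?e) - f x = t n * D (x + z *\<^sub>R ?e)" by auto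
      then have "q n x = D (x + z *\<^sub>R ?e)" using t(1)[of n] by (simp add: q_def)
      then show ?thesis using M True by simp
    next
      case False
      have "x \<notin> C" using False unfolding C'_def by force
      moreover have "x + t n *\<^sub>R ?e \<notin> C"
      proof
        assume "x + t n *\<^sub>R ?e \<in> C"
        moreover have "x \<in> cball (x + t n *\<^sub>R ?e) 1" using t[of n] by (simp add: dist_norm)
        ultimately show False using False unfolding C'_def by blast
      qed
      ultimately show ?thesis using C(2) M(1) by (simp add: q_def)
    qed
    then show "AE x in lborel. norm (q n x) \<le> M * indicator C' x" for n by simp
  qed
  then have "(LINT x|lborel. D x) = 0" unfolding q0 by (rule LIMSEQ_unique[OF _ tendsto_const])
  moreover have "D \<in> borel_measurable lborel" by (rule continuous_borel_measurable(1)[OF D])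
  ultimately show ?thesis using integral_completion[of D lborel] by simp
qed

lemma integral_by_parts:
  fixes f g :: "real ^ 'n \<Rightarrow> real"
  assumes c: "continuous_on UNIV f" "continuous_on UNIV D" "continuous_on UNIV g" "continuous_on UNIV E"
    and C: "compact C" "\<And>x. x \<notin> C \<Longrightarrow> f x = 0"
    and d: "\<And>x. has_partial f i (D x) x" "\<And>x. has_partial g i (E x) x"
  shows "(LINT x|lebesgue. D x * g x) = - (LINT x|lebesgue. f x * E x)"
proof -
  have D0: "D x = 0" if "x \<notin> C" for x
    using has_partial_zero_outside[OF C d(1) that] .
  have "(LINT x|lebesgue. D x * g x + E x * f x) = 0"
    by (rule integral_partial_eq_0[of "\<lambda>x. f x * g x" _ C i])
       (use C in \<open>auto intro!: continuous_intros c has_partial_mult d\<close>)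
  moreover have "integrable lebesgue (\<lambda>x. D x * g x)" "integrable lebesgue (\<lambda>x. E x * f x)"
    by (rule integrable_continuous_compact_support(2)[of _ C];
        use C D0 in \<open>auto intro!: continuous_intros c\<close>)+
  ultimately show ?thesis by (simp add: mult.commute)
qed

section \<open>Reflected kernels and averages against mollifiers\<close>

lemma lborel_integral_reflect:
  fixes f :: "real ^ 'n \<Rightarrow> real"
  assumes "f \<in> borel_measurable lborel"
  shows "(LINT y|lborel. f (x - y)) = (LINT y|lborel. f y)"
proof -
  have "distr lborel borel (\<lambda>y. x - y) = (lborel :: (real ^ 'n) measure)"
    by (subst (2) lborel_affine[of "-1" x]) (auto simp: density_1)
  then have "(LINT y|lborel. f y) = (LINT y|distr lborel borel (\<lambda>y. x - y). f y)" by simp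
  also have "\<dots> = (LINT y|lborel. f (x - y))" using assms by (intro integral_distr) auto
  finally show ?thesis by simp
qed

lemma mollifier_integral_translate:
  assumes "mollifier \<epsilon> \<rho>"
  shows "(LINT y|lebesgue. \<rho> (x - y)) = 1"
proof -
  have c: "continuous_on UNIV \<rho>" using assms bump_continuous by (auto simp: mollifier_def)
  have m: "\<rho> \<in> borel_measurable lborel" by (rule continuous_borel_measurable(1)[OF c])
  have m': "(\<lambda>y. \<rho> (x - y)) \<in> borel_measurable lborel" using m by measurable
  show ?thesis
    using assms integral_completion[OF m] integral_completion[OF m'] lborel_integral_reflect[OF m, of x]
    by (simp add: mollifier_def)
qed

lemma mollifier_integrable_translate:
  assumes "bump \<epsilon> \<rho>"
  shows "integrable lebesgue (\<lambda>y. \<rho> (x - y))"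
proof (rule integrable_continuous_compact_support(2)[OF _ compact_cball[of x \<epsilon>]])
  show "continuous_on UNIV (\<lambda>y. \<rho> (x - y))"
    by (rule continuous_on_compose2[OF bump_continuous[OF assms]]) (auto intro!: continuous_intros)
qed (use assms in \<open>auto simp: bump_def dist_norm\<close>)

lemma conv_mono_local:
  assumes f: "integrable lebesgue f" "integrable lebesgue g" and \<rho>: "bump \<epsilon> \<rho>" "\<And>x. 0 \<le> \<rho> x"
    and le: "\<And>y. y \<in> cball x \<epsilon> \<Longrightarrow> f y \<le> g y"
  shows "conv f \<rho> x \<le> conv g \<rho> x"
  unfolding conv_def
proof (rule integral_mono)
  show "f y * \<rho> (x - y) \<le> g y * \<rho> (x - y)" for y
    using le[of y] \<rho>(2)[of "x - y"] \<rho>(1)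
    by (cases "y \<in> cball x \<epsilon>") (auto simp: bump_def dist_norm intro: mult_right_mono)
qed (intro integrable_conv[OF _ \<rho>(1)] f)+

lemma conv_le:
  assumes f: "integrable lebesgue f" and \<rho>: "mollifier \<epsilon> \<rho>"
    and le: "\<And>y. y \<in> cball x \<epsilon> \<Longrightarrow> f y \<le> c"
  shows "conv f \<rho> x \<le> c"
proof -
  have b: "bump \<epsilon> \<rho>" "\<And>x. 0 \<le> \<rho> x" using \<rho> by (auto simp: mollifier_def)
  have "conv f \<rho> x \<le> (LINT y|lebesgue. c * \<rho> (x - y))" unfolding conv_def
  proof (rule integral_mono)
    show "f y * \<rho> (x - y) \<le> c * \<rho> (x - y)" for y
      using le[of y] b(2)[of "x - y"] b(1)
      by (cases "y \<in> cball x \<epsilon>") (auto simp: bump_def dist_norm intro: mult_right_mono)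
  qed (intro integrable_conv[OF f b(1)] integrable_mult_right mollifier_integrable_translate[OF b(1)])+
  then show ?thesis using mollifier_integral_translate[OF \<rho>] by simp
qed

lemma conv_minus: "conv (\<lambda>y. - f y) \<rho> x = - conv f \<rho> x"
  by (simp add: conv_def)

lemma conv_ge:
  assumes "integrable lebesgue f" "mollifier \<epsilon> \<rho>" "\<And>y. y \<in> cball x \<epsilon> \<Longrightarrow> c \<le> f y"
  shows "c \<le> conv f \<rho> x"
  using conv_le[of "\<lambda>y. - f y" \<epsilon> \<rho> x "- c"] assms by (simp add: conv_minus)

lemma conv_eq_0:
  assumes "bump \<epsilon> \<rho>" "\<And>y. y \<in> cball x \<epsilon> \<Longrightarrow> f y = 0"
  shows "conv f \<rho> x = 0"
proof -
  have "f y * \<rho> (x - y) = 0" for y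
    using assms by (cases "y \<in> cball x \<epsilon>") (auto simp: bump_def dist_norm)
  then have "(\<lambda>y. f y * \<rho> (x - y)) = (\<lambda>y. 0)" by (rule ext)
  then show ?thesis unfolding conv_def by simp
qed

lemma gradient_translate_reflect:
  assumes "bump \<epsilon> \<rho>"
  shows "(\<lambda>y. \<rho> (x - y)) differentiable (at y)" "gradient (\<lambda>y. \<rho> (x - y)) y = - gradient \<rho> (x - y)"
proof -
  have d: "((\<lambda>y. \<rho> (x - y)) has_derivative (\<lambda>h. gradient \<rho> (x - y) \<bullet> (- h))) (at y)"
    by (rule has_derivative_compose[OF _ gradient_has_derivative[OF bump_differentiable[OF assms]]])
       (auto intro!: derivative_eq_intros)
  then show "(\<lambda>y. \<rho> (x - y)) differentiable (at y)" by (auto simp: differentiable_def)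
  show "gradient (\<lambda>y. \<rho> (x - y)) y = - gradient \<rho> (x - y)"
    using gradient_eqI[OF d] by (simp add: vec_eq_iff inner_axis)
qed

lemma has_partial_translate_reflect:
  assumes "bump \<epsilon> \<rho>"
  shows "has_partial (\<lambda>y. \<rho> (x - y)) i (- (gradient \<rho> (x - y) $ i)) y"
  using has_partial_gradient[OF gradient_translate_reflect(1)[OF assms]] gradient_translate_reflect(2)[OF assms]
  by simp

text \<open>Integration by parts moves the derivative from the kernel back to
  \<open>\<zeta>\<close>. Thus gradients of mollified C1 functions inherit the bounds of the
  original gradient and converge to it.\<close>

lemma gradient_conv_partial:
  assumes \<zeta>: "continuous_on UNIV \<zeta>" "continuous_on UNIV D" "compact C" "\<And>x. x \<notin> C \<Longrightarrow> \<zeta> x = 0"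
    "\<And>x. has_partial \<zeta> i (D x) x" and \<rho>: "bump \<epsilon> \<rho>"
  shows "gradient (conv \<zeta> \<rho>) x $ i = conv D \<rho> x"
proof -
  have c: "continuous_on UNIV (\<lambda>y. \<rho> (x - y))" if "bump \<epsilon> \<rho>" for \<rho>
    by (rule continuous_on_compose2[OF bump_continuous[OF that]]) (auto intro!: continuous_intros)
  have "(LINT y|lebesgue. D y * \<rho> (x - y)) = - (LINT y|lebesgue. \<zeta> y * - (gradient \<rho> (x - y) $ i))"
    by (rule integral_by_parts[OF \<zeta>(1,2) c[OF \<rho>] continuous_on_minus[OF c[OF bump_gradient[OF \<rho>]]]
        \<zeta>(3,4,5) has_partial_translate_reflect[OF \<rho>]])
  then show ?thesis
    using gradient_conv[OF integrable_continuous_compact_support(2)[OF \<zeta>(1,3,4)] \<rho>]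
    by (simp add: conv_def)
qed

lemma test_functionI:
  assumes "\<And>k. class_C k \<phi>" "compact C" "C \<subseteq> K" "\<And>x. x \<notin> C \<Longrightarrow> \<phi> x = 0"
  shows "\<phi> \<in> test_functions K"
proof -
  have "closure {x. \<phi> x \<noteq> 0} \<subseteq> C"
    using assms by (intro closure_minimal) (auto simp: compact_imp_closed)
  then show ?thesis
    using assms compact_Int_closed[OF assms(2), of "closure {x. \<phi> x \<noteq> 0}"]
    by (auto simp: test_functions_def Int_absorb1)
qed

text \<open>A drift with weak divergence at most \<open>0\<close> is tested against \<open>C\<^sup>1\<close> functions by mollifying them.\<close>

lemma integral_drift_nonneg:
  fixes B Z :: "real ^ 'n \<Rightarrow> real ^ 'n"
  assumes K: "open K" and B: "locally_integrable K B"
    and test: "\<And>\<phi>. \<phi> \<in> test_functions K \<Longrightarrow> (\<And>x. 0 \<le> \<phi> x) \<Longrightarrow> 0 \<le> (LINT x:K|lebesgue. B x \<bullet> gradient \<phi> x)"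
    and \<zeta>: "continuous_on UNIV \<zeta>" "\<And>x. 0 \<le> \<zeta> x" and Z: "continuous_on UNIV Z"
    and C: "compact C" "C \<subseteq> K" "\<And>x. x \<notin> C \<Longrightarrow> \<zeta> x = 0"
    and part: "\<And>x i. has_partial \<zeta> i (Z x $ i) x"
  shows "0 \<le> (LINT x:K|lebesgue. B x \<bullet> Z x)"
proof -
  \<comment> \<open>A margin around the support: mollifications of radius at most
    \<open>\<eta>\<close> remain supported in one compact subset of \<open>K\<close>, where
    \<open>B\<close> is integrable.\<close>
  obtain \<eta> where \<eta>: "\<eta> > 0" "(\<Union>x\<in>C. cball x \<eta>) \<subseteq> K"
    using compact_subset_open_imp_cball_epsilon_subset[OF C(1) K C(2)] by blast
  define C' where "C' = (\<Union>x\<in>C. cball x \<eta>)"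
  have C': "compact C'" "C' \<subseteq> K" unfolding C'_def using compact_minkowski_sum_cball[OF C(1)] \<eta> by auto
  define e where "e = (\<lambda>n. \<eta> * inverse (real (Suc n)))"
  have e: "0 < e n" "e n \<le> \<eta>" for n using \<eta>(1) by (auto simp: e_def field_simps)
  have e0: "e \<longlonglongrightarrow> 0" unfolding e_def using tendsto_mult_right_zero[OF LIMSEQ_inverse_real_of_nat] by simp
  have "\<exists>\<rho> :: real ^ 'n \<Rightarrow> real. mollifier (e n) \<rho>" for n
    using mollifiers_exist[where 'n = 'n] e(1)[of n] by metis
  then obtain \<rho> :: "nat \<Rightarrow> real ^ 'n \<Rightarrow> real" where \<rho>: "\<And>n. mollifier (e n) (\<rho> n)" by metis
  have b: "bump (e n) (\<rho> n)" "0 \<le> \<rho> n x" for n x using \<rho>[of n] by (auto simp: mollifier_def)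
  have Zc: "continuous_on UNIV (\<lambda>x. Z x $ i)" for i by (intro continuous_intros Z)
  have Z0: "Z x $ i = 0" if "x \<notin> C" for x i
    using has_partial_zero_outside[OF C(1,3) part that] .
  obtain M where M: "M > 0" "\<And>x. norm (Z x) \<le> M"
    using continuous_compact_support_bounded[OF Z C(1)] Z0 by (auto simp: vec_eq_iff)
  have \<zeta>i: "integrable lebesgue \<zeta>" by (rule integrable_continuous_compact_support(2)[OF \<zeta>(1) C(1,3)])
  have Zi: "integrable lebesgue (\<lambda>x. Z x $ i)" for i
    by (rule integrable_continuous_compact_support(2)[OF Zc C(1) Z0])
  define f where "f = (\<lambda>n. conv \<zeta> (\<rho> n))"
  have out: "y \<notin> C" if "x \<notin> C'" "y \<in> cball x (e n)" for x y n
  proof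
    assume "y \<in> C"
    moreover have "x \<in> cball y \<eta>" using that(2) e(2)[of n] by (simp add: dist_commute)
    ultimately show False using that(1) unfolding C'_def by blast
  qed
  have g: "gradient (f n) x $ i = conv (\<lambda>x. Z x $ i) (\<rho> n) x" for n x i
    unfolding f_def by (rule gradient_conv_partial[OF \<zeta>(1) Zc C(1,3) part b(1)])
  have g0: "gradient (f n) x = 0" if "x \<notin> C'" for n x
    using conv_eq_0[OF b(1)] Z0 out[OF that] unfolding vec_eq_iff g by auto
  have fC: "class_C k (f n)" for k n unfolding f_def by (rule class_C_conv[OF \<zeta>i b(1)])
  have f0: "f n x = 0" if "x \<notin> C'" for n x
    unfolding f_def by (rule conv_eq_0[OF b(1)]) (use out[OF that] C(3) in blast)
  have "0 \<le> (LINT x:K|lebesgue. B x \<bullet> gradient (f n) x)" for n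
  proof (rule test)
    show "f n \<in> test_functions K" by (rule test_functionI[OF fC C' f0])
    show "0 \<le> f n x" for x unfolding f_def by (rule conv_ge[OF \<zeta>i \<rho> \<zeta>(2)])
  qed
  moreover have "(\<lambda>n. LINT x:K|lebesgue. B x \<bullet> gradient (f n) x) \<longlonglongrightarrow> (LINT x:K|lebesgue. B x \<bullet> Z x)"
  proof -
    have BI: "integrable lebesgue (\<lambda>x. indicator C' x *\<^sub>R B x)"
      using B C' by (auto simp: locally_integrable_def set_integrable_def)
    have s: "indicator K x *\<^sub>R (B x \<bullet> g) = (indicator C' x *\<^sub>R B x) \<bullet> g" if "x \<notin> C' \<Longrightarrow> g = 0" for x g
      using that C'(2) by (auto simp: indicator_def)
    have CC': "C \<subseteq> C'" unfolding C'_def using \<eta>(1) by force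
    have Z0': "Z x = 0" if "x \<notin> C'" for x using Z0 that CC' by (auto simp: vec_eq_iff)
    have "(\<lambda>n. LINT x|lebesgue. (indicator C' x *\<^sub>R B x) \<bullet> gradient (f n) x) \<longlonglongrightarrow>
        (LINT x|lebesgue. (indicator C' x *\<^sub>R B x) \<bullet> Z x)"
    proof (rule integral_dominated_convergence)
      show "(\<lambda>x. (indicator C' x *\<^sub>R B x) \<bullet> Z x) \<in> borel_measurable lebesgue"
        by (rule borel_measurable_inner[OF borel_measurable_integrable[OF BI] continuous_borel_measurable(2)[OF Z]])
      show "(\<lambda>x. (indicator C' x *\<^sub>R B x) \<bullet> gradient (f n) x) \<in> borel_measurable lebesgue" for n
        by (rule borel_measurable_inner[OF borel_measurable_integrable[OF BI] continuous_borel_measurable(2)[OF continuous_gradient[OF fC]]])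
      \<comment> \<open>Averages of a component of \<open>Z\<close> stay between \<open>- M\<close>
        and \<open>M\<close>; the factor \<open>CARD('n)\<close> comes from estimating the norm by
        the sum of the components.\<close>
      show "integrable lebesgue (\<lambda>x. norm (indicator C' x *\<^sub>R B x) * (real CARD('n) * M))"
        using BI by (intro integrable_mult_left integrable_norm)
      have "(\<lambda>n. gradient (f n) x) \<longlonglongrightarrow> Z x" for x
      proof (rule vec_tendstoI)
        fix i
        show "(\<lambda>n. gradient (f n) x $ i) \<longlonglongrightarrow> Z x $ i" unfolding g
        proof (rule LIMSEQ_I)
          fix r :: real assume "r > 0"
          then obtain d where d: "d > 0" "\<And>y. dist y x < d \<Longrightarrow> dist (Z y $ i) (Z x $ i) < r / 2"
            using Zc[of i] unfolding continuous_on_iff by (metis UNIV_I half_gt_zero)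
          obtain N where N: "\<And>n. n \<ge> N \<Longrightarrow> e n < d"
            using order_tendstoD(2)[OF e0 d(1)] by (auto simp: eventually_sequentially)
          have "norm (conv (\<lambda>x. Z x $ i) (\<rho> n) x - Z x $ i) < r" if n: "n \<ge> N" for n
          proof -
            have cl: "\<bar>Z y $ i - Z x $ i\<bar> < r / 2" if "y \<in> cball x (e n)" for y
              using d(2)[of y] that N[OF n] by (simp add: dist_commute dist_real_def abs_minus_commute)
            have "conv (\<lambda>x. Z x $ i) (\<rho> n) x \<le> Z x $ i + r / 2"
              by (rule conv_le[OF Zi \<rho>]) (drule cl, linarith)
            moreover have "Z x $ i - r / 2 \<le> conv (\<lambda>x. Z x $ i) (\<rho> n) x"
              by (rule conv_ge[OF Zi \<rho>]) (drule cl, linarith)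
            ultimately show ?thesis using \<open>r > 0\<close> by (simp add: abs_le_iff)
          qed
          then show "\<exists>no. \<forall>n\<ge>no. norm (conv (\<lambda>x. Z x $ i) (\<rho> n) x - Z x $ i) < r" by blast
        qed
      qed
      then have "(\<lambda>n. (indicator C' x *\<^sub>R B x) \<bullet> gradient (f n) x) \<longlonglongrightarrow> (indicator C' x *\<^sub>R B x) \<bullet> Z x" for x
        by (intro tendsto_inner tendsto_const)
      then show "AE x in lebesgue. (\<lambda>n. (indicator C' x *\<^sub>R B x) \<bullet> gradient (f n) x) \<longlonglongrightarrow>
          (indicator C' x *\<^sub>R B x) \<bullet> Z x" by simp
      have "norm (gradient (f n) x) \<le> real CARD('n) * M" for n x
      proof -
        have "\<bar>gradient (f n) x $ i\<bar> \<le> M" for i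
        proof -
          have Zb: "- M \<le> Z y $ i" "Z y $ i \<le> M" for y
            using M(2)[of y] component_le_norm_cart[of "Z y" i] by linarith+
          show ?thesis unfolding g using conv_le[OF Zi \<rho> Zb(2)] conv_ge[OF Zi \<rho> Zb(1)]
            by (simp add: abs_le_iff minus_le_iff)
        qed
        then have "(\<Sum>i\<in>UNIV. \<bar>gradient (f n) x $ i\<bar>) \<le> (\<Sum>i\<in>(UNIV::'n set). M)" by (rule sum_mono)
        then show ?thesis using norm_le_l1_cart[of "gradient (f n) x"] by simp
      qed
      then have "norm ((indicator C' x *\<^sub>R B x) \<bullet> gradient (f n) x) \<le> norm (indicator C' x *\<^sub>R B x) * (real CARD('n) * M)" for n x
        unfolding real_norm_def
        by (rule order_trans[OF Cauchy_Schwarz_ineq2 mult_left_mono]) simp_all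
      then show "AE x in lebesgue. norm ((indicator C' x *\<^sub>R B x) \<bullet> gradient (f n) x)
          \<le> norm (indicator C' x *\<^sub>R B x) * (real CARD('n) * M)" for n by blast
    qed
    moreover have "indicator K x *\<^sub>R (B x \<bullet> gradient (f n) x) = (indicator C' x *\<^sub>R B x) \<bullet> gradient (f n) x"
      "indicator K x *\<^sub>R (B x \<bullet> Z x) = (indicator C' x *\<^sub>R B x) \<bullet> Z x" for n x
      using s g0 Z0' by blast+
    ultimately show ?thesis unfolding set_lebesgue_integral_def by presburger
  qed
  ultimately show ?thesis by (intro LIMSEQ_le_const) auto
qed

subsection \<open>The integrated maximum principle\<close>

text \<open>A convex C2 substitute for the positive part. Cubic growth at 0 makes the second
  derivative continuous there, and linear growth at infinity gives \<open>hinge'\<close> at most 1,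
  so that the error enters only through its L1 norm.\<close>

definition hinge :: "real \<Rightarrow> real" where "hinge t = max t 0 ^ 3 / (1 + max t 0) ^ 2"
definition hinge' :: "real \<Rightarrow> real" where
  "hinge' t = max t 0 ^ 2 * (max t 0 + 3) / (1 + max t 0) ^ 3"
definition hinge'' :: "real \<Rightarrow> real" where "hinge'' t = 6 * max t 0 / (1 + max t 0) ^ 4"

text \<open>Settles the junction at 0 for both \<open>hinge\<close> and
  \<open>hinge'\<close>.\<close>

lemma DERIV_0_if_quadratic:
  fixes f :: "real \<Rightarrow> real"
  assumes "\<And>t. \<bar>f t\<bar> \<le> c * t\<^sup>2"
  shows "(f has_real_derivative 0) (at 0)"
proof -
  have "f 0 = 0" using assms[of 0] by simp
  have "((\<lambda>h. f h / h) \<longlongrightarrow> 0) (at 0)"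
  proof (rule Lim_null_comparison)
    show "\<forall>\<^sub>F h in at 0. norm (f h / h) \<le> c * \<bar>h\<bar>"
    proof (rule always_eventually, rule allI)
      fix h show "norm (f h / h) \<le> c * \<bar>h\<bar>"
      proof (cases "h = 0")
        case False
        then have "\<bar>f h\<bar> / \<bar>h\<bar> \<le> c * h\<^sup>2 / \<bar>h\<bar>" by (intro divide_right_mono assms) auto
        also have "\<dots> = c * \<bar>h\<bar>" using False by (simp add: power2_eq_square abs_if)
        finally show ?thesis by simp
      qed simp
    qed
    show "((\<lambda>h. c * \<bar>h\<bar>) \<longlongrightarrow> 0) (at 0)" by (auto intro!: tendsto_eq_intros)
  qed
  then show ?thesis using \<open>f 0 = 0\<close> by (simp add: DERIV_def)
qed

lemma hinge_bound: "\<bar>hinge t\<bar> \<le> 1 * t\<^sup>2"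
proof -
  define p where "p = max t 0"
  have p: "p \<ge> 0" by (simp add: p_def)
  have "p ^ 3 \<le> p\<^sup>2 * (1 + p)\<^sup>2"
  proof -
    have "p \<le> (1 + p)\<^sup>2" using p by (simp add: power2_eq_square algebra_simps)
    then have "p\<^sup>2 * p \<le> p\<^sup>2 * (1 + p)\<^sup>2" by (intro mult_left_mono) auto
    then show ?thesis by (simp add: power3_eq_cube power2_eq_square mult_ac)
  qed
  then have "hinge t \<le> p\<^sup>2" using p by (simp add: hinge_def p_def[symmetric] divide_le_eq)
  also have "p\<^sup>2 \<le> t\<^sup>2" by (simp add: p_def max_def)
  finally show ?thesis using p by (simp add: hinge_def p_def[symmetric])
qed

lemma hinge'_bound: "\<bar>hinge' t\<bar> \<le> 3 * t\<^sup>2"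
proof -
  define p where "p = max t 0"
  have p: "p \<ge> 0" by (simp add: p_def)
  have "p + 3 \<le> 3 * (1 + p) ^ 3" using p by (simp add: power3_eq_cube algebra_simps)
  then have "p\<^sup>2 * (p + 3) \<le> p\<^sup>2 * (3 * (1 + p) ^ 3)" by (intro mult_left_mono) auto
  then have "hinge' t \<le> 3 * p\<^sup>2" using p by (simp add: hinge'_def p_def[symmetric] divide_le_eq mult_ac)
  also have "p\<^sup>2 \<le> t\<^sup>2" by (simp add: p_def max_def)
  finally show ?thesis using p by (simp add: hinge'_def p_def[symmetric])
qed

lemma hinge_DERIV: "(hinge has_real_derivative hinge' t) (at t)"
proof (cases t "0 :: real" rule: linorder_cases)
  case less
  have "(hinge has_real_derivative 0) (at t)"
    by (rule has_field_derivative_transform_within_open[where f = "\<lambda>_. 0" and S = "{..<0}"])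
       (use less in \<open>auto simp: hinge_def\<close>)
  then show ?thesis using less by (simp add: hinge'_def)
next
  case equal
  then show ?thesis using DERIV_0_if_quadratic[OF hinge_bound] by (simp add: hinge'_def)
next
  case greater
  have "((\<lambda>t. t ^ 3 / (1 + t) ^ 2) has_real_derivative hinge' t) (at t)"
    using greater
    by (auto intro!: derivative_eq_intros simp: hinge'_def divide_simps)
       (simp add: algebra_simps power2_eq_square power3_eq_cube power4_eq_xxxx)
  then show ?thesis
    by (rule has_field_derivative_transform_within_open[where S = "{0<..}"])
       (use greater in \<open>auto simp: hinge_def\<close>)
qed

lemma hinge'_DERIV: "(hinge' has_real_derivative hinge'' t) (at t)"
proof (cases t "0 :: real" rule: linorder_cases)
  case less
  have "(hinge' has_real_derivative 0) (at t)"
    by (rule has_field_derivative_transform_within_open[where f = "\<lambda>_. 0" and S = "{..<0}"])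
       (use less in \<open>auto simp: hinge'_def\<close>)
  then show ?thesis using less by (simp add: hinge''_def)
next
  case equal
  then show ?thesis using DERIV_0_if_quadratic[OF hinge'_bound] by (simp add: hinge''_def)
next
  case greater
  \<comment> \<open>As a polynomial in \<open>w = inverse (1 + t)\<close> the function is
    differentiated without quotients.\<close>
  have e: "t\<^sup>2 * (t + 3) / (1 + t) ^ 3 = 1 - 3 * inverse (1 + t) ^ 2 + 2 * inverse (1 + t) ^ 3" if "t > 0" for t :: real
  proof -
    define w where "w = inverse (1 + t)"
    have w: "(1 + t) * w = 1" using that by (simp add: w_def)
    have "t\<^sup>2 * (t + 3) * w ^ 3 = ((1 + t) * w) ^ 3 - 3 * ((1 + t) * w) * w\<^sup>2 + 2 * w ^ 3"
      by (simp add: power2_eq_square power3_eq_cube algebra_simps)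
    then have "t\<^sup>2 * (t + 3) * w ^ 3 = 1 - 3 * w\<^sup>2 + 2 * w ^ 3" unfolding w by simp
    then show ?thesis by (simp add: w_def divide_inverse power_inverse)
  qed
  define w where "w = inverse (1 + t)"
  have w: "t * w = 1 - w" using greater by (simp add: w_def field_simps)
  have "((\<lambda>t. 1 - 3 * inverse (1 + t) ^ 2 + 2 * inverse (1 + t) ^ 3) has_real_derivative 6 * w ^ 3 - 6 * w ^ 4) (at t)"
    using greater by (auto intro!: derivative_eq_intros simp: w_def power_numeral_reduce)
  also have "6 * w ^ 3 - 6 * w ^ 4 = 6 * (1 - w) * w ^ 3" by (simp add: power_numeral_reduce algebra_simps)
  also have "\<dots> = 6 * t * w ^ 4" unfolding w[symmetric] by (simp add: power_numeral_reduce)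
  also have "\<dots> = hinge'' t" using greater by (simp add: hinge''_def w_def divide_inverse power_inverse)
  finally show ?thesis
    by (rule has_field_derivative_transform_within_open[where S = "{0<..}"])
       (use greater e in \<open>auto simp: hinge'_def\<close>)
qed

lemma hinge_nonneg: "0 \<le> hinge t" "0 \<le> hinge' t" "0 \<le> hinge'' t"
  by (auto simp: hinge_def hinge'_def hinge''_def)

lemma hinge'_le_1: "hinge' t \<le> 1"
proof -
  define p where "p = max t 0"
  have p: "p \<ge> 0" by (simp add: p_def)
  have "p\<^sup>2 * (p + 3) \<le> (1 + p) ^ 3" using p by (simp add: power3_eq_cube power2_eq_square algebra_simps)
  then show ?thesis using p by (simp add: hinge'_def p_def[symmetric] divide_le_eq)
qed

lemma hinge_mono: "s \<le> t \<Longrightarrow> hinge s \<le> hinge t"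
  by (rule DERIV_nonneg_imp_nondecreasing) (use hinge_DERIV hinge_nonneg in blast)+

lemma hinge_pos: "t > 0 \<Longrightarrow> hinge t > 0"
  by (auto simp: hinge_def)

lemma hinge_eq_0: "t \<le> 0 \<Longrightarrow> hinge t = 0" "t \<le> 0 \<Longrightarrow> hinge' t = 0" "t \<le> 0 \<Longrightarrow> hinge'' t = 0"
  by (auto simp: hinge_def hinge'_def hinge''_def)

lemma continuous_hinge: "continuous_on S hinge" "continuous_on S hinge'" "continuous_on S hinge''"
  by (intro continuous_at_imp_continuous_on ballI DERIV_isCont[OF hinge_DERIV])
     (intro continuous_at_imp_continuous_on ballI DERIV_isCont[OF hinge'_DERIV],
      unfold hinge''_def, auto intro!: continuous_intros simp: add_nonneg_eq_0_iff)

text \<open>The open sets \<open>S\<close> and \<open>- C\<close> cover the space, and on their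
  overlap both descriptions give 0.\<close>

lemma continuous_on_extend_by_zero:
  fixes f :: "'a :: t2_space \<Rightarrow> 'b :: real_normed_vector"
  assumes "open S" "continuous_on S f" "compact C" "C \<subseteq> S" "\<And>x. x \<in> S \<Longrightarrow> x \<notin> C \<Longrightarrow> f x = 0"
  shows "continuous_on UNIV (\<lambda>x. if x \<in> S then f x else 0)"
proof -
  have "continuous_on (S \<union> - C) (\<lambda>x. if x \<in> S then f x else 0)"
  proof (rule continuous_on_open_Un)
    show "continuous_on S (\<lambda>x. if x \<in> S then f x else 0)" using assms(2) by (simp cong: continuous_on_cong)
    have "continuous_on (- C) (\<lambda>x. 0 :: 'b)" by simp
    then show "continuous_on (- C) (\<lambda>x. if x \<in> S then f x else 0)"
      by (rule continuous_on_eq) (use assms(5) in auto)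
  qed (use assms compact_imp_closed in auto)
  moreover have "S \<union> - C = UNIV" using assms(4) by auto
  ultimately show ?thesis by simp
qed

text \<open>The sign of the weak divergence makes \<open>-\<Delta>\<phi> - B \<bullet> \<nabla>\<phi>\<close> a usable adjoint: integrating a smooth
  convex function of \<open>z\<close> against a strict supersolution \<open>\<phi> = c - exp (\<Lambda> x\<^sub>k)\<close> of it bounds
  the positive part of \<open>z\<close> by the \<open>L\<^sup>1\<close> norm of the error \<open>e\<close>.\<close>

lemma integral_hinge_le:
  fixes B P H :: "real ^ 'n \<Rightarrow> real ^ 'n" and z e :: "real ^ 'n \<Rightarrow> real"
  assumes K: "open K" "locally_integrable K B"
    and test: "\<And>\<phi>. \<phi> \<in> test_functions K \<Longrightarrow> (\<And>x. 0 \<le> \<phi> x) \<Longrightarrow> 0 \<le> (LINT x:K|lebesgue. B x \<bullet> gradient \<phi> x)"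
    and S: "open S" "S \<subseteq> K" "\<And>x. x \<in> S \<Longrightarrow> norm x \<le> d" and C: "compact C" "C \<subseteq> S"
    and z: "continuous_on S z" "continuous_on S P" "continuous_on S H"
      "\<And>x i. x \<in> S \<Longrightarrow> has_partial z i (P x $ i) x"
      "\<And>x i. x \<in> S \<Longrightarrow> has_partial (\<lambda>y. P y $ i) i (H x $ i) x"
      "\<And>x. x \<in> S \<Longrightarrow> x \<notin> C \<Longrightarrow> z x \<le> 0"
    and \<Lambda>: "\<And>x. x \<in> S \<Longrightarrow> norm (B x) + 1 \<le> \<Lambda>" "\<Lambda> \<ge> 1"
    and e: "integrable lebesgue e" "\<And>x. 0 \<le> e x"
      "\<And>x. x \<in> S \<Longrightarrow> - (\<Sum>i\<in>UNIV. H x $ i) + B x \<bullet> P x \<le> e x"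
  shows "integrable lebesgue (\<lambda>x. if x \<in> S then hinge (z x) else 0)"
    "exp (- \<Lambda> * d) * (LINT x|lebesgue. (if x \<in> S then hinge (z x) else 0))
    \<le> exp (\<Lambda> * d) * (LINT x|lebesgue. e x)"
proof -
  \<comment> \<open>Any coordinate direction will do.\<close>
  obtain k :: 'n where True by simp
  define E where "E = (\<lambda>x :: real ^ 'n. exp (\<Lambda> * x $ k))"
  \<comment> \<open>Here \<open>-\<Delta>\<phi> - B \<bullet> \<nabla>\<phi> = \<Lambda> * E *
    (\<Lambda> + B $ k)\<close>. Since \<open>\<Lambda>\<close> exceeds the norm of \<open>B\<close>
    on \<open>S\<close> by 1 and is itself at least 1, this is at least \<open>E\<close>, hence at
    least \<open>exp (- \<Lambda> * d)\<close> on \<open>S\<close>. The constant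
    \<open>exp (\<Lambda> * d)\<close> makes \<open>\<phi>\<close> nonnegative on \<open>S\<close>
    and bounds it there.\<close>
  define \<phi> where "\<phi> = (\<lambda>x. exp (\<Lambda> * d) - E x)"
  define \<phi>1 where "\<phi>1 = (\<lambda>i x. if i = k then - \<Lambda> * E x else 0)"
  define \<phi>2 where "\<phi>2 = (\<lambda>i x. if i = k then - \<Lambda>\<^sup>2 * E x else 0)"
  define s where "s = (\<lambda>x. if x \<in> S then hinge (z x) else 0)"
  define s1 where "s1 = (\<lambda>i x. if x \<in> S then hinge' (z x) * P x $ i else 0)"
  define s2 where "s2 = (\<lambda>i x. if x \<in> S then hinge' (z x) * H x $ i + hinge'' (z x) * (P x $ i)\<^sup>2 else 0)"
  have zc: "continuous_on S (\<lambda>x. h (z x))" if "continuous_on UNIV h" for h :: "real \<Rightarrow> real"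
    by (rule continuous_on_compose2[OF that z(1)]) simp
  have Pc: "continuous_on S (\<lambda>x. P x $ i)" "continuous_on S (\<lambda>x. H x $ i)" for i
    by (intro continuous_intros z)+
  have hc: "continuous_on S (\<lambda>x. hinge (z x))" "continuous_on S (\<lambda>x. hinge' (z x))" "continuous_on S (\<lambda>x. hinge'' (z x))"
    by (intro zc continuous_hinge)+
  have sc: "continuous_on UNIV s" unfolding s_def
    by (rule continuous_on_extend_by_zero[OF S(1) hc(1) C]) (use z(6) in \<open>auto simp: hinge_eq_0\<close>)
  have s1c: "continuous_on UNIV (s1 i)" for i unfolding s1_def
    by (rule continuous_on_extend_by_zero[OF S(1) _ C])
       (use z(6) in \<open>auto simp: hinge_eq_0 intro!: continuous_intros hc Pc\<close>)
  have s2c: "continuous_on UNIV (s2 i)" for i unfolding s2_def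
    by (rule continuous_on_extend_by_zero[OF S(1) _ C])
       (use z(6) in \<open>auto simp: hinge_eq_0 intro!: continuous_intros hc Pc\<close>)
  have s0: "s x = 0" "s1 i x = 0" "s2 i x = 0" if "x \<notin> C" for x i
    using that z(6)[of x] by (auto simp: s_def s1_def s2_def hinge_eq_0)
  have Ec: "continuous_on UNIV E" unfolding E_def by (intro continuous_intros)
  have \<phi>c: "continuous_on UNIV \<phi>" "continuous_on UNIV (\<phi>1 i)" "continuous_on UNIV (\<phi>2 i)" for i
    unfolding \<phi>_def \<phi>1_def \<phi>2_def by (cases "i = k"; auto intro!: continuous_intros Ec)+
  have C': "open (- C)" using C(1) by (simp add: compact_imp_closed open_Compl)
  have cover: "x \<in> S \<or> x \<in> - C" for x using C(2) by auto
  have p1: "has_partial s i (s1 i x) x" for i x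
  proof (cases "x \<in> S")
    case True
    have "has_partial (\<lambda>x. hinge (z x)) i (hinge' (z x) * P x $ i) x"
      by (rule has_partial_chain[OF z(4)[OF True] hinge_DERIV])
    then have "has_partial s i (hinge' (z x) * P x $ i) x"
      by (rule has_partial_transform[OF _ S(1) True]) (simp add: s_def)
    then show ?thesis using True by (simp add: s1_def)
  next
    case False
    then have x: "x \<in> - C" using cover by blast
    have "has_partial s i 0 x" by (rule has_partial_transform[OF has_partial_const[of 0] C' x]) (use s0 in auto)
    then show ?thesis using s0(2)[of x] x by simp
  qed
  have p2: "has_partial (s1 i) i (s2 i x) x" for i x
  proof (cases "x \<in> S")
    case True
    have "has_partial (\<lambda>x. hinge' (z x) * P x $ i) i (hinge'' (z x) * P x $ i * P x $ i + H x $ i * hinge' (z x)) x"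
      by (rule has_partial_mult[OF has_partial_chain[OF z(4)[OF True] hinge'_DERIV] z(5)[OF True]])
    then have "has_partial (s1 i) i (hinge'' (z x) * P x $ i * P x $ i + H x $ i * hinge' (z x)) x"
      by (rule has_partial_transform[OF _ S(1) True]) (simp add: s1_def)
    then show ?thesis using True by (simp add: s2_def power2_eq_square algebra_simps)
  next
    case False
    then have x: "x \<in> - C" using cover by blast
    have "has_partial (s1 i) i 0 x" by (rule has_partial_transform[OF has_partial_const[of 0] C' x]) (use s0 in auto)
    then show ?thesis using s0(3)[of x] x by simp
  qed
  have pE: "has_partial E i (if i = k then \<Lambda> * E x else 0) x" for i x
  proof -
    have "has_partial (\<lambda>x. exp (\<Lambda> * x $ k)) i (exp (\<Lambda> * x $ k) * \<Lambda> * (if i = k then 1 else 0)) x"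
      by (rule has_partial_chain[OF has_partial_component, of "\<lambda>t. exp (\<Lambda> * t)"])
         (auto intro!: derivative_eq_intros)
    then show ?thesis unfolding E_def by (rule has_partial_eq) auto
  qed
  have q1: "has_partial \<phi> i (\<phi>1 i x) x" for i x
    unfolding \<phi>_def by (rule has_partial_eq[OF has_partial_diff[OF has_partial_const pE]]) (simp add: \<phi>1_def)
  have q2: "has_partial (\<phi>1 i) i (\<phi>2 i x) x" for i x
  proof (cases "i = k")
    case True
    have "has_partial (\<lambda>x. - \<Lambda> * E x) i (0 * E x + \<Lambda> * E x * - \<Lambda>) x"
      using has_partial_mult[OF has_partial_const[of "- \<Lambda>"] pE[of i x]] True by simp
    then show ?thesis using True by (simp add: \<phi>1_def \<phi>2_def power2_eq_square mult_ac)
  qed (simp add: \<phi>1_def \<phi>2_def has_partial_const)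
  have E: "exp (- \<Lambda> * d) \<le> E x" "E x \<le> exp (\<Lambda> * d)" if "x \<in> S" for x
  proof -
    have "\<bar>x $ k\<bar> \<le> d" using S(3)[OF that] component_le_norm_cart[of x k] by linarith
    then have "\<bar>\<Lambda> * x $ k\<bar> \<le> \<Lambda> * d" using \<Lambda>(2) by (simp add: abs_mult mult_left_mono)
    then show "exp (- \<Lambda> * d) \<le> E x" "E x \<le> exp (\<Lambda> * d)" by (auto simp: E_def abs_le_iff)
  qed
  \<comment> \<open>Outside \<open>S\<close> the function \<open>\<phi>\<close> may be negative, but
    \<open>s\<close> vanishes there; the product is nonnegative, C1 and compactly supported, so the
    sign of the divergence applies to its gradient \<open>Z\<close>.\<close>
  define \<zeta> where "\<zeta> = (\<lambda>x. \<phi> x * s x)"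
  define Z where "Z = (\<lambda>x. \<chi> i. \<phi>1 i x * s x + s1 i x * \<phi> x)"
  have Zc: "continuous_on UNIV Z" unfolding Z_def by (intro continuous_intros \<phi>c sc s1c)
  have Z0: "Z x = 0" if "x \<notin> C" for x using s0[OF that] by (simp add: Z_def vec_eq_iff)
  have I1: "0 \<le> (LINT x:K|lebesgue. B x \<bullet> Z x)"
  proof (rule integral_drift_nonneg[where \<zeta> = \<zeta> and C = C, OF K test])
    show "continuous_on UNIV \<zeta>" unfolding \<zeta>_def by (intro continuous_intros \<phi>c sc)
    show "0 \<le> \<zeta> x" for x
      using E(2)[of x] hinge_nonneg by (auto simp: \<zeta>_def s_def \<phi>_def intro!: mult_nonneg_nonneg)
    show "has_partial \<zeta> i (Z x $ i) x" for x i
      unfolding \<zeta>_def Z_def by (rule has_partial_eq[OF has_partial_mult[OF q1 p1]]) simp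
  qed (use C S(2) s0 Zc in \<open>auto simp: \<zeta>_def\<close>)
  \<comment> \<open>Green's second identity: \<open>W i\<close> is the \<open>i\<close>-th
    derivative of \<open>s1 i * \<phi> - \<phi>1 i * s\<close>, because the mixed products cancel,
    and its integral is 0.\<close>
  define W where "W = (\<lambda>i x. s2 i x * \<phi> x - \<phi>2 i x * s x)"
  have I2: "(LINT x|lebesgue. W i x) = 0" for i
  proof (rule integral_partial_eq_0[of "\<lambda>x. s1 i x * \<phi> x - \<phi>1 i x * s x" _ C i])
    show "has_partial (\<lambda>x. s1 i x * \<phi> x - \<phi>1 i x * s x) i (W i x) x" for x
      by (rule has_partial_eq[OF has_partial_diff[OF has_partial_mult[OF p2 q1] has_partial_mult[OF q2 p1]]])
         (simp add: W_def algebra_simps)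
  qed (use C s0 in \<open>auto simp: W_def intro!: continuous_intros sc s1c s2c \<phi>c\<close>)
  have Wi: "integrable lebesgue (W i)" for i
    by (rule integrable_continuous_compact_support(2)[OF _ C(1)])
       (use s0 in \<open>auto simp: W_def intro!: continuous_intros sc s2c \<phi>c\<close>)
  have si: "integrable lebesgue s" by (rule integrable_continuous_compact_support(2)[OF sc C(1) s0(1)])
  have BZ: "integrable lebesgue (\<lambda>x. indicator K x *\<^sub>R (B x \<bullet> Z x))"
  proof -
    have BC: "integrable lebesgue (\<lambda>x. indicator C x *\<^sub>R B x)"
      using K(2) C S(2) by (auto simp: locally_integrable_def set_integrable_def)
    have BCi: "integrable lebesgue (\<lambda>x. (indicator C x *\<^sub>R B x) $ i)" for i
      by (rule integrable_bounded_linear[OF bounded_linear_vec_nth BC])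
    have Zci: "continuous_on UNIV (\<lambda>x. Z x $ i)" for i by (intro continuous_intros Zc)
    have "integrable lebesgue (\<lambda>x. (indicator C x *\<^sub>R B x) $ i * Z x $ i)" for i
    proof -
      have m: "(\<lambda>x. Z x $ i) \<in> borel_measurable lebesgue" by (rule continuous_borel_measurable(2)[OF Zci])
      obtain M where "\<And>x. norm (Z x $ i) \<le> M"
        using continuous_compact_support_bounded[OF Zci C(1)] Z0 by (metis zero_index)
      then show ?thesis using integrable_mult_bounded[OF BCi m] by auto
    qed
    then have "integrable lebesgue (\<lambda>x. (indicator C x *\<^sub>R B x) \<bullet> Z x)"
      unfolding inner_vec_def inner_real_def by (intro Bochner_Integration.integrable_sum)
    moreover have "(\<lambda>x. (indicator C x *\<^sub>R B x) \<bullet> Z x) = (\<lambda>x. indicator K x *\<^sub>R (B x \<bullet> Z x))"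
      using Z0 C(2) S(2) by (auto simp: indicator_def fun_eq_iff)
    ultimately show ?thesis by simp
  qed
  \<comment> \<open>The integrated argument in pointwise form. In
    \<open>(\<Sum>i\<in>UNIV. W i x) - B x \<bullet> Z x\<close> the terms with \<open>hinge\<close>
    give the strict supersolution property of \<open>\<phi>\<close>, those with
    \<open>hinge'\<close> give the differential inequality for \<open>z\<close>, and the one with
    \<open>hinge''\<close> is nonnegative by convexity and is dropped.\<close>
  have pw: "exp (- \<Lambda> * d) * s x \<le> exp (\<Lambda> * d) * e x + (\<Sum>i\<in>UNIV. W i x) - indicator K x *\<^sub>R (B x \<bullet> Z x)" for x
  proof (cases "x \<in> S")
    case False
    then have "x \<notin> C" using C(2) by auto
    then show ?thesis using e(2)[of x] s0[of x] Z0[of x] by (simp add: W_def)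
  next
    case True
    have xK: "x \<in> K" using True S(2) by auto
    define h h1 h2 where "h = hinge (z x)" and "h1 = hinge' (z x)" and "h2 = hinge'' (z x)"
    have h: "0 \<le> h" "0 \<le> h1" "0 \<le> h2" "h1 \<le> 1"
      unfolding h_def h1_def h2_def using hinge_nonneg hinge'_le_1 by auto
    have ph: "0 \<le> \<phi> x" "\<phi> x \<le> exp (\<Lambda> * d)" using E[OF True] by (auto simp: \<phi>_def E_def)
    have sW: "(\<Sum>i\<in>UNIV. W i x) = \<phi> x * (h1 * (\<Sum>i\<in>UNIV. H x $ i) + h2 * (P x \<bullet> P x)) + \<Lambda>\<^sup>2 * E x * h"
    proof -
      have "(\<Sum>i\<in>UNIV. W i x) = (\<Sum>i\<in>UNIV. \<phi> x * (h1 * H x $ i + h2 * (P x $ i * P x $ i))) - (\<Sum>i\<in>UNIV. \<phi>2 i x * h)"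
        unfolding W_def using True by (simp add: s2_def s_def h_def h1_def h2_def sum_subtractf power2_eq_square mult_ac)
      also have "(\<Sum>i\<in>UNIV. \<phi>2 i x * h) = - \<Lambda>\<^sup>2 * E x * h"
        by (simp add: \<phi>2_def if_distrib[where f = "\<lambda>a. a * h"] cong: if_cong)
      also have "(\<Sum>i\<in>UNIV. \<phi> x * (h1 * H x $ i + h2 * (P x $ i * P x $ i))) =
          \<phi> x * (h1 * (\<Sum>i\<in>UNIV. H x $ i) + h2 * (P x \<bullet> P x))"
        by (simp add: inner_vec_def sum.distrib sum_distrib_left distrib_left mult.assoc)
      finally show ?thesis by simp
    qed
    have BZx: "B x \<bullet> Z x = - \<Lambda> * E x * h * B x $ k + \<phi> x * h1 * (B x \<bullet> P x)"
    proof -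
      have "B x \<bullet> Z x = (\<Sum>i\<in>UNIV. B x $ i * (\<phi>1 i x * h)) + (\<Sum>i\<in>UNIV. B x $ i * (h1 * P x $ i * \<phi> x))"
        using True by (simp add: inner_vec_def Z_def s_def s1_def h_def h1_def distrib_left sum.distrib)
      also have "(\<Sum>i\<in>UNIV. B x $ i * (\<phi>1 i x * h)) = - \<Lambda> * E x * h * B x $ k"
        by (simp add: \<phi>1_def if_distrib[where f = "\<lambda>a. a * h"] if_distrib[where f = "\<lambda>a. _ * a"] mult_ac cong: if_cong)
      also have "(\<Sum>i\<in>UNIV. B x $ i * (h1 * P x $ i * \<phi> x)) = \<phi> x * h1 * (B x \<bullet> P x)"
        by (simp add: inner_vec_def sum_distrib_left mult_ac)
      finally show ?thesis .
    qed
    have "exp (- \<Lambda> * d) * h \<le> \<Lambda> * E x * h * (\<Lambda> + B x $ k)"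
    proof -
      have "\<bar>B x $ k\<bar> \<le> norm (B x)" by (rule component_le_norm_cart)
      then have "1 \<le> \<Lambda> + B x $ k" using \<Lambda>(1)[OF True] by linarith
      then have "1 * 1 \<le> \<Lambda> * (\<Lambda> + B x $ k)" using \<Lambda>(2) by (intro mult_mono) auto
      then have "exp (- \<Lambda> * d) * 1 \<le> E x * (\<Lambda> * (\<Lambda> + B x $ k))"
        using E(1)[OF True] by (intro mult_mono) (auto simp: E_def)
      then have "exp (- \<Lambda> * d) * 1 * h \<le> E x * (\<Lambda> * (\<Lambda> + B x $ k)) * h" using h(1) by (rule mult_right_mono)
      then show ?thesis by (simp add: mult_ac)
    qed
    moreover have "\<phi> x * h1 * (- (\<Sum>i\<in>UNIV. H x $ i) + B x \<bullet> P x) \<le> exp (\<Lambda> * d) * e x"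
    proof -
      have "\<phi> x * h1 * (- (\<Sum>i\<in>UNIV. H x $ i) + B x \<bullet> P x) \<le> \<phi> x * h1 * e x"
        using e(3)[OF True] ph h by (intro mult_left_mono mult_nonneg_nonneg)
      also have "\<dots> \<le> exp (\<Lambda> * d) * 1 * e x" using ph h e(2) by (intro mult_right_mono mult_mono) auto
      finally show ?thesis by simp
    qed
    moreover have "0 \<le> \<phi> x * (h2 * (P x \<bullet> P x))" using ph h by simp
    ultimately have "exp (- \<Lambda> * d) * h \<le> exp (\<Lambda> * d) * e x + (\<Sum>i\<in>UNIV. W i x) - B x \<bullet> Z x"
      unfolding sW BZx by (simp add: algebra_simps power2_eq_square)
    then show ?thesis using True xK by (simp add: s_def h_def)
  qed
  have "(LINT x|lebesgue. exp (- \<Lambda> * d) * s x) \<le>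
      (LINT x|lebesgue. exp (\<Lambda> * d) * e x + (\<Sum>i\<in>UNIV. W i x) - indicator K x *\<^sub>R (B x \<bullet> Z x))"
    by (rule integral_mono)
       (intro integrable_mult_right si Bochner_Integration.integrable_diff Bochner_Integration.integrable_add
         Bochner_Integration.integrable_sum Wi e BZ pw)+
  also have "\<dots> = exp (\<Lambda> * d) * (LINT x|lebesgue. e x) + (\<Sum>i\<in>UNIV. LINT x|lebesgue. W i x)
      - (LINT x:K|lebesgue. B x \<bullet> Z x)"
    using e(1) Wi BZ by (simp add: set_lebesgue_integral_def)
  finally show "exp (- \<Lambda> * d) * (LINT x|lebesgue. (if x \<in> S then hinge (z x) else 0))
    \<le> exp (\<Lambda> * d) * (LINT x|lebesgue. e x)" using I1 I2 by (simp add: s_def)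
  show "integrable lebesgue (\<lambda>x. if x \<in> S then hinge (z x) else 0)" using si by (simp add: s_def)
qed

subsection \<open>The mollified equation\<close>

lemma integrable_vec:
  fixes F :: "'a \<Rightarrow> real ^ 'n"
  assumes "\<And>i. integrable M (\<lambda>x. F x $ i)"
  shows "integrable M F"
proof -
  have "integrable M (\<lambda>x. \<Sum>i\<in>UNIV. F x $ i *\<^sub>R (axis i 1 :: real ^ 'n))"
    by (intro Bochner_Integration.integrable_sum integrable_scaleR_left assms)
  moreover have "(\<lambda>x. \<Sum>i\<in>UNIV. F x $ i *\<^sub>R axis i 1) = F"
    using basis_expansion[of "F _"] by (simp add: scalar_mult_eq_scaleR fun_eq_iff)
  ultimately show ?thesis by simp
qed

lemma integral_vec_nth:
  fixes F :: "'a \<Rightarrow> real ^ 'n"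
  assumes "integrable M F"
  shows "(LINT x|M. F x) $ i = (LINT x|M. F x $ i)"
  using integral_bounded_linear[OF bounded_linear_vec_nth assms, of i] by simp

text \<open>Tonelli with a kernel of mass 1. It converts the pointwise commutator bound into an L1
  bound that does not depend on the radius.\<close>

lemma integral_conv:
  fixes f \<rho> :: "real ^ 'n \<Rightarrow> real"
  assumes f: "integrable lebesgue f" "\<And>x. 0 \<le> f x" and \<rho>: "mollifier \<epsilon> \<rho>"
  shows "integrable lebesgue (conv f \<rho>)" "(LINT x|lebesgue. conv f \<rho> x) = (LINT x|lebesgue. f x)"
proof -
  have b: "bump \<epsilon> \<rho>" "\<And>x. 0 \<le> \<rho> x" using \<rho> by (auto simp: mollifier_def)
  have \<rho>m: "\<rho> \<in> borel_measurable lborel"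
    by (rule continuous_borel_measurable(1)[OF bump_continuous[OF b(1)]])
  \<comment> \<open>The exchange of integrals is carried out for Borel functions on
    \<open>lborel\<close>, so \<open>f\<close> is replaced by an almost everywhere equal Borel
    function, truncated to be nonnegative.\<close>
  obtain g0 where g0: "g0 \<in> borel_measurable lborel" "AE x in lborel. f x = g0 x"
    using completion_ex_borel_measurable_real[of f lborel] f(1) by (metis borel_measurable_integrable)
  define g where "g = (\<lambda>x. max 0 (g0 x))"
  have gm[measurable]: "g \<in> borel_measurable lborel" unfolding g_def using g0(1) by measurable
  have gAE: "AE x in lebesgue. f x = g x"
    by (rule AE_completion, use g0(2) in eventually_elim) (metis f(2) g_def max.absorb2)
  have gpos: "0 \<le> g x" for x by (simp add: g_def)
  have gl: "g \<in> borel_measurable lebesgue" by (rule measurable_completion[OF gm])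
  have gi: "integrable lborel g"
    using integrable_cong_AE_imp[OF f(1) gl] gAE integrable_completion[OF gm] by (auto elim: eventually_mono)
  have gint: "(LINT x|lebesgue. f x) = (LINT x|lborel. g x)"
    using integral_cong_AE[OF borel_measurable_integrable[OF f(1)] gl gAE] integral_completion[OF gm] by simp
  have m1: "(\<lambda>y. g y * \<rho> (x - y)) \<in> borel_measurable lborel" for x using gm \<rho>m by measurable
  have cg: "conv f \<rho> x = (LINT y|lborel. g y * \<rho> (x - y))" for x
  proof -
    have "conv f \<rho> x = (LINT y|lebesgue. g y * \<rho> (x - y))" unfolding conv_def
    proof (rule integral_cong_AE)
      show "AE y in lebesgue. f y * \<rho> (x - y) = g y * \<rho> (x - y)" using gAE by eventually_elim simp
    qed (use borel_measurable_integrable[OF integrable_conv[OF f(1) b(1)]] measurable_completion[OF m1] in auto)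
    then show ?thesis using integral_completion[OF m1] by simp
  qed
  have gri: "integrable lborel (\<lambda>y. g y * \<rho> (x - y))" for x
  proof -
    have "integrable lebesgue g" using gi integrable_completion[OF gm] by simp
    from integrable_conv[OF this b(1)] show ?thesis using integrable_completion[OF m1] by simp
  qed
  have e1: "ennreal (conv f \<rho> x) = (\<integral>\<^sup>+y. ennreal (g y * \<rho> (x - y)) \<partial>lborel)" for x
    unfolding cg using gri gpos b(2) by (intro nn_integral_eq_integral[symmetric]) auto
  have r1: "(\<integral>\<^sup>+x. ennreal (\<rho> (x - y)) \<partial>lborel) = 1" for y
  proof -
    have "integrable lborel \<rho>" using bump_integrable[OF b(1)] integrable_completion[OF \<rho>m] by simp
    then have i: "integrable lborel (\<lambda>x. \<rho> (x - y))"
      by (intro integrable_continuous_compact_support(1)[OF _ compact_cball[of y \<epsilon>]]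
          continuous_on_compose2[OF bump_continuous[OF b(1)]])
         (use b(1) in \<open>auto simp: bump_def dist_norm norm_minus_commute intro!: continuous_intros\<close>)
    then have "(\<integral>\<^sup>+x. ennreal (\<rho> (x - y)) \<partial>lborel) = ennreal (LINT x|lborel. \<rho> (x - y))"
      by (rule nn_integral_eq_integral) (use b(2) in auto)
    also have "(LINT x|lborel. \<rho> (x - y)) = (LINT x|lborel. \<rho> x)"
      using lborel_integral_translate[OF \<rho>m, of "- y"] by simp
    also have "\<dots> = 1" using \<rho> integral_completion[OF \<rho>m] by (simp add: mollifier_def)
    finally show ?thesis by simp
  qed
  have "(\<integral>\<^sup>+x. ennreal (conv f \<rho> x) \<partial>lborel) = (\<integral>\<^sup>+x. (\<integral>\<^sup>+y. ennreal (g y * \<rho> (x - y)) \<partial>lborel) \<partial>lborel)"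
    by (simp only: e1)
  also have "\<dots> = (\<integral>\<^sup>+y. (\<integral>\<^sup>+x. ennreal (g y * \<rho> (x - y)) \<partial>lborel) \<partial>lborel)"
  proof (rule lborel_pair.Fubini'[symmetric])
    have "(\<lambda>(x, y). ennreal (g y * \<rho> (x - y))) \<in> borel_measurable (lborel \<Otimes>\<^sub>M lborel)"
      using gm \<rho>m by measurable
    then show "(\<lambda>(y, x). ennreal (g x * \<rho> (y - x))) \<in> borel_measurable (lborel \<Otimes>\<^sub>M lborel)" .
  qed
  also have "\<dots> = (\<integral>\<^sup>+y. ennreal (g y) * (\<integral>\<^sup>+x. ennreal (\<rho> (x - y)) \<partial>lborel) \<partial>lborel)"
    using gpos b(2) \<rho>m by (simp add: ennreal_mult nn_integral_cmult)
  also have "\<dots> = (\<integral>\<^sup>+y. ennreal (g y) \<partial>lborel)" by (simp add: r1)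
  also have "\<dots> = ennreal (LINT y|lborel. g y)" using gi gpos by (intro nn_integral_eq_integral) auto
  finally have nn: "(\<integral>\<^sup>+x. ennreal (conv f \<rho> x) \<partial>lborel) = ennreal (LINT y|lborel. g y)" .
  have cc: "continuous_on UNIV (conv f \<rho>)" using class_C_imp_continuous[OF class_C_conv[OF f(1) b(1), of 0]] .
  then have cm: "conv f \<rho> \<in> borel_measurable lborel" by (rule continuous_borel_measurable(1))
  have cpos: "0 \<le> conv f \<rho> x" for x using conv_ge[OF f(1) \<rho>, of x 0] f(2) by auto
  have ci: "integrable lborel (conv f \<rho>)" by (rule integrableI_nonneg[OF cm]) (use cpos nn in auto)
  then show "integrable lebesgue (conv f \<rho>)" using integrable_completion[OF cm] by simp
  have "(LINT x|lborel. conv f \<rho> x) = (LINT y|lborel. g y)"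
    unfolding integral_eq_nn_integral[OF cm AE_I2[OF cpos]] nn
    using gpos by (intro enn2real_ennreal integral_nonneg_AE) auto
  then show "(LINT x|lebesgue. conv f \<rho> x) = (LINT x|lebesgue. f x)"
    using integral_completion[OF cm] gint by simp
qed

section \<open>The weak equation tested with reflected kernels\<close>

lemma translate_test_function:
  assumes "bump \<epsilon> \<rho>" "cball x \<epsilon> \<subseteq> K"
  shows "(\<lambda>y. \<rho> (x - y)) \<in> test_functions K"
proof -
  have "class_C k (\<lambda>y. \<rho> (x - y))" if "bump \<epsilon> \<rho>" for k \<rho>
    using that
  proof (induction k arbitrary: \<rho>)
    case 0
    then show ?case
      by (auto intro!: continuous_on_compose2[OF bump_continuous[OF 0]] continuous_intros)
  next
    case (Suc k)
    have "class_C k (\<lambda>y. - (gradient \<rho> (x - y) $ i))" for i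
      by (intro class_C_uminus Suc.IH bump_gradient Suc.prems)
    then show ?case using gradient_translate_reflect[OF Suc.prems] by simp
  qed
  then show ?thesis
    by (rule test_functionI[OF _ compact_cball[of x \<epsilon>] assms(2)])
       (use assms(1) in \<open>auto simp: bump_def dist_norm\<close>)
qed

lemma weak_gradient_integrable:
  fixes u :: "real ^ 'n \<Rightarrow> real"
  assumes "has_weak_gradient K u V" "compact C" "C \<subseteq> K"
  shows "integrable lebesgue (\<lambda>y. indicator C y * u y)" "integrable lebesgue (\<lambda>y. indicator C y *\<^sub>R V y)"
    "integrable lebesgue (\<lambda>y. indicator C y * V y $ i)" "integrable lebesgue (\<lambda>y. indicator C y * norm (V y))"
proof -
  show "integrable lebesgue (\<lambda>y. indicator C y * u y)" and *: "integrable lebesgue (\<lambda>y. indicator C y *\<^sub>R V y)"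
    using assms by (auto simp: has_weak_gradient_def locally_integrable_def set_integrable_def)
  show "integrable lebesgue (\<lambda>y. indicator C y * V y $ i)"
    using integrable_bounded_linear[OF bounded_linear_vec_nth *] by simp
  show "integrable lebesgue (\<lambda>y. indicator C y * norm (V y))"
    using integrable_norm[OF *] by simp
qed

text \<open>Comes from testing with the kernel reflected about \<open>x\<close>. The cut-off to
  \<open>C\<close> is invisible since the kernel lives in \<open>cball x \<epsilon>\<close>. Asking
  only for a \<open>bump\<close> makes the result available for derivatives of the kernel, which
  gives the second derivatives in the mollified equation.\<close>

lemma weak_gradient_mollified:
  fixes u :: "real ^ 'n \<Rightarrow> real"
  assumes wg: "has_weak_gradient K u V" and C: "compact C" "C \<subseteq> K"
    and \<rho>: "bump \<epsilon> \<rho>" "cball x \<epsilon> \<subseteq> C"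
  shows "gradient (conv (\<lambda>y. indicator C y * u y) \<rho>) x $ i = conv (\<lambda>y. indicator C y * V y $ i) \<rho> x"
proof -
  define \<phi> where "\<phi> = (\<lambda>y. \<rho> (x - y))"
  have xK: "cball x \<epsilon> \<subseteq> K" using \<rho>(2) C(2) by blast
  have \<phi>t: "\<phi> \<in> test_functions K" and \<phi>g: "gradient \<phi> y = - gradient \<rho> (x - y)" for y
    unfolding \<phi>_def using translate_test_function[OF \<rho>(1) xK] gradient_translate_reflect(2)[OF \<rho>(1)] by auto
  note uC = weak_gradient_integrable(1)[OF wg C] and VC = weak_gradient_integrable(3)[OF wg C]
  have out: "y \<notin> cball x \<epsilon>" if "y \<notin> C" for y using that \<rho>(2) by blast
  have z: "\<rho> (x - y) = 0" "gradient \<rho> (x - y) $ i = 0" if "y \<notin> C" for y i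
    using out[OF that] \<rho>(1) bump_gradient[OF \<rho>(1), of i] by (auto simp: bump_def dist_norm)
  let ?F = "\<lambda>y. indicator K y *\<^sub>R (u y *\<^sub>R gradient \<phi> y)" and ?G = "\<lambda>y. indicator K y *\<^sub>R (\<phi> y *\<^sub>R V y)"
  have F: "?F y $ i = - (indicator C y * u y * gradient \<rho> (x - y) $ i)" for y i
    using z(2)[of y i] C(2) by (auto simp: \<phi>g indicator_def)
  have G: "?G y $ i = indicator C y * V y $ i * \<rho> (x - y)" for y i
    using z(1)[of y] C(2) by (auto simp: \<phi>_def indicator_def)
  have "integrable lebesgue ?F"
    by (rule integrable_vec, unfold F)
       (intro Bochner_Integration.integrable_minus integrable_conv[OF uC bump_gradient[OF \<rho>(1)]])
  from integral_vec_nth[OF this, of i]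
  have "(LINT y:K|lebesgue. u y *\<^sub>R gradient \<phi> y) $ i = - conv (\<lambda>y. indicator C y * u y) (\<lambda>x. gradient \<rho> x $ i) x"
    unfolding F set_lebesgue_integral_def conv_def by simp
  moreover have "integrable lebesgue ?G"
    by (rule integrable_vec, unfold G) (intro integrable_conv[OF VC \<rho>(1)])
  from integral_vec_nth[OF this, of i]
  have "(LINT y:K|lebesgue. \<phi> y *\<^sub>R V y) $ i = conv (\<lambda>y. indicator C y * V y $ i) \<rho> x"
    unfolding G set_lebesgue_integral_def conv_def by simp
  moreover have "(LINT y:K|lebesgue. u y *\<^sub>R gradient \<phi> y) = - (LINT y:K|lebesgue. \<phi> y *\<^sub>R V y)"
    using wg \<phi>t by (auto simp: has_weak_gradient_def)
  ultimately show ?thesis unfolding gradient_conv[OF uC \<rho>(1)] by simp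
qed

text \<open>The reflected kernel takes the value \<open>\<rho> x\<close> at the pole, so the Dirac
  mass turns into the source \<open>\<rho>\<close>. The drift term stays inside the convolution;
  freeing it is the task of the commutator estimate.\<close>

lemma weak_equation_mollified:
  fixes u :: "real ^ 'n \<Rightarrow> real"
  assumes wg: "has_weak_gradient K u V"
    and eq: "\<And>\<phi>. \<phi> \<in> test_functions K \<Longrightarrow>
      (LINT x:K|lebesgue. V x \<bullet> gradient \<phi> x + (B x \<bullet> V x) * \<phi> x) = \<phi> 0"
    and C: "compact C" "C \<subseteq> K"
    and BV: "integrable lebesgue (\<lambda>y. indicator C y * (B y \<bullet> V y))"
    and \<rho>: "bump \<epsilon> \<rho>" "cball x \<epsilon> \<subseteq> C"
  shows "- (\<Sum>i\<in>UNIV. gradient (\<lambda>x. gradient (conv (\<lambda>y. indicator C y * u y) \<rho>) x $ i) x $ i)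
      + conv (\<lambda>y. indicator C y * (B y \<bullet> V y)) \<rho> x = \<rho> x"
proof -
  define \<phi> where "\<phi> = (\<lambda>y. \<rho> (x - y))"
  have xK: "cball x \<epsilon> \<subseteq> K" using \<rho>(2) C(2) by blast
  have \<phi>t: "\<phi> \<in> test_functions K" and \<phi>g: "gradient \<phi> y = - gradient \<rho> (x - y)" for y
    unfolding \<phi>_def using translate_test_function[OF \<rho>(1) xK] gradient_translate_reflect(2)[OF \<rho>(1)] by auto
  note uC = weak_gradient_integrable(1)[OF wg C] and VC = weak_gradient_integrable(3)[OF wg C]
  have out: "y \<notin> cball x \<epsilon>" if "y \<notin> C" for y using that \<rho>(2) by blast
  have z: "\<rho> (x - y) = 0" "gradient \<rho> (x - y) = 0" if "y \<notin> C" for y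
    using out[OF that] \<rho>(1) bump_gradient[OF \<rho>(1)] by (auto simp: bump_def dist_norm vec_eq_iff)
  have "gradient (\<lambda>x. gradient (conv (\<lambda>y. indicator C y * u y) \<rho>) x $ i) x $ i
      = conv (\<lambda>y. indicator C y * V y $ i) (\<lambda>x. gradient \<rho> x $ i) x" for i
    unfolding gradient_conv[OF uC \<rho>(1)]
    by (rule weak_gradient_mollified[OF wg C bump_gradient[OF \<rho>(1)] \<rho>(2)])
  then have "(\<Sum>i\<in>UNIV. gradient (\<lambda>x. gradient (conv (\<lambda>y. indicator C y * u y) \<rho>) x $ i) x $ i)
      = (\<Sum>i\<in>UNIV. (LINT y|lebesgue. indicator C y * V y $ i * gradient \<rho> (x - y) $ i))"
    by (simp add: conv_def)
  also have "\<dots> = (LINT y|lebesgue. (\<Sum>i\<in>UNIV. indicator C y * V y $ i * gradient \<rho> (x - y) $ i))"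
    by (rule Bochner_Integration.integral_sum[symmetric]) (rule integrable_conv[OF VC bump_gradient[OF \<rho>(1)]])
  also have "\<dots> = (LINT y|lebesgue. indicator C y * (V y \<bullet> gradient \<rho> (x - y)))"
    by (simp add: inner_vec_def sum_distrib_left mult.assoc)
  finally have L: "(\<Sum>i\<in>UNIV. gradient (\<lambda>x. gradient (conv (\<lambda>y. indicator C y * u y) \<rho>) x $ i) x $ i)
      = (LINT y|lebesgue. indicator C y * (V y \<bullet> gradient \<rho> (x - y)))" .
  have Vi: "integrable lebesgue (\<lambda>y. indicator C y * (V y \<bullet> gradient \<rho> (x - y)))"
  proof -
    have e: "indicator C y * (V y \<bullet> gradient \<rho> (x - y))
        = (\<Sum>i\<in>UNIV. indicator C y * V y $ i * gradient \<rho> (x - y) $ i)" for y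
      by (simp add: inner_vec_def sum_distrib_left mult.assoc)
    show ?thesis unfolding e
      by (rule Bochner_Integration.integrable_sum) (rule integrable_conv[OF VC bump_gradient[OF \<rho>(1)]])
  qed
  have "indicator K y *\<^sub>R (V y \<bullet> gradient \<phi> y + (B y \<bullet> V y) * \<phi> y) =
      - (indicator C y * (V y \<bullet> gradient \<rho> (x - y))) + indicator C y * (B y \<bullet> V y) * \<rho> (x - y)" for y
    using z[of y] C(2) \<phi>_def unfolding \<phi>g by (auto simp: indicator_def)
  then have "(LINT y:K|lebesgue. V y \<bullet> gradient \<phi> y + (B y \<bullet> V y) * \<phi> y) =
      (LINT y|lebesgue. - (indicator C y * (V y \<bullet> gradient \<rho> (x - y))) + indicator C y * (B y \<bullet> V y) * \<rho> (x - y))"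
    unfolding set_lebesgue_integral_def by presburger
  also have "\<dots> = - (LINT y|lebesgue. indicator C y * (V y \<bullet> gradient \<rho> (x - y)))
      + conv (\<lambda>y. indicator C y * (B y \<bullet> V y)) \<rho> x"
    unfolding conv_def using Vi integrable_conv[OF BV \<rho>(1)] by (simp add: Bochner_Integration.integral_diff)
  finally show ?thesis unfolding L using eq[OF \<phi>t] by (simp add: \<phi>_def)
qed

text \<open>Replacing \<open>B y\<close> by \<open>B x\<close> under the convolution costs at most
  \<open>\<omega>\<close> times the mollified norm of \<open>V\<close>, by Cauchy-Schwarz on the
  support of the kernel.\<close>

lemma commutator_bound:
  fixes u :: "real ^ 'n \<Rightarrow> real"
  assumes wg: "has_weak_gradient K u V" and C: "compact C" "C \<subseteq> K"
    and BV: "integrable lebesgue (\<lambda>y. indicator C y * (B y \<bullet> V y))"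
    and \<rho>: "mollifier \<epsilon> \<rho>" "cball x \<epsilon> \<subseteq> C"
    and \<omega>: "\<And>y. y \<in> cball x \<epsilon> \<Longrightarrow> norm (B x - B y) \<le> \<omega>"
  shows "B x \<bullet> gradient (conv (\<lambda>y. indicator C y * u y) \<rho>) x \<le>
      conv (\<lambda>y. indicator C y * (B y \<bullet> V y)) \<rho> x + \<omega> * conv (\<lambda>y. indicator C y * norm (V y)) \<rho> x"
proof -
  have b: "bump \<epsilon> \<rho>" "\<And>x. 0 \<le> \<rho> x" using \<rho> by (auto simp: mollifier_def)
  note VC = weak_gradient_integrable(3)[OF wg C] and VN = weak_gradient_integrable(4)[OF wg C]
  have "B x \<bullet> gradient (conv (\<lambda>y. indicator C y * u y) \<rho>) x =
      (\<Sum>i\<in>UNIV. (LINT y|lebesgue. B x $ i * (indicator C y * V y $ i * \<rho> (x - y))))"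
    by (simp add: inner_vec_def weak_gradient_mollified[OF wg C b(1) \<rho>(2)] conv_def)
  also have "\<dots> = (LINT y|lebesgue. (\<Sum>i\<in>UNIV. B x $ i * (indicator C y * V y $ i * \<rho> (x - y))))"
    by (rule Bochner_Integration.integral_sum[symmetric])
       (intro integrable_mult_right integrable_conv[OF VC b(1)])
  also have "\<dots> = conv (\<lambda>y. indicator C y * (B x \<bullet> V y)) \<rho> x"
    unfolding conv_def by (rule Bochner_Integration.integral_cong) (simp_all add: inner_vec_def sum_distrib_left sum_distrib_right mult_ac del: sum_mult_indicator)
  also have "\<dots> \<le> conv (\<lambda>y. indicator C y * (B y \<bullet> V y) + \<omega> * (indicator C y * norm (V y))) \<rho> x"
  proof (rule conv_mono_local[OF _ _ b])
    have "integrable lebesgue (\<lambda>y. \<Sum>i\<in>UNIV. B x $ i * (indicator C y * V y $ i))"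
      by (intro Bochner_Integration.integrable_sum integrable_mult_right VC)
    moreover have "(\<lambda>y. \<Sum>i\<in>UNIV. B x $ i * (indicator C y * V y $ i)) = (\<lambda>y. indicator C y * (B x \<bullet> V y))"
      by (simp add: inner_vec_def sum_distrib_left mult.left_commute)
    ultimately show "integrable lebesgue (\<lambda>y. indicator C y * (B x \<bullet> V y))" by simp
    show "integrable lebesgue (\<lambda>y. indicator C y * (B y \<bullet> V y) + \<omega> * (indicator C y * norm (V y)))"
      by (intro Bochner_Integration.integrable_add BV integrable_mult_right VN)
    fix y assume y: "y \<in> cball x \<epsilon>"
    have "(B x - B y) \<bullet> V y \<le> norm (B x - B y) * norm (V y)" by (rule norm_cauchy_schwarz)
    also have "\<dots> \<le> \<omega> * norm (V y)" using \<omega>[OF y] by (rule mult_right_mono) simp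
    finally show "indicator C y * (B x \<bullet> V y) \<le> indicator C y * (B y \<bullet> V y) + \<omega> * (indicator C y * norm (V y))"
      by (simp add: indicator_def inner_diff_left)
  qed
  also have "\<dots> = conv (\<lambda>y. indicator C y * (B y \<bullet> V y)) \<rho> x + \<omega> * conv (\<lambda>y. indicator C y * norm (V y)) \<rho> x"
    by (subst conv_add[OF BV integrable_mult_right[OF VN] b(1)]) (simp add: conv_def mult.assoc)
  finally show ?thesis .
qed

subsection \<open>The gauge of a convex body\<close>

definition polar :: "(real ^ 'n) set \<Rightarrow> (real ^ 'n) set" where
  "polar K = {a. \<forall>y\<in>K. a \<bullet> y \<le> 1}"

text \<open>The Minkowski gauge, encoded as the support function of the polar: a supremum of linear
  functionals of norm at most \<open>1 / r\<close> is at once convex and Lipschitz. That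
  \<open>K\<close> is its sublevel set below 1 is \<open>K_eq\<close>.\<close>

definition mink :: "(real ^ 'n) set \<Rightarrow> real ^ 'n \<Rightarrow> real" where
  "mink K x = (SUP a\<in>polar K. a \<bullet> x)"

locale convex_body =
  fixes K :: "(real ^ 'n) set" and r d :: real
  assumes open_K: "open K" and convex_K: "convex K" and r_pos: "r > 0"
    and cball_r: "cball 0 r \<subseteq> K" and K_d: "\<And>x. x \<in> K \<Longrightarrow> norm x \<le> d"
begin

abbreviation "g \<equiv> mink K"

lemma zero_in_K: "0 \<in> K" using cball_r r_pos by auto

lemma d_pos: "d > 0"
proof -
  have "r *\<^sub>R axis undefined 1 \<in> K" using cball_r r_pos by (auto simp: subset_iff)
  from K_d[OF this] r_pos show ?thesis by simp
qed

lemma polar_norm: "a \<in> polar K \<Longrightarrow> norm a \<le> 1 / r"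
proof (cases "a = 0")
  case False
  assume a: "a \<in> polar K"
  have "(r / norm a) *\<^sub>R a \<in> K" using cball_r r_pos False by (auto simp: subset_iff)
  then have "a \<bullet> ((r / norm a) *\<^sub>R a) \<le> 1" using a unfolding polar_def by blast
  then have "r * norm a \<le> 1" using False by (simp add: dot_square_norm power2_eq_square)
  then show ?thesis using r_pos by (simp add: field_simps)
qed (use r_pos in auto)

lemma zero_in_polar: "0 \<in> polar K" by (simp add: polar_def)

lemma polar_le: "a \<in> polar K \<Longrightarrow> a \<bullet> x \<le> norm x / r"
proof -
  assume "a \<in> polar K"
  have "a \<bullet> x \<le> norm a * norm x" by (rule norm_cauchy_schwarz)
  also have "\<dots> \<le> 1 / r * norm x" by (rule mult_right_mono[OF polar_norm]) (fact, simp)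
  finally show ?thesis by simp
qed

lemma bdd_polar: "bdd_above ((\<lambda>a. a \<bullet> x) ` polar K)"
  using polar_le by (auto intro!: bdd_aboveI)

lemma g_ge: "a \<in> polar K \<Longrightarrow> a \<bullet> x \<le> g x"
  unfolding mink_def by (rule cSUP_upper[OF _ bdd_polar])

lemma g_le: "(\<And>a. a \<in> polar K \<Longrightarrow> a \<bullet> x \<le> c) \<Longrightarrow> g x \<le> c"
  unfolding mink_def using zero_in_polar by (intro cSUP_least) auto

lemma g_nonneg: "0 \<le> g x" using g_ge[OF zero_in_polar] by simp

lemma g_0: "g 0 = 0" using g_nonneg[of 0] g_le[of 0 0] by simp

lemma g_lipschitz: "g x \<le> g y + norm (x - y) / r"
proof (rule g_le)
  fix a assume a: "a \<in> polar K"
  have "a \<bullet> x = a \<bullet> y + a \<bullet> (x - y)" by (simp add: inner_diff_right)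
  then show "a \<bullet> x \<le> g y + norm (x - y) / r" using g_ge[OF a, of y] polar_le[OF a, of "x - y"] by linarith
qed

lemma g_continuous: "continuous_on S g"
proof (rule continuous_on_subset[of UNIV])
  show "continuous_on UNIV g" unfolding continuous_on_iff
  proof (intro ballI allI impI)
    fix x e assume e: "(e :: real) > 0"
    have "dist (g x') (g x) < e" if "dist x' x < e * r" for x'
    proof -
      have "norm (x' - x) / r < e" using that r_pos by (simp add: dist_norm field_simps)
      then show ?thesis using g_lipschitz[of x' x] g_lipschitz[of x x']
        by (simp add: dist_real_def norm_minus_commute abs_less_iff)
    qed
    then show "\<exists>da>0. \<forall>x'\<in>UNIV. dist x' x < da \<longrightarrow> dist (g x') (g x) < e"
      using e r_pos by (intro exI[of _ "e * r"]) auto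
  qed
qed simp

lemma g_convex:
  assumes "0 \<le> s" "0 \<le> t" "s + t = 1"
  shows "g (s *\<^sub>R x + t *\<^sub>R y) \<le> s * g x + t * g y"
  by (rule g_le) (auto simp: inner_add_right intro!: add_mono mult_left_mono g_ge assms)

text \<open>The multiple of \<open>x\<close> of norm \<open>1 / d\<close> belongs to the polar. This
  growth later keeps the gradient of the smoothed gauge away from 0.\<close>

lemma g_lower: "norm x / d \<le> g x"
proof (cases "x = 0")
  case False
  define a where "a = (1 / (d * norm x)) *\<^sub>R x"
  have "a \<in> polar K" unfolding polar_def
  proof (clarify)
    fix y assume y: "y \<in> K"
    have "x \<bullet> y \<le> norm x * norm y" by (rule norm_cauchy_schwarz)
    also have "\<dots> \<le> norm x * d" using K_d[OF y] by (rule mult_left_mono) simp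
    finally show "a \<bullet> y \<le> 1" using False d_pos by (simp add: a_def field_simps)
  qed
  from g_ge[OF this, of x] show ?thesis using False
    by (simp add: a_def dot_square_norm power2_eq_square)
qed (simp add: g_nonneg)

lemma g_less_1: assumes "x \<in> K" shows "g x < 1"
proof -
  obtain e where e: "e > 0" "cball x e \<subseteq> K" using open_K assms open_contains_cball by blast
  \<comment> \<open>Openness lets \<open>x\<close> be stretched by the factor \<open>1 + t\<close>
    inside \<open>K\<close>, which makes the inequality strict.\<close>
  define t where "t = e / (d + 1)"
  have t: "t > 0" using e(1) d_pos by (simp add: t_def)
  have "norm x * t \<le> d * t" using K_d[OF assms] t by (intro mult_right_mono) auto
  also have "\<dots> \<le> e" using e(1) d_pos by (simp add: t_def field_simps)
  finally have "(1 + t) *\<^sub>R x \<in> cball x e" using t by (simp add: dist_norm algebra_simps)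
  then have xK: "(1 + t) *\<^sub>R x \<in> K" using e(2) by blast
  have "g x \<le> 1 / (1 + t)"
  proof (rule g_le)
    fix a assume "a \<in> polar K"
    then have "a \<bullet> ((1 + t) *\<^sub>R x) \<le> 1" using xK unfolding polar_def by blast
    then have "a \<bullet> x * (1 + t) \<le> 1" by (simp add: mult.commute)
    then show "a \<bullet> x \<le> 1 / (1 + t)" using t by (simp add: le_divide_eq)
  qed
  also have "\<dots> < 1" using t by simp
  finally show ?thesis .
qed

text \<open>A hyperplane separating \<open>y\<close> from \<open>K\<close>, normalised to level 1,
  is an element of the polar. Its level \<open>b\<close> is positive because \<open>K\<close>
  contains a ball about 0.\<close>

lemma g_ge_1: assumes "y \<notin> K" shows "1 \<le> g y"
proof -
  obtain a b where ab: "a \<noteq> 0" "\<And>x. x \<in> K \<Longrightarrow> a \<bullet> x \<le> b" "b \<le> a \<bullet> y"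
    using separating_hyperplane_sets[of K "{y}"] convex_K zero_in_K assms by auto
  have "(r / norm a) *\<^sub>R a \<in> K" using cball_r r_pos ab(1) by (auto simp: subset_iff)
  from ab(2)[OF this] have "r * norm a \<le> b" using ab(1) by (simp add: dot_square_norm power2_eq_square)
  then have b: "b > 0" using r_pos ab(1) by (smt (verit) mult_pos_pos zero_less_norm_iff)
  have "(1 / b) *\<^sub>R a \<in> polar K" using ab(2) b by (auto simp: polar_def field_simps)
  from g_ge[OF this, of y] have "(a \<bullet> y) / b \<le> g y" by simp
  moreover have "1 \<le> (a \<bullet> y) / b" using ab(3) b by simp
  ultimately show ?thesis by linarith
qed

lemma K_eq: "x \<in> K \<longleftrightarrow> g x < 1" using g_less_1 g_ge_1 by (meson not_le)

lemma bounded_K: "bounded K" using K_d by (auto simp: bounded_iff)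

lemma frontier_nonempty: "frontier K \<noteq> {}"
  using bounded_K zero_in_K frontier_eq_empty[of K] not_bounded_UNIV by auto

text \<open>On the frontier the gauge is at least 1, and it has Lipschitz constant
  \<open>1 / r\<close>. Hence a drift bound in terms of the distance becomes one in terms of the
  concave function \<open>1 - g\<close>.\<close>

lemma infdist_lower: "r * (1 - g x) \<le> infdist x (frontier K)"
proof -
  have "r * (1 - g x) \<le> dist x z" if "z \<in> frontier K" for z
  proof -
    have "z \<notin> K" using that open_K by (simp add: frontier_def interior_open)
    then have "1 \<le> g x + norm (z - x) / r" using g_ge_1[of z] g_lipschitz[of z x] by linarith
    then show ?thesis using r_pos by (simp add: dist_norm norm_minus_commute field_simps)
  qed
  then show ?thesis unfolding infdist_notempty[OF frontier_nonempty]
    by (intro cINF_greatest frontier_nonempty)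
qed

text \<open>The sublevel sets exhaust \<open>K\<close> by convex sets compactly contained in it;
  comparison and Hoelder bounds take place on them.\<close>

lemma compact_sublevel: "l < 1 \<Longrightarrow> compact {x. g x \<le> l}"
proof -
  assume l: "l < 1"
  have "closed {x. g x \<le> l}" using g_continuous by (intro closed_Collect_le continuous_on_const)
  moreover have "bounded {x. g x \<le> l}" by (rule bounded_subset[OF bounded_K]) (use l K_eq in force)
  ultimately show ?thesis by (simp add: compact_eq_bounded_closed)
qed

lemma open_sublevel: "open {x. g x < l}"
  using g_continuous by (intro open_Collect_less continuous_on_const)

lemma convex_sublevel: "convex {x. g x < l}"
proof (rule convexI)
  fix x y and u v :: real
  assume "x \<in> {x. g x < l}" "y \<in> {x. g x < l}" and uv: "0 \<le> u" "0 \<le> v" "u + v = 1"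
  then have "u * g x + v * g y < l" by (intro convex_bound_lt) auto
  then show "u *\<^sub>R x + v *\<^sub>R y \<in> {x. g x < l}" using g_convex[OF uv, of x y] by simp
qed

end

text \<open>Mollifying the gauge gives a smooth convex function whose gradient cannot degenerate away from
  the origin, since \<open>x \<bullet> \<nabla>G x \<ge> G x - G 0\<close>.\<close>

lemma (in convex_body) smooth_gauge:
  assumes \<eta>: "\<eta> > 0"
  obtains G where "\<And>k. class_C k G" "\<And>x. x \<in> K \<Longrightarrow> g x \<le> G x" "\<And>x. x \<in> K \<Longrightarrow> G x \<le> g x + 2 * \<eta> / r"
    "\<And>x. x \<in> K \<Longrightarrow> norm x / d - 2 * \<eta> / r \<le> norm (gradient G x) * norm x"
    "\<And>x i. x \<in> K \<Longrightarrow> 0 \<le> gradient (\<lambda>y. gradient G y $ i) x $ i"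
proof -
  obtain \<rho> :: "real ^ 'n \<Rightarrow> real" where \<rho>: "mollifier \<eta> \<rho>" using mollifiers_exist[where 'n = 'n] \<eta> by metis
  have b: "bump \<eta> \<rho>" "\<And>x. 0 \<le> \<rho> x" using \<rho> by (auto simp: mollifier_def)
  \<comment> \<open>The gauge is cut off to be integrable; the radius \<open>d + \<eta>\<close> is
    large enough that mollification at points of \<open>K\<close> does not notice it.\<close>
  define D where "D = cball (0 :: real ^ 'n) (d + \<eta>)"
  define f where "f = (\<lambda>x. indicator D x * g x)"
  have D: "compact D" by (simp add: D_def)
  have fb: "integrable lborel f" unfolding f_def
    using borel_integrable_compact[OF D g_continuous] by simp
  then have f: "integrable lebesgue f" using integrable_completion[of f lborel] by (simp add: borel_measurable_integrable)
  define c where "c = conv f \<rho>"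
  \<comment> \<open>Averaging moves the gauge by at most \<open>\<eta> / r\<close>; the shift puts
    the result above \<open>g\<close>, at a total cost of \<open>2 * \<eta> / r\<close>.\<close>
  define G where "G = (\<lambda>x. c x + \<eta> / r)"
  have GC: "class_C k G" for k unfolding G_def c_def by (intro class_C_add class_C_conv[OF f b(1)] class_C_const)
  have nb: "f y = g y" if "x \<in> K" "y \<in> cball x \<eta>" for x y
  proof -
    have "norm y \<le> norm x + norm (y - x)" using norm_triangle_ineq[of x "y - x"] by simp
    also have "\<dots> \<le> d + \<eta>" using K_d[OF that(1)] that(2) by (simp add: dist_norm norm_minus_commute)
    finally show ?thesis by (simp add: f_def D_def)
  qed
  have lip: "g y \<le> g x + \<eta> / r" "g x - \<eta> / r \<le> g y" if "y \<in> cball x \<eta>" for x y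
  proof -
    have "norm (x - y) / r \<le> \<eta> / r" using that r_pos by (intro divide_right_mono) (auto simp: dist_norm)
    then show "g y \<le> g x + \<eta> / r" "g x - \<eta> / r \<le> g y"
      using g_lipschitz[of x y] g_lipschitz[of y x] by (simp_all add: norm_minus_commute)
  qed
  have up: "c x \<le> g x + \<eta> / r" if "x \<in> K" for x
    unfolding c_def by (rule conv_le[OF f \<rho>]) (use nb[OF that] lip in simp)
  have lo: "g x - \<eta> / r \<le> c x" if "x \<in> K" for x
    unfolding c_def by (rule conv_ge[OF f \<rho>]) (use nb[OF that] lip in simp)
  \<comment> \<open>With the translation placed on \<open>f\<close>, the mollification is visibly an
    average of translates of a convex function, hence convex on \<open>K\<close>.\<close>
  have ci: "c x = (LINT y|lborel. f (x - y) * \<rho> y)" "integrable lborel (\<lambda>y. f (x - y) * \<rho> y)" for x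
  proof -
    have \<rho>m: "\<rho> \<in> borel_measurable lborel"
      by (rule continuous_borel_measurable(1)[OF bump_continuous[OF b(1)]])
    have fm: "f \<in> borel_measurable lborel" using fb by (rule borel_measurable_integrable)
    have m: "(\<lambda>y. f y * \<rho> (x - y)) \<in> borel_measurable lborel" using fm \<rho>m by measurable
    show "c x = (LINT y|lborel. f (x - y) * \<rho> y)"
      unfolding c_def conv_def integral_completion[OF m] using lborel_integral_reflect[OF m, of x] by simp
    obtain M where M: "M > 0" "\<And>x. norm (f x) \<le> M"
    proof -
      have "bounded (g ` D)" by (intro compact_imp_bounded compact_continuous_image g_continuous D)
      then obtain M where M: "M > 0" "\<And>x. x \<in> D \<Longrightarrow> norm (g x) \<le> M" by (auto simp: bounded_pos)
      then have "norm (f x) \<le> M" for x by (cases "x \<in> D") (auto simp: f_def)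
      with M(1) that show ?thesis by blast
    qed
    have "integrable lborel \<rho>" using bump_integrable[OF b(1)] integrable_completion[OF \<rho>m] by simp
    moreover have "(\<lambda>y. f (x - y)) \<in> borel_measurable lborel" using fm by measurable
    ultimately have "integrable lborel (\<lambda>y. \<rho> y * f (x - y))" using M(2) by (intro integrable_mult_bounded) auto
    then show "integrable lborel (\<lambda>y. f (x - y) * \<rho> y)" by (simp add: mult.commute)
  qed
  have conv: "G (s *\<^sub>R x + t *\<^sub>R y) \<le> s * G x + t * G y"
    if st: "0 \<le> s" "0 \<le> t" "s + t = 1" and xy: "x \<in> K" "y \<in> K" for s t x y
  proof -
    have xyK: "s *\<^sub>R x + t *\<^sub>R y \<in> K" using convexD[OF convex_K xy st] .
    have "c (s *\<^sub>R x + t *\<^sub>R y) \<le> (LINT w|lborel. s * (f (x - w) * \<rho> w) + t * (f (y - w) * \<rho> w))"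
      unfolding ci(1)
    proof (rule integral_mono)
      fix w
      show "f (s *\<^sub>R x + t *\<^sub>R y - w) * \<rho> w \<le> s * (f (x - w) * \<rho> w) + t * (f (y - w) * \<rho> w)"
      proof (cases "norm w \<le> \<eta>")
        case True
        then have n: "f (z - w) = g (z - w)" if "z \<in> K" for z using nb[OF that, of "z - w"] by (simp add: dist_norm)
        have "s *\<^sub>R x + t *\<^sub>R y - w = s *\<^sub>R x + t *\<^sub>R y - (s + t) *\<^sub>R w" using st by simp
        also have "\<dots> = s *\<^sub>R (x - w) + t *\<^sub>R (y - w)" by (simp add: algebra_simps)
        finally have "g (s *\<^sub>R x + t *\<^sub>R y - w) \<le> s * g (x - w) + t * g (y - w)" using g_convex[OF st] by simp
        then have "g (s *\<^sub>R x + t *\<^sub>R y - w) * \<rho> w \<le> (s * g (x - w) + t * g (y - w)) * \<rho> w"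
          by (rule mult_right_mono[OF _ b(2)])
        then show ?thesis unfolding n[OF xyK] n[OF xy(1)] n[OF xy(2)] by (simp add: algebra_simps)
      qed (use b(1) in \<open>auto simp: bump_def\<close>)
    qed (intro ci(2) Bochner_Integration.integrable_add integrable_mult_right)+
    also have "\<dots> = s * c x + t * c y" unfolding ci(1) using ci(2) by simp
    finally have "c (s *\<^sub>R x + t *\<^sub>R y) \<le> s * c x + t * c y" .
    moreover have "s * (\<eta> / r) + t * (\<eta> / r) = \<eta> / r" using st(3) by (metis distrib_right mult_1)
    ultimately show ?thesis by (simp add: G_def algebra_simps)
  qed
  have line: "convex_on {t. x + t *\<^sub>R v \<in> K} (\<lambda>t. G (x + t *\<^sub>R v))"
    "open {t. x + t *\<^sub>R v \<in> K}" "connected {t. x + t *\<^sub>R v \<in> K}" for x v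
  proof -
    have e: "x + (s * a + t * b') *\<^sub>R v = s *\<^sub>R (x + a *\<^sub>R v) + t *\<^sub>R (x + b' *\<^sub>R v)" if "s + t = 1" for s t a b' :: real
    proof -
      have "s *\<^sub>R (x + a *\<^sub>R v) + t *\<^sub>R (x + b' *\<^sub>R v) = (s + t) *\<^sub>R x + (s * a + t * b') *\<^sub>R v"
        by (simp add: algebra_simps)
      then show ?thesis using that by simp
    qed
    have cv: "convex {t. x + t *\<^sub>R v \<in> K}"
      by (rule convexI) (simp add: e, intro convexD[OF convex_K], auto)
    then show "connected {t. x + t *\<^sub>R v \<in> K}" by (rule convex_connected)
    have "continuous_on UNIV (\<lambda>t. x + t *\<^sub>R v)" by (intro continuous_intros)
    from open_vimage[OF open_K this] show "open {t. x + t *\<^sub>R v \<in> K}" by (simp add: vimage_def)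
    show "convex_on {t. x + t *\<^sub>R v \<in> K} (\<lambda>t. G (x + t *\<^sub>R v))"
      unfolding convex_on_def using cv by (auto simp: e intro!: conv)
  qed
  have Gd: "G differentiable (at x)" for x using GC[of "Suc 0"] by simp
  have Ld: "((\<lambda>t. G (x + t *\<^sub>R v)) has_real_derivative gradient G (x + t *\<^sub>R v) \<bullet> v) (at t within A)" for x v t A
  proof -
    have "((\<lambda>t. G (x + t *\<^sub>R v)) has_derivative (\<lambda>h. gradient G (x + t *\<^sub>R v) \<bullet> (h *\<^sub>R v))) (at t)"
      by (rule has_derivative_compose[OF _ gradient_has_derivative[OF Gd]]) (auto intro!: derivative_eq_intros)
    then show ?thesis
      unfolding has_field_derivative_def
      by (rule has_derivative_at_withinI[OF has_derivative_eq_rhs]) (simp add: fun_eq_iff mult.commute)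
  qed
  \<comment> \<open>The tangent inequality along lines. On the segment from 0 to \<open>x\<close> it
    gives the lower bound for the gradient, on coordinate lines the sign of the diagonal second
    derivatives.\<close>
  have tang: "G (x + t *\<^sub>R v) - G (x + s *\<^sub>R v) \<ge> (gradient G (x + s *\<^sub>R v) \<bullet> v) * (t - s)"
    if "x + s *\<^sub>R v \<in> K" "x + t *\<^sub>R v \<in> K" for x v s t
    by (rule convex_on_imp_above_tangent[OF line(1) line(3) _ _ Ld])
       (use that line(2) in \<open>auto simp: interior_open\<close>)
  show ?thesis
  proof (rule that[OF GC])
    fix x assume x: "x \<in> K"
    show "g x \<le> G x" "G x \<le> g x + 2 * \<eta> / r"
      using lo[OF x] up[OF x] by (auto simp: G_def)
    have "G 0 - G x \<ge> (gradient G x \<bullet> x) * (0 - 1)"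
      using tang[of 0 1 x 0] x zero_in_K by simp
    then have "G x - G 0 \<le> gradient G x \<bullet> x" by simp
    then have "G x - G 0 \<le> norm (gradient G x) * norm x" using norm_cauchy_schwarz[of "gradient G x" x] by linarith
    moreover have "G 0 \<le> 2 * \<eta> / r" using up[OF zero_in_K] g_0 by (simp add: G_def)
    moreover have "norm x / d \<le> G x" using g_lower[of x] lo[OF x] by (simp add: G_def)
    ultimately show "norm x / d - 2 * \<eta> / r \<le> norm (gradient G x) * norm x" by linarith
    fix i
    define e where "e = (axis i 1 :: real ^ 'n)"
    define h where "h = (\<lambda>t. gradient G (x + t *\<^sub>R e) $ i)"
    have hi: "gradient G y \<bullet> e = gradient G y $ i" for y by (simp add: e_def inner_axis)
    have "(\<lambda>y. gradient G y $ i) differentiable (at x)" using GC[of "Suc (Suc 0)"] by simp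
    from has_partial_gradient[OF this, of i]
    have hd: "(h has_real_derivative gradient (\<lambda>y. gradient G y $ i) x $ i) (at 0)"
      by (simp add: has_partial_def h_def e_def)
    \<comment> \<open>The sum of the tangent inequalities at the two endpoints.\<close>
    have mono: "0 \<le> (h t - h 0) / t" if t: "x + t *\<^sub>R e \<in> K" for t
    proof -
      have "G (x + t *\<^sub>R e) - G x \<ge> h 0 * t" "G x - G (x + t *\<^sub>R e) \<ge> h t * (0 - t)"
        using tang[of x 0 e t] tang[of x t e 0] x t hi by (simp_all add: h_def)
      then have "0 \<le> (h t - h 0) * t" by (simp add: algebra_simps)
      then show ?thesis by (auto simp: zero_le_mult_iff zero_le_divide_iff)
    qed
    have "\<forall>\<^sub>F t in nhds 0. t \<in> {t. x + t *\<^sub>R e \<in> K}"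
      by (rule eventually_nhds_in_open[OF line(2)]) (use x in auto)
    then have "\<forall>\<^sub>F t in at 0. 0 \<le> (h (0 + t) - h 0) / t"
      unfolding eventually_at_filter by eventually_elim (use mono in auto)
    with hd show "0 \<le> gradient (\<lambda>y. gradient G y $ i) x $ i"
      unfolding DERIV_def by (intro tendsto_lowerbound) auto
  qed
qed

subsection \<open>The barrier\<close>

definition rad :: "real \<Rightarrow> real \<Rightarrow> real ^ 'n \<Rightarrow> real" where
  "rad \<epsilon> a x = (x \<bullet> x + \<epsilon>\<^sup>2) powr a"

lemma has_partial_rad:
  fixes x :: "real ^ 'n"
  assumes "\<epsilon> > 0"
  shows "has_partial (rad \<epsilon> a) i (2 * a * rad \<epsilon> (a - 1) x * x $ i) x"
proof -
  have sq: "has_partial (\<lambda>x. x \<bullet> x + \<epsilon>\<^sup>2) i (2 * x $ i) x"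
  proof -
    have "((\<lambda>x. x \<bullet> x + \<epsilon>\<^sup>2) has_derivative (\<lambda>h. 2 * (x \<bullet> h))) (at x)"
      by (auto intro!: derivative_eq_intros simp: inner_commute)
    then show ?thesis using has_partial_gradient[of "\<lambda>x. x \<bullet> x + \<epsilon>\<^sup>2" x i] gradient_eqI
      by (fastforce simp: differentiable_def inner_axis)
  qed
  have "x \<bullet> x + \<epsilon>\<^sup>2 > 0" using assms by (intro add_nonneg_pos) auto
  then have "((\<lambda>q. q powr a) has_real_derivative a * (x \<bullet> x + \<epsilon>\<^sup>2) powr (a - 1)) (at (x \<bullet> x + \<epsilon>\<^sup>2))"
    by (rule has_real_derivative_powr)
  from has_partial_chain[OF sq this] show ?thesis
    unfolding rad_def by (rule has_partial_eq) simp
qed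

lemma continuous_rad:
  assumes "\<epsilon> > 0"
  shows "continuous_on S (rad \<epsilon> a)"
proof -
  have "x \<bullet> x + \<epsilon>\<^sup>2 \<noteq> 0" for x :: "real ^ 'n"
    using assms add_nonneg_pos[of "x \<bullet> x" "\<epsilon>\<^sup>2"] by simp
  then show ?thesis unfolding rad_def by (intro continuous_intros) auto
qed

lemma has_partial_rad2:
  fixes x :: "real ^ 'n"
  assumes "\<epsilon> > 0"
  shows "has_partial (\<lambda>x. 2 * a * rad \<epsilon> (a - 1) x * x $ i) i
    (2 * a * rad \<epsilon> (a - 1) x + 4 * a * (a - 1) * rad \<epsilon> (a - 2) x * (x $ i)\<^sup>2) x"
proof -
  have "has_partial (\<lambda>x. 2 * a * (rad \<epsilon> (a - 1) x * x $ i)) i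
     (0 * (rad \<epsilon> (a - 1) x * x $ i) +
      (2 * (a - 1) * rad \<epsilon> (a - 1 - 1) x * x $ i * x $ i + (if i = i then 1 else 0) * rad \<epsilon> (a - 1) x) * (2 * a)) x"
    by (rule has_partial_mult[OF has_partial_const has_partial_mult[OF has_partial_rad[OF assms] has_partial_component]])
  then show ?thesis unfolding mult.assoc by (rule has_partial_eq) (simp add: power2_eq_square algebra_simps)
qed

text \<open>Writes \<open>x \<bullet> x\<close> as \<open>q - \<epsilon>\<^sup>2\<close>. With
  \<open>n = 2 * m + 2\<close> the first coefficient is \<open>4 * a * (a + m)\<close>: it vanishes
  for \<open>a = - m\<close> and equals \<open>a\<close> for \<open>a = 1/4 - m\<close>, which is
  the reason for the offset 1/4.\<close>

lemma rad_laplacian: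
  fixes x :: "real ^ 'n"
  assumes "\<epsilon> > 0"
  shows "(\<Sum>i\<in>UNIV. 2 * a * rad \<epsilon> (a - 1) x + 4 * a * (a - 1) * rad \<epsilon> (a - 2) x * (x $ i)\<^sup>2)
    = a * (2 * real CARD('n) + 4 * a - 4) * rad \<epsilon> (a - 1) x - 4 * a * (a - 1) * \<epsilon>\<^sup>2 * rad \<epsilon> (a - 2) x"
proof -
  define q where "q = x \<bullet> x + \<epsilon>\<^sup>2"
  have q: "q > 0" unfolding q_def using assms by (intro add_nonneg_pos) auto
  have s: "(\<Sum>i\<in>UNIV. (x $ i)\<^sup>2) = q - \<epsilon>\<^sup>2" by (simp add: q_def inner_vec_def power2_eq_square)
  have "q powr (a - 2) * q = q powr (a - 1)" using q powr_mult_base[of q "a - 2"] by (simp add: mult.commute)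
  then have "4 * a * (a - 1) * (q powr (a - 2) * q) = 4 * a * (a - 1) * q powr (a - 1)" by simp
  then show ?thesis
    unfolding rad_def q_def[symmetric] sum.distrib sum_distrib_left[symmetric] s
    by (simp add: algebra_simps)
qed

lemma rad_le:
  assumes "a \<le> 0" "x \<noteq> 0"
  shows "rad \<epsilon> a x \<le> norm x powr (2 * a)"
proof -
  have "rad \<epsilon> a x \<le> (x \<bullet> x) powr a" unfolding rad_def
    using assms by (intro powr_mono2') auto
  also have "\<dots> = norm x powr (2 * a)"
    using assms by (simp add: dot_square_norm powr_powr[symmetric] powr_numeral)
  finally show ?thesis .
qed

text \<open>The power \<beta> gives a slope of the order of the drift bound,
  \<open>(1 - s) powr (\<beta> - 1)\<close>. The exponential adds the square of that slope to the
  concavity, with the free factor \<open>k\<close>, and keeps the profile between 0 and 1.\<close>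

definition gauge_barrier :: "real \<Rightarrow> real \<Rightarrow> real \<Rightarrow> real" where
  "gauge_barrier k \<beta> s = 1 - exp (- k * (1 - s) powr \<beta>)"
definition gauge_barrier' :: "real \<Rightarrow> real \<Rightarrow> real \<Rightarrow> real" where
  "gauge_barrier' k \<beta> s = - (k * \<beta> * (1 - s) powr (\<beta> - 1) * exp (- k * (1 - s) powr \<beta>))"
definition gauge_barrier'' :: "real \<Rightarrow> real \<Rightarrow> real \<Rightarrow> real" where
  "gauge_barrier'' k \<beta> s = - (k * \<beta> * ((1 - \<beta>) * (1 - s) powr (\<beta> - 2)
     + k * \<beta> * ((1 - s) powr (\<beta> - 1))\<^sup>2) * exp (- k * (1 - s) powr \<beta>))"

lemma powr_DERIV_reflect:
  "s < 1 \<Longrightarrow> ((\<lambda>s. (1 - s) powr b) has_real_derivative - (b * (1 - s) powr (b - 1))) (at s)"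
  by (rule DERIV_chain2[OF has_real_derivative_powr, THEN DERIV_cong]) (auto intro!: derivative_eq_intros)

lemma exp_powr_DERIV_reflect:
  assumes "s < 1"
  shows "((\<lambda>s. exp (- k * (1 - s) powr b)) has_real_derivative
    exp (- k * (1 - s) powr b) * (k * b * (1 - s) powr (b - 1))) (at s)"
  by (rule DERIV_chain2[OF DERIV_exp DERIV_cmult[OF powr_DERIV_reflect[OF assms]], THEN DERIV_cong]) simp

lemma gauge_barrier_DERIV:
  assumes "s < 1"
  shows "(gauge_barrier k \<beta> has_real_derivative gauge_barrier' k \<beta> s) (at s)"
  unfolding gauge_barrier_def[abs_def] gauge_barrier'_def
  by (rule DERIV_diff[OF DERIV_const exp_powr_DERIV_reflect[OF assms], THEN DERIV_cong]) simp

lemma gauge_barrier'_DERIV: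
  assumes "s < 1"
  shows "(gauge_barrier' k \<beta> has_real_derivative gauge_barrier'' k \<beta> s) (at s)"
proof -
  have "((\<lambda>s. - (k * \<beta> * ((1 - s) powr (\<beta> - 1) * exp (- k * (1 - s) powr \<beta>)))) has_real_derivative
      - (k * \<beta> * (- ((\<beta> - 1) * (1 - s) powr (\<beta> - 1 - 1)) * exp (- k * (1 - s) powr \<beta>)
        + exp (- k * (1 - s) powr \<beta>) * (k * \<beta> * (1 - s) powr (\<beta> - 1)) * (1 - s) powr (\<beta> - 1)))) (at s)"
    by (intro DERIV_minus DERIV_cmult DERIV_mult powr_DERIV_reflect exp_powr_DERIV_reflect assms)
  moreover have "\<beta> - 1 - 1 = \<beta> - 2" by simp
  ultimately show ?thesis
    unfolding gauge_barrier'_def[abs_def] gauge_barrier''_def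
    by (simp only: mult.assoc power2_eq_square) (simp add: algebra_simps)
qed

lemma continuous_gauge_barrier:
  "continuous_on {..<1} (gauge_barrier k \<beta>)" "continuous_on {..<1} (gauge_barrier' k \<beta>)"
  "continuous_on {..<1} (gauge_barrier'' k \<beta>)"
  unfolding gauge_barrier_def[abs_def] gauge_barrier'_def[abs_def] gauge_barrier''_def[abs_def]
  by (auto intro!: continuous_intros)

lemma gauge_barrier_bounds:
  assumes "k \<ge> 0"
  shows "0 \<le> gauge_barrier k \<beta> s" "gauge_barrier k \<beta> s \<le> 1"
  using assms by (auto simp: gauge_barrier_def)

text \<open>Concavity gains \<open>(k * y)\<^sup>2\<close> and the drift costs
  \<open>k * y * norm b\<close>. Completing the square always leaves a bounded deficit for bounded
  \<open>b\<close>, which is the bound used near the origin. If the gradient \<open>P\<close> is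
  bounded below, this \<open>k\<close> makes \<open>k * y\<close> at least twice the drift bound,
  and a positive surplus remains.\<close>

lemma gauge_barrier_supersolution:
  fixes P b :: "real ^ 'n"
  assumes k: "k \<ge> 0" and \<beta>: "0 < \<beta>" "\<beta> < 1" and s: "0 \<le> s" "s < 1" and L: "0 \<le> L"
  defines "Lb \<equiv> - (gauge_barrier'' k \<beta> s * (P \<bullet> P) + gauge_barrier' k \<beta> s * L) + gauge_barrier' k \<beta> s * (b \<bullet> P)"
  shows "- (norm b)\<^sup>2 / 4 \<le> Lb"
    "norm b \<le> M1 * (1 - s) powr (\<beta> - 1) \<Longrightarrow> M1 > 0 \<Longrightarrow> c > 0 \<Longrightarrow> c \<le> norm P \<Longrightarrow> k = 2 * M1 / (\<beta> * c) \<Longrightarrow>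
      2 * M1\<^sup>2 * exp (- k) * (1 - s) powr (\<beta> - 1) \<le> Lb"
proof -
  define T where "T = 1 - s"
  have T: "0 < T" "T \<le> 1" using s by (auto simp: T_def)
  define E where "E = exp (- k * T powr \<beta>)"
  define t where "t = T powr (\<beta> - 1)"
  have t: "t \<ge> 1"
  proof -
    have "T powr 0 \<le> T powr (\<beta> - 1)" using T \<beta> by (intro powr_mono') auto
    then show ?thesis using T by (simp add: t_def)
  qed
  have "T powr \<beta> \<le> 1" using T \<beta> by (intro powr_le1) auto
  then have "k * T powr \<beta> \<le> k * 1" using k by (intro mult_left_mono) auto
  then have E: "exp (- k) \<le> E" "E \<le> 1" "E > 0" using k by (auto simp: E_def)
  define y where "y = \<beta> * t * norm P"
  have y: "y \<ge> 0" using \<beta> t by (simp add: y_def)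
  \<comment> \<open>The terms with \<open>1 - \<beta>\<close> and with the Laplacian
    \<open>L\<close> of the convex function have the good sign and are dropped.\<close>
  have main: "E * (k * y * (k * y - norm b)) \<le> Lb"
  proof -
    have "Lb = E * (k * \<beta> * (1 - \<beta>) * T powr (\<beta> - 2) * (norm P)\<^sup>2 + (k * y)\<^sup>2 + k * \<beta> * t * L - k * \<beta> * t * (b \<bullet> P))"
      unfolding Lb_def gauge_barrier'_def gauge_barrier''_def T_def[symmetric] E_def[symmetric] t_def[symmetric] y_def
      by (simp add: dot_square_norm power2_eq_square algebra_simps)
    moreover have "k * \<beta> * (1 - \<beta>) * T powr (\<beta> - 2) * (norm P)\<^sup>2 \<ge> 0" using k \<beta> by simp
    moreover have "k * \<beta> * t * L \<ge> 0" using k \<beta> t L by simp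
    moreover have "k * \<beta> * t * (b \<bullet> P) \<le> k * \<beta> * t * (norm b * norm P)"
      using k \<beta> t by (intro mult_left_mono norm_cauchy_schwarz) auto
    moreover have "k * \<beta> * t * (norm b * norm P) = k * y * norm b" by (simp add: y_def)
    ultimately have "Lb \<ge> E * ((k * y)\<^sup>2 - k * y * norm b)" using E(3) by (simp add: mult_left_mono)
    then show ?thesis by (simp add: power2_eq_square algebra_simps)
  qed
  have "- (norm b)\<^sup>2 / 4 \<le> k * y * (k * y - norm b)"
    using zero_le_power2[of "k * y - norm b / 2"] by (simp add: power2_eq_square algebra_simps)
  then have "E * (- (norm b)\<^sup>2 / 4) \<le> E * (k * y * (k * y - norm b))" using E by (intro mult_left_mono) auto
  moreover have "- (norm b)\<^sup>2 / 4 \<le> E * (- (norm b)\<^sup>2 / 4)"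
    using mult_right_mono[OF E(2), of "(norm b)\<^sup>2 / 4"] by simp
  ultimately show "- (norm b)\<^sup>2 / 4 \<le> Lb" using main by linarith
  assume b: "norm b \<le> M1 * (1 - s) powr (\<beta> - 1)" and M1: "M1 > 0" and c: "c > 0" "c \<le> norm P"
    and k_def: "k = 2 * M1 / (\<beta> * c)"
  have "\<beta> * t * c \<le> y" unfolding y_def using \<beta> t c by (intro mult_left_mono) auto
  then have "k * (\<beta> * t * c) \<le> k * y" using k by (rule mult_left_mono)
  moreover have "k * (\<beta> * t * c) = 2 * M1 * t" unfolding k_def using \<beta> c by simp
  ultimately have ky: "2 * M1 * t \<le> k * y" by simp
  have "norm b \<le> M1 * t" using b by (simp add: t_def T_def)
  then have b2: "M1 * t \<le> k * y - norm b" using ky by linarith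
  \<comment> \<open>Since \<open>t\<close> is at least 1, the quadratic surplus is lowered to the
    first power, the rate at which the drift has to be compensated.\<close>
  have "2 * M1\<^sup>2 * t * 1 \<le> 2 * M1\<^sup>2 * t * t" using t by (intro mult_left_mono) auto
  also have "\<dots> = 2 * M1 * t * (M1 * t)" by (simp add: power2_eq_square)
  also have "\<dots> \<le> k * y * (k * y - norm b)" by (rule mult_mono[OF ky b2]) (use M1 t k y in auto)
  finally have f: "2 * M1\<^sup>2 * t \<le> k * y * (k * y - norm b)" by simp
  have "exp (- k) * (2 * M1\<^sup>2 * t) \<le> E * (k * y * (k * y - norm b))"
    by (rule mult_mono[OF E(1) f]) (use E t in auto)
  then show "2 * M1\<^sup>2 * exp (- k) * (1 - s) powr (\<beta> - 1) \<le> Lb"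
    using main by (simp add: t_def T_def mult_ac)
qed

definition rad_lap :: "real \<Rightarrow> real \<Rightarrow> real ^ 'n \<Rightarrow> real" where
  "rad_lap \<epsilon> a x = (\<Sum>i\<in>UNIV. 2 * a * rad \<epsilon> (a - 1) x + 4 * a * (a - 1) * rad \<epsilon> (a - 2) x * (x $ i)\<^sup>2)"

text \<open>The regularised fundamental solution \<open>q powr - m\<close>, \<open>q = |x|\<^sup>2 + \<epsilon>\<^sup>2\<close>, has \<open>-\<Delta>\<close> equal to an
  approximate Dirac mass; the lower order term \<open>q powr (1/4 - m)\<close> absorbs a bounded drift.\<close>

lemma rad_barrier:
  fixes x b :: "real ^ 'n"
  assumes n: "CARD('n) \<ge> 3" and \<epsilon>: "\<epsilon> > 0" and m: "m = (real CARD('n) - 2) / 2" and p: "p = 1/4 - m"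
  defines "q \<equiv> x \<bullet> x + \<epsilon>\<^sup>2"
  defines "P \<equiv> (2 * (- m) * rad \<epsilon> (- m - 1) x + 2 * p * rad \<epsilon> (p - 1) x) *\<^sub>R x"
  defines "Lw \<equiv> - (rad_lap \<epsilon> (- m) x + rad_lap \<epsilon> p x) + b \<bullet> P"
  shows "0 < q0 \<Longrightarrow> q0 \<le> q \<Longrightarrow> - (norm b * (2 * (m * q0 powr (- m - 1/2) - p * q0 powr (p - 1/2)))) \<le> Lw"
    "norm b \<le> M0 \<Longrightarrow> q \<le> 1 \<Longrightarrow> 2 * M0 * (m - p) * q powr (1/4) \<le> - p / 2 \<Longrightarrow>
      \<epsilon>\<^sup>2 * q powr (- m - 2) - p / 2 * q powr (p - 1) \<le> Lw"
proof -
  have n3: "real CARD('n) \<ge> 3" using n by linarith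
  have m12: "m \<ge> 1/2" and p0: "p < 0" and nm: "real CARD('n) = 2 * m + 2"
    using n3 by (auto simp: m p field_simps)
  have q: "q > 0" unfolding q_def using \<epsilon> by (intro add_nonneg_pos) auto
  have xq: "norm x \<le> q powr (1/2)"
  proof -
    have "norm x = sqrt (x \<bullet> x)" by (rule norm_eq_sqrt_inner)
    also have "\<dots> \<le> sqrt q" by (simp add: q_def)
    finally show ?thesis using q by (simp add: powr_half_sqrt)
  qed
  have r: "rad \<epsilon> a x = q powr a" for a by (simp add: rad_def q_def)
  have lap: "- (rad_lap \<epsilon> (- m) x + rad_lap \<epsilon> p x) \<ge> \<epsilon>\<^sup>2 * q powr (- m - 2) - p * q powr (p - 1)"
  proof -
    have l1: "rad_lap \<epsilon> (- m) x = - (4 * m * (m + 1) * \<epsilon>\<^sup>2 * q powr (- m - 2))"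
      unfolding rad_lap_def rad_laplacian[OF \<epsilon>] unfolding r nm by (simp add: algebra_simps)
    have c: "2 * (2 * m + 2) + 4 * p - 4 = 1" by (simp add: p)
    have l2: "rad_lap \<epsilon> p x = p * q powr (p - 1) - 4 * p * (p - 1) * \<epsilon>\<^sup>2 * q powr (p - 2)"
      unfolding rad_lap_def rad_laplacian[OF \<epsilon>] unfolding r nm c by simp
    have "4 * p * (p - 1) \<ge> 0" using p0 by (intro mult_nonpos_nonpos) auto
    then have "4 * p * (p - 1) * \<epsilon>\<^sup>2 * q powr (p - 2) \<ge> 0" by simp
    \<comment> \<open>Dimension at least 3 enters as \<open>m\<close> at least 1/2.\<close>
    moreover have "1 * (\<epsilon>\<^sup>2 * q powr (- m - 2)) \<le> 4 * m * (m + 1) * (\<epsilon>\<^sup>2 * q powr (- m - 2))"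
    proof (rule mult_right_mono)
      have "(1/2) * 1 \<le> m * (m + 1)" using m12 by (intro mult_mono) auto
      then show "1 \<le> 4 * m * (m + 1)" by simp
    qed simp
    ultimately show ?thesis unfolding l1 l2 by (simp add: mult.assoc)
  qed
  have grad: "norm P \<le> 2 * (m * q powr (- m - 1/2) - p * q powr (p - 1/2))"
  proof -
    have "norm P = (2 * m * q powr (- m - 1) - 2 * p * q powr (p - 1)) * norm x"
    proof -
      have "2 * m * q powr (- m - 1) \<ge> 0" "- (2 * p * q powr (p - 1)) \<ge> 0"
        using m12 p0 by (auto simp: mult_nonpos_nonneg)
      then have "\<bar>2 * (- m) * q powr (- m - 1) + 2 * p * q powr (p - 1)\<bar> = 2 * m * q powr (- m - 1) - 2 * p * q powr (p - 1)"
        by simp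
      then show ?thesis unfolding P_def r by simp
    qed
    also have "\<dots> \<le> (2 * m * q powr (- m - 1) - 2 * p * q powr (p - 1)) * q powr (1/2)"
    proof (rule mult_left_mono[OF xq])
      have "2 * m * q powr (- m - 1) \<ge> 0" "- (2 * p * q powr (p - 1)) \<ge> 0"
        using m12 p0 by (auto simp: mult_nonpos_nonneg)
      then show "0 \<le> 2 * m * q powr (- m - 1) - 2 * p * q powr (p - 1)" by linarith
    qed
    also have "\<dots> = 2 * (m * (q powr (- m - 1) * q powr (1/2)) - p * (q powr (p - 1) * q powr (1/2)))"
      by (simp add: algebra_simps)
    also have "q powr (- m - 1) * q powr (1/2) = q powr (- m - 1 + 1/2)" by (rule powr_add[symmetric])
    also have "- m - 1 + 1/2 = - m - 1/2" by simp
    also have "q powr (p - 1) * q powr (1/2) = q powr (p - 1 + 1/2)" by (rule powr_add[symmetric])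
    also have "p - 1 + 1/2 = p - 1/2" by simp
    finally show ?thesis .
  qed
  have grad': "norm P \<le> 2 * (a - c)" if "m * q powr (- m - 1/2) \<le> a" "c \<le> p * q powr (p - 1/2)" for a c
  proof -
    have "m * q powr (- m - 1/2) - p * q powr (p - 1/2) \<le> a - c" using that by (rule diff_mono)
    then show ?thesis using grad by simp
  qed
  have bP: "- (norm b * norm P) \<le> b \<bullet> P" using Cauchy_Schwarz_ineq2[of b P] by linarith
  have pos: "\<epsilon>\<^sup>2 * q powr (- m - 2) \<ge> 0" "- (p * q powr (p - 1)) \<ge> 0" using p0 by (auto simp: mult_nonpos_nonneg)
  {
    assume q0: "0 < q0" "q0 \<le> q"
    have "q powr (- m - 1/2) \<le> q0 powr (- m - 1/2)" "q powr (p - 1/2) \<le> q0 powr (p - 1/2)"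
      using q0 m12 p0 by (auto intro!: powr_mono2')
    then have "m * q powr (- m - 1/2) \<le> m * q0 powr (- m - 1/2)" "p * q0 powr (p - 1/2) \<le> p * q powr (p - 1/2)"
      using m12 p0 by (auto intro: mult_left_mono mult_left_mono_neg)
    then have "norm P \<le> 2 * (m * q0 powr (- m - 1/2) - p * q0 powr (p - 1/2))"
      by (rule grad')
    then have "norm b * norm P \<le> norm b * (2 * (m * q0 powr (- m - 1/2) - p * q0 powr (p - 1/2)))"
      by (rule mult_left_mono) simp
    then show "- (norm b * (2 * (m * q0 powr (- m - 1/2) - p * q0 powr (p - 1/2)))) \<le> Lw"
      using bP lap pos unfolding Lw_def by linarith
  }
  assume b: "norm b \<le> M0" and q1: "q \<le> 1" and small: "2 * M0 * (m - p) * q powr (1/4) \<le> - p / 2"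
  \<comment> \<open>The gradient of the fundamental solution is smaller by the factor
    \<open>q powr (1/4)\<close> than the Laplacian of the correction term, so a bounded drift uses
    at most half of the latter when \<open>q\<close> is small.\<close>
  have "- m - 1/2 = p - 1 + 1/4" by (simp add: p)
  then have "q powr (- m - 1/2) = q powr (p - 1) * q powr (1/4)" by (simp only: powr_add)
  moreover have "q powr (p - 1/2) \<le> q powr (p - 1) * q powr (1/4)"
    using q q1 by (simp add: powr_add[symmetric] powr_mono')
  ultimately have "m * q powr (- m - 1/2) \<le> m * (q powr (p - 1) * q powr (1/4))"
    "p * (q powr (p - 1) * q powr (1/4)) \<le> p * q powr (p - 1/2)"
    using m12 p0 by (auto intro: mult_left_mono_neg)
  then have "norm P \<le> 2 * (m * (q powr (p - 1) * q powr (1/4)) - p * (q powr (p - 1) * q powr (1/4)))"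
    by (rule grad')
  then have "norm P \<le> 2 * (m - p) * q powr (1/4) * q powr (p - 1)" by (simp add: algebra_simps)
  then have "norm b * norm P \<le> M0 * (2 * (m - p) * q powr (1/4) * q powr (p - 1))"
    using b order_trans[OF norm_ge_zero b] by (intro mult_mono) auto
  also have "\<dots> = 2 * M0 * (m - p) * q powr (1/4) * q powr (p - 1)" by simp
  also have "\<dots> \<le> - p / 2 * q powr (p - 1)" using small by (rule mult_right_mono) simp
  finally show "\<epsilon>\<^sup>2 * q powr (- m - 2) - p / 2 * q powr (p - 1) \<le> Lw"
    using bP lap unfolding Lw_def by simp
qed

text \<open>In the ball of radius \<epsilon> one has \<open>q\<close> at most
  \<open>2 * \<epsilon>\<^sup>2\<close>, which costs the factor \<open>2 powr (m + 2)\<close>; the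
  remaining power of \<epsilon> is \<open>- 2 * m - 2\<close>, that is \<open>- n\<close>. This is
  the origin of the coefficient of the pole term.\<close>

lemma rad_dominates_mollifier:
  fixes x :: "real ^ 'n"
  assumes n: "CARD('n) \<ge> 3" and \<epsilon>: "\<epsilon> > 0" and m: "m = (real CARD('n) - 2) / 2"
    and C: "C > 0" and x: "norm x \<le> \<epsilon>"
  shows "C / \<epsilon> ^ CARD('n) \<le> C * 2 powr (m + 2) * (\<epsilon>\<^sup>2 * (x \<bullet> x + \<epsilon>\<^sup>2) powr (- m - 2))"
proof -
  have n3: "real CARD('n) \<ge> 3" using n by linarith
  have "x \<bullet> x \<le> \<epsilon>\<^sup>2" unfolding dot_square_norm using x by (intro power_mono) auto
  moreover have "0 < x \<bullet> x + \<epsilon>\<^sup>2" using \<epsilon> by (intro add_nonneg_pos) auto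
  ultimately have "(2 * \<epsilon>\<^sup>2) powr (- m - 2) \<le> (x \<bullet> x + \<epsilon>\<^sup>2) powr (- m - 2)"
    using n3 by (intro powr_mono2') (auto simp: m field_simps)
  then have "C * 2 powr (m + 2) * (\<epsilon>\<^sup>2 * (2 * \<epsilon>\<^sup>2) powr (- m - 2)) \<le>
      C * 2 powr (m + 2) * (\<epsilon>\<^sup>2 * (x \<bullet> x + \<epsilon>\<^sup>2) powr (- m - 2))"
    using C by (intro mult_left_mono) auto
  moreover have "C * 2 powr (m + 2) * (\<epsilon>\<^sup>2 * (2 * \<epsilon>\<^sup>2) powr (- m - 2)) = C / \<epsilon> ^ CARD('n)"
  proof -
    have e: "\<epsilon>\<^sup>2 = \<epsilon> powr 2" using \<epsilon> by simp
    have "(2 * \<epsilon>\<^sup>2) powr (- m - 2) = 2 powr (- m - 2) * \<epsilon> powr (2 * (- m - 2))"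
      unfolding e powr_powr[symmetric] by (rule powr_mult)
    then have "C * 2 powr (m + 2) * (\<epsilon>\<^sup>2 * (2 * \<epsilon>\<^sup>2) powr (- m - 2)) =
        C * (2 powr (m + 2) * 2 powr (- m - 2)) * (\<epsilon> powr 2 * \<epsilon> powr (2 * (- m - 2)))"
      unfolding e by (simp only: mult_ac)
    also have "\<dots> = C * \<epsilon> powr (- real CARD('n))" by (simp add: powr_add[symmetric] m field_simps)
    also have "\<dots> = C / \<epsilon> ^ CARD('n)" using \<epsilon> by (simp add: powr_minus powr_realpow divide_inverse)
    finally show ?thesis .
  qed
  ultimately show ?thesis by simp
qed

section \<open>Choice of parameters and assembly of the barrier\<close>

lemma powr_small_exists:
  fixes e b :: real
  assumes "a > 0" "e > 0" "b > 0"
  obtains s where "s > 0" "\<And>q. 0 < q \<Longrightarrow> q \<le> s \<Longrightarrow> a * q powr b \<le> e"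
proof
  define s where "s = (e / a) powr (1 / b)"
  show "s > 0" using assms by (simp add: s_def)
  fix q :: real assume q: "0 < q" "q \<le> s"
  have "q powr b \<le> s powr b" using q assms by (intro powr_mono2) auto
  also have "\<dots> = e / a" using assms by (simp add: s_def powr_powr)
  finally show "a * q powr b \<le> e" using assms by (simp add: field_simps)
qed

lemma powr_large_exists:
  fixes e b :: real
  assumes "a > 0" "b < 0"
  obtains s where "s > 0" "\<And>q. 0 < q \<Longrightarrow> q \<le> s \<Longrightarrow> e \<le> a * q powr b"
proof -
  have "\<bar>e\<bar> + 1 > 0" "- b > 0" using assms by auto
  then obtain s where s: "s > 0" "\<And>q. 0 < q \<Longrightarrow> q \<le> s \<Longrightarrow> (\<bar>e\<bar> + 1) * q powr (- b) \<le> a"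
    using powr_small_exists[of "\<bar>e\<bar> + 1" a "- b"] assms(1) by metis
  have "e \<le> a * q powr b" if q: "0 < q" "q \<le> s" for q
  proof -
    have "(\<bar>e\<bar> + 1) * q powr (- b) * q powr b \<le> a * q powr b" by (rule mult_right_mono[OF s(2)[OF q]]) simp
    moreover have "q powr (- b) * q powr b = 1" using q by (simp add: powr_add[symmetric])
    ultimately have "\<bar>e\<bar> + 1 \<le> a * q powr b" by (simp add: mult.assoc)
    then show ?thesis by linarith
  qed
  with s(1) that show ?thesis by blast
qed

text \<open>\<open>P\<close> and \<open>H\<close> carry the gradient and the diagonal second
  derivatives of \<open>W\<close>. The function \<open>W\<close> may change with \<open>l\<close>
  and \<epsilon>, whereas the majorant \<open>w\<close> is meant to be independent of both.\<close>

definition (in convex_body) supersolution_on ::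
    "real \<Rightarrow> real \<Rightarrow> real \<Rightarrow> (real ^ 'n \<Rightarrow> real) \<Rightarrow> (real ^ 'n \<Rightarrow> real ^ 'n) \<Rightarrow>
     (real ^ 'n \<Rightarrow> real) \<Rightarrow> (real ^ 'n \<Rightarrow> real ^ 'n) \<Rightarrow> (real ^ 'n \<Rightarrow> real ^ 'n) \<Rightarrow> bool" where
  "supersolution_on l \<epsilon> c w B W P H \<longleftrightarrow>
     continuous_on {x. g x < l} W \<and> continuous_on {x. g x < l} P \<and> continuous_on {x. g x < l} H \<and>
     (\<forall>x i. g x < l \<longrightarrow> has_partial W i (P x $ i) x \<and> has_partial (\<lambda>y. P y $ i) i (H x $ i) x) \<and>
     (\<forall>x. g x < l \<longrightarrow> 0 \<le> W x \<and> (x \<noteq> 0 \<longrightarrow> W x \<le> w x) \<and>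
       (if norm x \<le> \<epsilon> then c else 0) \<le> - (\<Sum>i\<in>UNIV. H x $ i) + B x \<bullet> P x)"

definition pole_bound :: "real \<Rightarrow> real \<Rightarrow> real \<Rightarrow> real ^ 'n \<Rightarrow> real" where
  "pole_bound A m N x = A * (norm x powr (- 2 * m) + norm x powr (2 * (1/4 - m))) + N"

text \<open>\<open>N\<close> and \<open>\<epsilon>0\<close> precede \<open>B\<close>,
  \<open>l\<close> and \<epsilon> in the quantifiers, which makes the final bound uniform in the
  drift.\<close>

lemma (in convex_body) barrier:
  assumes n: "CARD('n) \<ge> 3" and M: "M > 0" and \<beta>: "0 < \<beta>" "\<beta> < 1" and C: "C > 0"
    and m: "m = (real CARD('n) - 2) / 2"
  obtains N \<epsilon>0 where "N \<ge> 0" "\<epsilon>0 > 0"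
    "\<And>B l \<epsilon>. (\<And>x. x \<in> K \<Longrightarrow> norm (B x) \<le> M * (r * (1 - g x)) powr (\<beta> - 1)) \<Longrightarrow> l < 1 \<Longrightarrow>
       0 < \<epsilon> \<Longrightarrow> \<epsilon> \<le> \<epsilon>0 \<Longrightarrow>
       \<exists>W P H. supersolution_on l \<epsilon> (C / \<epsilon> ^ CARD('n)) (pole_bound (C * 2 powr (m + 2)) m N) B W P H"
proof -
  define p where "p = 1/4 - m"
  note p = p_def
  have n3: "real CARD('n) \<ge> 3" using n by linarith
  have m12: "m \<ge> 1/2" and p0: "p < 0" using n3 by (auto simp: m p field_simps)
  define A where "A = C * 2 powr (m + 2)"
  have A: "A > 0" using C by (simp add: A_def)
  \<comment> \<open>\<open>M0\<close> bounds the drift where the gauge is at most 1/2, in particular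
    for \<open>norm x\<close> at most \<open>r / 2\<close>. \<open>M1\<close> is its coefficient in
    terms of \<open>1 - g\<close> on all of \<open>K\<close>.\<close>
  define M0 where "M0 = M * (r / 2) powr (\<beta> - 1)"
  define M1 where "M1 = M * r powr (\<beta> - 1)"
  have M0: "M0 > 0" and M1: "M1 > 0" using M r_pos by (auto simp: M0_def M1_def)
  obtain s0 where s0: "s0 > 0" "\<And>q. 0 < q \<Longrightarrow> q \<le> s0 \<Longrightarrow> 2 * M0 * (m - p) * q powr (1/4) \<le> - p / 2"
    using powr_small_exists[of "2 * M0 * (m - p)" "- p / 2" "1/4"] M0 m12 p0 by auto
  define q0 where "q0 = min s0 (min 1 ((r / 2)\<^sup>2))"
  have q0: "q0 > 0" "q0 \<le> s0" "q0 \<le> 1" "q0 \<le> (r / 2)\<^sup>2" using s0(1) r_pos by (auto simp: q0_def)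
  define C6 where "C6 = 2 * (m * q0 powr (- m - 1/2) - p * q0 powr (p - 1/2))"
  have C6: "C6 \<ge> 0"
  proof -
    have "m * q0 powr (- m - 1/2) \<ge> 0" "p * q0 powr (p - 1/2) \<le> 0"
      using m12 p0 by (auto simp: mult_nonpos_nonneg)
    then show ?thesis by (simp add: C6_def)
  qed
  \<comment> \<open>A lower bound for the gradient of the smoothed gauge outside a neighbourhood of
    0. It does not involve the size of that neighbourhood, so \<open>k\<close> and \<open>N\<close>
    can be fixed before \<open>q1\<close>; the smoothing parameter is adapted afterwards.\<close>
  define c1 where "c1 = 1 / (2 * d)"
  have c1: "c1 > 0" using d_pos by (simp add: c1_def)
  define k where "k = 2 * M1 / (\<beta> * c1)"
  have k: "k \<ge> 0" using M1 \<beta> c1 by (simp add: k_def)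
  \<comment> \<open>Chosen so that the surplus of the boundary term equals the damage
    \<open>A * M1 * C6\<close> that the drift does to the pole term where \<open>q\<close> exceeds
    \<open>q0\<close>.\<close>
  define N where "N = A * C6 * exp k / (2 * M1)"
  have N: "N \<ge> 0" using A C6 M1 by (simp add: N_def)
  \<comment> \<open>With \<open>N\<close> fixed, its deficit near the origin is a constant, and the
    negative power \<open>p - 1\<close> of a small \<open>q\<close> covers it.\<close>
  obtain s1 where s1: "s1 > 0" "\<And>q. 0 < q \<Longrightarrow> q \<le> s1 \<Longrightarrow> N * (M0\<^sup>2 / 4) \<le> (A * (- p / 2)) * q powr (p - 1)"
    using powr_large_exists[of "A * (- p / 2)" "p - 1" "N * (M0\<^sup>2 / 4)"] A p0 by (auto simp: mult_pos_neg)
  define q1 where "q1 = min q0 s1"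
  have q1: "q1 > 0" "q1 \<le> q0" "q1 \<le> s1" using q0(1) s1(1) by (auto simp: q1_def)
  \<comment> \<open>For \<epsilon> at most \<open>\<epsilon>0\<close>, a value of \<open>q\<close>
    above \<open>q1\<close> forces \<open>norm x\<close> to be at least
    \<open>\<epsilon>0\<close>.\<close>
  define \<epsilon>0 where "\<epsilon>0 = sqrt (q1 / 2)"
  have e0: "\<epsilon>0 > 0" "\<epsilon>0\<^sup>2 = q1 / 2" using q1(1) by (auto simp: \<epsilon>0_def)
  show ?thesis
  proof (rule that[OF N e0(1)])
    fix B :: "real ^ 'n \<Rightarrow> real ^ 'n" and l \<epsilon> :: real
    assume B: "\<And>x. x \<in> K \<Longrightarrow> norm (B x) \<le> M * (r * (1 - g x)) powr (\<beta> - 1)" and l: "l < 1"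
      and \<epsilon>: "0 < \<epsilon>" "\<epsilon> \<le> \<epsilon>0"
    have eq1: "\<epsilon>\<^sup>2 \<le> q1 / 2" using \<epsilon> e0(2) by (metis less_imp_le power_mono)
    \<comment> \<open>The first entry secures the gradient bound \<open>c1\<close> from radius
      \<open>\<epsilon>0\<close> on, the second keeps the smoothed gauge below 1 on the sublevel set
      \<open>l\<close>.\<close>
    define \<eta> where "\<eta> = min (r * \<epsilon>0 / (4 * d)) (r * (1 - l) / 4)"
    have \<eta>: "\<eta> > 0" "2 * \<eta> / r \<le> \<epsilon>0 / (2 * d)" "2 * \<eta> / r \<le> (1 - l) / 2"
    proof -
      show "\<eta> > 0" using r_pos e0(1) d_pos l by (simp add: \<eta>_def)
      have "2 * \<eta> / r \<le> 2 * (r * \<epsilon>0 / (4 * d)) / r"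
        unfolding \<eta>_def using r_pos by (intro divide_right_mono mult_left_mono) auto
      then show "2 * \<eta> / r \<le> \<epsilon>0 / (2 * d)" using r_pos by simp
      have "2 * \<eta> / r \<le> 2 * (r * (1 - l) / 4) / r"
        unfolding \<eta>_def using r_pos by (intro divide_right_mono mult_left_mono) auto
      then show "2 * \<eta> / r \<le> (1 - l) / 2" using r_pos by simp
    qed
    obtain G where G: "\<And>k. class_C k G" "\<And>x. x \<in> K \<Longrightarrow> g x \<le> G x" "\<And>x. x \<in> K \<Longrightarrow> G x \<le> g x + 2 * \<eta> / r"
      "\<And>x. x \<in> K \<Longrightarrow> norm x / d - 2 * \<eta> / r \<le> norm (gradient G x) * norm x"
      "\<And>x i. x \<in> K \<Longrightarrow> 0 \<le> gradient (\<lambda>y. gradient G y $ i) x $ i"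
      using smooth_gauge[OF \<eta>(1)] by blast
    define S where "S = {x. g x < l}"
    have SK: "x \<in> K" if "x \<in> S" for x using that l K_eq by (auto simp: S_def)
    have G01: "0 \<le> G x" "G x < 1" if "x \<in> S" for x
      using G(2,3)[OF SK[OF that]] g_nonneg[of x] \<eta>(3) that l by (auto simp: S_def)
    have Gc: "continuous_on S G" "continuous_on S (gradient G)"
      "continuous_on S (\<lambda>x. gradient G x $ i)"
      "continuous_on S (\<lambda>x. gradient (\<lambda>y. gradient G y $ i) x $ i)" for i
    proof -
      have "class_C (Suc 0) (\<lambda>y. gradient G y $ i)" using G(1)[of "Suc (Suc 0)"] by simp
      then have "continuous_on UNIV (gradient (\<lambda>y. gradient G y $ i))" by (rule continuous_gradient)
      then show "continuous_on S (\<lambda>x. gradient (\<lambda>y. gradient G y $ i) x $ i)"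
        by (intro continuous_intros) (auto elim: continuous_on_subset)
      show "continuous_on S (gradient G)"
        using continuous_gradient[OF G(1)[of "Suc 0"]] by (auto elim: continuous_on_subset)
      then show "continuous_on S (\<lambda>x. gradient G x $ i)" by (intro continuous_intros)
      show "continuous_on S G" using class_C_imp_continuous[OF G(1)[of 0]] by (auto elim: continuous_on_subset)
    qed
    have bc: "continuous_on S (\<lambda>x. gauge_barrier k \<beta> (G x))" "continuous_on S (\<lambda>x. gauge_barrier' k \<beta> (G x))"
      "continuous_on S (\<lambda>x. gauge_barrier'' k \<beta> (G x))"
      by (rule continuous_on_compose2[OF continuous_gauge_barrier(1) Gc(1)]
          continuous_on_compose2[OF continuous_gauge_barrier(2) Gc(1)]
          continuous_on_compose2[OF continuous_gauge_barrier(3) Gc(1)], use G01 in auto)+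
    define P0 where "P0 = (\<lambda>x :: real ^ 'n. (2 * (- m) * rad \<epsilon> (- m - 1) x + 2 * p * rad \<epsilon> (p - 1) x) *\<^sub>R x)"
    define W where "W = (\<lambda>x :: real ^ 'n. A * (rad \<epsilon> (- m) x + rad \<epsilon> p x) + N * gauge_barrier k \<beta> (G x))"
    define P where "P = (\<lambda>x. A *\<^sub>R P0 x + (N * gauge_barrier' k \<beta> (G x)) *\<^sub>R gradient G x)"
    define h where "h = (\<lambda>a (x :: real ^ 'n) i. 2 * a * rad \<epsilon> (a - 1) x + 4 * a * (a - 1) * rad \<epsilon> (a - 2) x * (x $ i)\<^sup>2)"
    define H where "H = (\<lambda>x :: real ^ 'n. \<chi> i. A * (h (- m) x i + h p x i) +
        N * (gauge_barrier'' k \<beta> (G x) * (gradient G x $ i * gradient G x $ i) + gauge_barrier' k \<beta> (G x) * gradient (\<lambda>y. gradient G y $ i) x $ i))"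
    have Wc: "continuous_on S W" unfolding W_def by (intro continuous_intros continuous_rad bc \<epsilon>)
    have Pc: "continuous_on S P" unfolding P_def P0_def by (intro continuous_intros continuous_rad bc \<epsilon> Gc)
    have Hc: "continuous_on S H"
    proof -
      have "continuous_on S (\<lambda>x. h a x i)" for a i
        unfolding h_def by (intro continuous_intros continuous_rad \<epsilon>)
      then show ?thesis unfolding H_def by (intro continuous_intros bc Gc)
    qed
    have Gp: "has_partial G i (gradient G x $ i) x"
      "has_partial (\<lambda>y. gradient G y $ i) i (gradient (\<lambda>y. gradient G y $ i) x $ i) x" for i x
      using G(1)[of "Suc (Suc 0)"] by (auto intro!: has_partial_gradient)
    have p1: "has_partial W i (P x $ i) x" if "x \<in> S" for x i
    proof -
      have 1: "has_partial (\<lambda>x. gauge_barrier k \<beta> (G x)) i (gauge_barrier' k \<beta> (G x) * gradient G x $ i) x"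
        by (rule has_partial_chain[OF Gp(1) gauge_barrier_DERIV[OF G01(2)[OF that]]])
      have 2: "has_partial (\<lambda>x. rad \<epsilon> (- m) x + rad \<epsilon> p x) i (P0 x $ i) x"
        by (rule has_partial_eq[OF has_partial_add[OF has_partial_rad[OF \<epsilon>(1)] has_partial_rad[OF \<epsilon>(1)]]])
           (simp add: P0_def algebra_simps)
      show ?thesis unfolding W_def
        by (rule has_partial_eq[OF has_partial_add[OF has_partial_mult[OF has_partial_const 2]
            has_partial_mult[OF has_partial_const 1]]])
           (simp add: P_def mult_ac)
    qed
    have p2: "has_partial (\<lambda>y. P y $ i) i (H x $ i) x" if "x \<in> S" for x i
    proof -
      have 1: "has_partial (\<lambda>x. gauge_barrier' k \<beta> (G x)) i (gauge_barrier'' k \<beta> (G x) * gradient G x $ i) x"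
        by (rule has_partial_chain[OF Gp(1) gauge_barrier'_DERIV[OF G01(2)[OF that]]])
      have "has_partial (\<lambda>y. 2 * (- m) * rad \<epsilon> (- m - 1) y * y $ i + 2 * p * rad \<epsilon> (p - 1) y * y $ i) i
          (h (- m) x i + h p x i) x"
        unfolding h_def by (rule has_partial_add[OF has_partial_rad2[OF \<epsilon>(1)] has_partial_rad2[OF \<epsilon>(1)]])
      then have 2: "has_partial (\<lambda>y. P0 y $ i) i (h (- m) x i + h p x i) x"
        by (simp add: P0_def distrib_right left_diff_distrib)
      have "has_partial (\<lambda>y. A * P0 y $ i + N * (gauge_barrier' k \<beta> (G y) * gradient G y $ i)) i (H x $ i) x"
        by (rule has_partial_eq[OF has_partial_add[OF has_partial_mult[OF has_partial_const 2]
              has_partial_mult[OF has_partial_const has_partial_mult[OF 1 Gp(2)]]]])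
           (simp add: H_def algebra_simps)
      then show ?thesis by (simp add: P_def mult.assoc)
    qed
    have W0: "0 \<le> W x" for x
      unfolding W_def rad_def using A N gauge_barrier_bounds[OF k] by simp
    have W1: "W x \<le> A * (norm x powr (- 2 * m) + norm x powr (2 * p)) + N" if "x \<noteq> 0" for x
    proof -
      have "rad \<epsilon> (- m) x + rad \<epsilon> p x \<le> norm x powr (2 * (- m)) + norm x powr (2 * p)"
        using m12 p0 that by (intro add_mono rad_le) auto
      then have "A * (rad \<epsilon> (- m) x + rad \<epsilon> p x) \<le> A * (norm x powr (- 2 * m) + norm x powr (2 * p))"
        using A by simp
      moreover have "N * gauge_barrier k \<beta> (G x) \<le> N * 1" using N gauge_barrier_bounds[OF k] by (intro mult_left_mono)
      ultimately show ?thesis by (simp add: W_def)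
    qed
    have W2: "(if norm x \<le> \<epsilon> then C / \<epsilon> ^ CARD('n) else 0) \<le> - (\<Sum>i\<in>UNIV. H x $ i) + B x \<bullet> P x" if x: "x \<in> S" for x
    proof -
      define q where "q = x \<bullet> x + \<epsilon>\<^sup>2"
      have q: "q > 0" unfolding q_def using \<epsilon> by (intro add_nonneg_pos) auto
      define L where "L = (\<Sum>i\<in>UNIV. gradient (\<lambda>y. gradient G y $ i) x $ i)"
      have L: "L \<ge> 0" unfolding L_def by (intro sum_nonneg G(5) SK x)
      define Lw where "Lw = - (rad_lap \<epsilon> (- m) x + rad_lap \<epsilon> p x) + B x \<bullet> P0 x"
      define Lb where "Lb = - (gauge_barrier'' k \<beta> (G x) * (gradient G x \<bullet> gradient G x) + gauge_barrier' k \<beta> (G x) * L)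
          + gauge_barrier' k \<beta> (G x) * (B x \<bullet> gradient G x)"
      have split: "- (\<Sum>i\<in>UNIV. H x $ i) + B x \<bullet> P x = A * Lw + N * Lb"
      proof -
        have "(\<Sum>i\<in>UNIV. H x $ i) = A * (rad_lap \<epsilon> (- m) x + rad_lap \<epsilon> p x) +
            N * (gauge_barrier'' k \<beta> (G x) * (gradient G x \<bullet> gradient G x) + gauge_barrier' k \<beta> (G x) * L)"
          unfolding H_def rad_lap_def h_def L_def inner_vec_def
          by (simp only: vec_lambda_beta sum.distrib sum_distrib_left[symmetric] inner_real_def)
        then show ?thesis by (simp add: P_def Lw_def Lb_def inner_add_right algebra_simps)
      qed
      define T where "T = 1 - G x"
      have T: "0 < T" using G01[OF x] by (simp add: T_def)
      have BM1: "norm (B x) \<le> M1 * T powr (\<beta> - 1)"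
      proof -
        have "(r * (1 - g x)) powr (\<beta> - 1) \<le> (r * T) powr (\<beta> - 1)"
          using T G(2)[OF SK[OF x]] r_pos \<beta> by (intro powr_mono2') (auto simp: T_def)
        then have "M * (r * (1 - g x)) powr (\<beta> - 1) \<le> M * (r * T) powr (\<beta> - 1)" using M by simp
        also have "\<dots> = M1 * T powr (\<beta> - 1)" using T r_pos by (simp add: M1_def powr_mult)
        finally show ?thesis using B[OF SK[OF x]] by linarith
      qed
      have BM0: "norm (B x) \<le> M0" if "q \<le> q0"
      proof -
        have "(norm x)\<^sup>2 \<le> (r / 2)\<^sup>2" using that q0(4) by (simp add: q_def dot_square_norm)
          (smt (verit) zero_le_power2)
        then have "norm x \<le> r / 2" using r_pos by (simp add: power2_le_iff_abs_le)
        then have "norm x / r \<le> 1 / 2" using r_pos by (simp add: field_simps)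
        then have "g x \<le> 1 / 2" using g_lipschitz[of x 0] unfolding g_0 diff_zero by linarith
        then have "(r * (1 - g x)) powr (\<beta> - 1) \<le> (r / 2) powr (\<beta> - 1)"
          using r_pos \<beta> mult_left_mono[of "1 / 2" "1 - g x" r] by (intro powr_mono2') auto
        then have "M * (r * (1 - g x)) powr (\<beta> - 1) \<le> M0" using M by (simp add: M0_def)
        then show ?thesis using B[OF SK[OF x]] by linarith
      qed
      note gb = gauge_barrier_supersolution[OF k \<beta> G01[OF x] L, where P = "gradient G x" and b = "B x", folded Lb_def]
      have grad: "c1 \<le> norm (gradient G x)" if "q > q1"
      proof -
        have "(norm x)\<^sup>2 \<ge> \<epsilon>0\<^sup>2" using that eq1 e0(2) by (simp add: q_def dot_square_norm)
        then have nx: "norm x \<ge> \<epsilon>0" by (rule power2_le_imp_le) simp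
        have "\<epsilon>0 / (2 * d) \<le> norm x / (2 * d)" using nx d_pos by (intro divide_right_mono) auto
        moreover have "norm x / d = norm x / (2 * d) + norm x / (2 * d)" by (simp add: add_divide_distrib[symmetric])
        ultimately have "norm x / (2 * d) \<le> norm (gradient G x) * norm x"
          using G(4)[OF SK[OF x]] \<eta>(2) by linarith
        then have "c1 * norm x \<le> norm (gradient G x) * norm x" by (simp add: c1_def)
        moreover have "norm x > 0" using nx e0(1) by linarith
        ultimately show ?thesis by (rule mult_right_le_imp_le)
      qed
      have gbgrad: "2 * M1\<^sup>2 * exp (- k) * T powr (\<beta> - 1) \<le> Lb" if "q > q1"
        using gb(2)[OF BM1[unfolded T_def] M1 c1 grad[OF that] k_def] by (simp add: T_def)
      have src: "(if norm x \<le> \<epsilon> then C / \<epsilon> ^ CARD('n) else 0) \<le> A * (\<epsilon>\<^sup>2 * q powr (- m - 2))"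
        using rad_dominates_mollifier[OF n \<epsilon>(1) m C, of x] A by (simp add: A_def q_def)
      have near: "\<epsilon>\<^sup>2 * q powr (- m - 2) - p / 2 * q powr (p - 1) \<le> Lw" if "q \<le> q0"
        unfolding q_def Lw_def P0_def
        by (rule rad_barrier(2)[OF n \<epsilon>(1) m p BM0[OF that]])
           (use that q0 s0(2)[OF q] in \<open>unfold q_def, linarith+\<close>)
      \<comment> \<open>Three zones. Up to \<open>q1\<close> the pole term covers both the source
        and the deficit of the boundary term; up to \<open>q0\<close> both contributions have the
        good sign; beyond \<open>q0\<close> there is no source, and the boundary term compensates
        the drift.\<close>
      consider (1) "q \<le> q1" | (2) "q1 < q" "q \<le> q0" | (3) "q0 < q" by linarith
      then show ?thesis
      proof cases
        case 1
        have "(norm (B x))\<^sup>2 \<le> M0\<^sup>2" using BM0 1 q1(2) by (intro power_mono) auto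
        then have "- (M0\<^sup>2 / 4) \<le> Lb" using gb(1) by linarith
        then have "N * (- (M0\<^sup>2 / 4)) \<le> N * Lb" using N by (rule mult_left_mono)
        moreover have "N * (M0\<^sup>2 / 4) \<le> A * (- p / 2) * q powr (p - 1)" using s1(2)[OF q] 1 q1(3) by simp
        moreover have "A * (\<epsilon>\<^sup>2 * q powr (- m - 2) - p / 2 * q powr (p - 1)) \<le> A * Lw"
          using near 1 q1(2) A by (intro mult_left_mono) auto
        ultimately show ?thesis using src unfolding split by (simp add: algebra_simps)
      next
        case 2
        have "0 \<le> 2 * M1\<^sup>2 * exp (- k) * T powr (\<beta> - 1)" by simp
        then have "0 \<le> Lb" using gbgrad[OF 2(1)] by linarith
        then have "0 \<le> N * Lb" using N by simp
        moreover have "0 \<le> - p / 2 * q powr (p - 1)" using p0 by (intro mult_nonneg_nonneg) auto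
        then have "\<epsilon>\<^sup>2 * q powr (- m - 2) \<le> Lw" using near[OF 2(2)] by linarith
        then have "A * (\<epsilon>\<^sup>2 * q powr (- m - 2)) \<le> A * Lw" using A by simp
        ultimately show ?thesis using src unfolding split by linarith
      next
        case 3
        have "(norm x)\<^sup>2 > \<epsilon>\<^sup>2" using 3 q1(2) eq1 by (simp add: q_def dot_square_norm)
        then have nx: "norm x > \<epsilon>" by (rule power2_less_imp_less) simp
        have "- (norm (B x) * C6) \<le> Lw"
          unfolding C6_def Lw_def P0_def
          using rad_barrier(1)[OF n \<epsilon>(1) m p q0(1), of x "B x"] 3 by (simp add: q_def)
        moreover have "norm (B x) * C6 \<le> M1 * T powr (\<beta> - 1) * C6" using BM1 C6 by (rule mult_right_mono)
        ultimately have "- (M1 * T powr (\<beta> - 1) * C6) \<le> Lw" by linarith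
        then have 4: "A * (- (M1 * T powr (\<beta> - 1) * C6)) \<le> A * Lw" using A by (intro mult_left_mono) auto
        have "N * (2 * M1\<^sup>2 * exp (- k) * T powr (\<beta> - 1)) \<le> N * Lb"
          using gbgrad 3 q1(2) N by (intro mult_left_mono) auto
        moreover have "N * (2 * M1\<^sup>2 * exp (- k) * T powr (\<beta> - 1)) = A * (M1 * T powr (\<beta> - 1) * C6)"
          using M1 by (simp add: N_def power2_eq_square exp_minus)
        ultimately show ?thesis using nx 4 unfolding split by simp
      qed
    qed
    show "\<exists>W P H. supersolution_on l \<epsilon> (C / \<epsilon> ^ CARD('n)) (pole_bound (C * 2 powr (m + 2)) m N) B W P H"
      using Wc Pc Hc p1 p2 W0 W1 W2 unfolding S_def A_def p_def supersolution_on_def pole_bound_def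
      by (intro exI[of _ W] exI[of _ P] exI[of _ H] conjI allI impI) auto
  qed
qed

subsection \<open>Comparison with the barrier\<close>

text \<open>Compactness makes the pointwise boundary values uniform: points of \<open>K\<close> with
  gauge tending to 1 accumulate at a frontier point, where the limit of \<open>u\<close> is
  0.\<close>

lemma (in convex_body) small_near_frontier:
  assumes lim: "\<And>z. z \<in> frontier K \<Longrightarrow> (u \<longlongrightarrow> 0) (at z within K)" and \<kappa>: "\<kappa> > (0 :: real)"
  obtains l where "l < 1" "\<And>x. x \<in> K \<Longrightarrow> l < g x \<Longrightarrow> u x < \<kappa>"
proof -
  have "\<exists>l<1. \<forall>x\<in>K. l < g x \<longrightarrow> u x < \<kappa>"
  proof (rule ccontr)
    assume neg: "\<not> ?thesis"
    have "\<exists>x\<in>K. 1 - inverse (real (Suc n)) < g x \<and> \<kappa> \<le> u x" for n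
    proof -
      have "1 - inverse (real (Suc n)) < 1" by simp
      then show ?thesis using neg by (meson not_le)
    qed
    then obtain f where f: "\<And>n. f n \<in> K" "\<And>n. 1 - inverse (real (Suc n)) < g (f n)" "\<And>n. \<kappa> \<le> u (f n)" by metis
    have "compact (closure K)" using bounded_K by simp
    moreover have "\<forall>n. f n \<in> closure K" using f(1) closure_subset by blast
    ultimately obtain z s where z: "z \<in> closure K" "strict_mono s" "(f \<circ> s) \<longlonglongrightarrow> z"
      unfolding compact_def by metis
    have "(\<lambda>n. g (f (s n))) \<longlonglongrightarrow> g z"
      using continuous_on_tendsto_compose[OF g_continuous[of UNIV] z(3)] by (simp add: o_def)
    moreover have "(\<lambda>n. 1 - inverse (real (Suc (s n)))) \<longlonglongrightarrow> 1 - 0"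
      using LIMSEQ_subseq_LIMSEQ[OF tendsto_diff[OF tendsto_const LIMSEQ_inverse_real_of_nat] z(2)]
      by (simp add: o_def)
    ultimately have "1 \<le> g z" using f(2) by (intro LIMSEQ_le) (auto intro: less_imp_le)
    then have zK: "z \<notin> K" using K_eq by auto
    then have "z \<in> frontier K" using z(1) open_K by (simp add: frontier_def interior_open)
    from order_tendstoD(2)[OF lim[OF this] \<kappa>]
    obtain e where e: "e > 0" "\<And>x. x \<in> K \<Longrightarrow> x \<noteq> z \<Longrightarrow> dist x z < e \<Longrightarrow> u x < \<kappa>"
      by (auto simp: eventually_at)
    obtain n where "dist ((f \<circ> s) n) z < e" using z(3) e(1) by (metis LIMSEQ_def order_refl)
    then have "u (f (s n)) < \<kappa>" using e(2)[of "f (s n)"] f(1)[of "s n"] zK by auto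
    then show False using f(3)[of "s n"] by simp
  qed
  then show ?thesis using that by blast
qed

text \<open>The data in the form used by the comparison: the distance is replaced by the gauge, the
  weak divergence by its sign on nonnegative test functions, and Hoelder continuity is asked on
  sublevel sets.\<close>

definition (in convex_body) pole_solution ::
    "real \<Rightarrow> real \<Rightarrow> real \<Rightarrow> (real ^ 'n \<Rightarrow> real ^ 'n) \<Rightarrow> (real ^ 'n \<Rightarrow> real) \<Rightarrow> (real ^ 'n \<Rightarrow> real ^ 'n) \<Rightarrow> bool" where
  "pole_solution M \<beta> \<alpha> B u V \<longleftrightarrow>
     (\<forall>x\<in>K. norm (B x) \<le> M * (r * (1 - g x)) powr (\<beta> - 1)) \<and> locally_integrable K B \<and>
     (\<forall>\<phi>\<in>test_functions K. (\<forall>x. 0 \<le> \<phi> x) \<longrightarrow> 0 \<le> (LINT x:K|lebesgue. B x \<bullet> gradient \<phi> x)) \<and>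
     0 < \<alpha> \<and> (\<forall>l<1. holder_on \<alpha> {x. g x < l} B) \<and> continuous_on (K - {0}) u \<and> has_weak_gradient K u V \<and>
     (\<forall>\<phi>\<in>test_functions K. (LINT x:K|lebesgue. V x \<bullet> gradient \<phi> x + (B x \<bullet> V x) * \<phi> x) = \<phi> 0) \<and>
     (\<forall>z\<in>frontier K. (u \<longlongrightarrow> 0) (at z within K))"

lemma (in convex_body) green_bound:
  assumes n: "CARD('n) \<ge> 3" and M: "M > 0" and \<beta>: "0 < \<beta>" "\<beta> < 1" and C: "C > 0"
    and moll: "\<And>\<epsilon>. \<epsilon> > 0 \<Longrightarrow> \<exists>\<rho> :: real ^ 'n \<Rightarrow> real. mollifier \<epsilon> \<rho> \<and> (\<forall>x. \<rho> x \<le> C / \<epsilon> ^ CARD('n))"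
    and m: "m = (real CARD('n) - 2) / 2"
  obtains N where "N \<ge> 0" "\<And>B u V \<alpha> x. pole_solution M \<beta> \<alpha> B u V \<Longrightarrow> x \<in> K \<Longrightarrow> x \<noteq> 0 \<Longrightarrow>
    u x \<le> pole_bound (C * 2 powr (m + 2)) m N x"
proof (rule barrier[OF n M \<beta> C m])
  fix N \<epsilon>0 :: real
  assume N: "N \<ge> 0" and \<epsilon>0: "\<epsilon>0 > 0" and
    bar: "\<And>B l \<epsilon>. (\<And>x. x \<in> K \<Longrightarrow> norm (B x) \<le> M * (r * (1 - g x)) powr (\<beta> - 1)) \<Longrightarrow> l < 1 \<Longrightarrow>
       0 < \<epsilon> \<Longrightarrow> \<epsilon> \<le> \<epsilon>0 \<Longrightarrow>
       \<exists>W P H. supersolution_on l \<epsilon> (C / \<epsilon> ^ CARD('n)) (pole_bound (C * 2 powr (m + 2)) m N) B W P H"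
  show thesis
  proof (rule that[OF N])
    fix B V :: "real ^ 'n \<Rightarrow> real ^ 'n" and u :: "real ^ 'n \<Rightarrow> real" and \<alpha> :: real and x1 :: "real ^ 'n"
    assume sol: "pole_solution M \<beta> \<alpha> B u V" and x1: "x1 \<in> K" "x1 \<noteq> 0"
    have B: "\<And>x. x \<in> K \<Longrightarrow> norm (B x) \<le> M * (r * (1 - g x)) powr (\<beta> - 1)"
      and Bli: "locally_integrable K B"
      and test: "\<And>\<phi>. \<phi> \<in> test_functions K \<Longrightarrow> (\<And>x. 0 \<le> \<phi> x) \<Longrightarrow> 0 \<le> (LINT x:K|lebesgue. B x \<bullet> gradient \<phi> x)"
      and \<alpha>: "0 < \<alpha>" and hold: "\<And>l. l < 1 \<Longrightarrow> holder_on \<alpha> {x. g x < l} B"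
      and uc: "continuous_on (K - {0}) u" and wg: "has_weak_gradient K u V"
      and eq: "\<And>\<phi>. \<phi> \<in> test_functions K \<Longrightarrow>
          (LINT x:K|lebesgue. V x \<bullet> gradient \<phi> x + (B x \<bullet> V x) * \<phi> x) = \<phi> 0"
      and lim: "\<And>z. z \<in> frontier K \<Longrightarrow> (u \<longlongrightarrow> 0) (at z within K)"
      using sol unfolding pole_solution_def by blast+
    define w where "w = (pole_bound (C * 2 powr (m + 2)) m N :: real ^ 'n \<Rightarrow> real)"
    have "u x1 \<le> w x1"
    proof (rule ccontr)
      assume "\<not> u x1 \<le> w x1"
      \<comment> \<open>A quarter of the gap at \<open>x1\<close>: one share for the oscillation of
        \<open>u\<close> near \<open>x1\<close>, one for that of \<open>w\<close>, one subtracted in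
        \<open>z\<close> to dominate the boundary values, and one left over as a lower bound for
        \<open>z\<close>.\<close>
      define \<kappa> where "\<kappa> = (u x1 - w x1) / 4"
      have \<kappa>: "\<kappa> > 0" using \<open>\<not> u x1 \<le> w x1\<close> by (simp add: \<kappa>_def)
      obtain l where l: "l < 1" "\<And>x. x \<in> K \<Longrightarrow> l < g x \<Longrightarrow> u x < \<kappa>"
        using small_near_frontier[OF lim \<kappa>] by blast
      \<comment> \<open>Nested levels: beyond \<open>l0\<close> the values of \<open>u\<close> are
        below \<open>\<kappa>\<close>, \<open>S\<close> at level \<open>l1\<close> is the comparison
        domain, \<open>C2\<close> at level \<open>l2\<close> contains the kernels centred in
        \<open>S\<close>, and below \<open>l3\<close> the drift is uniformly Hoelder
        continuous.\<close>
      define l0 where "l0 = max l (g x1)"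
      define l1 where "l1 = (l0 + 1) / 2"
      define l2 where "l2 = (l1 + 1) / 2"
      define l3 where "l3 = (l2 + 1) / 2"
      have "l0 < 1" using l(1) g_less_1[OF x1(1)] by (simp add: l0_def)
      then have ll: "l0 < l1" "l1 < l2" "l2 < l3" "l3 < 1" by (auto simp: l1_def l2_def l3_def)
      define S where "S = {x. g x < l1}"
      define C2 where "C2 = {x. g x \<le> l2}"
      have C2: "compact C2" "C2 \<subseteq> K"
      proof -
        have "l2 < 1" using ll by linarith
        then show "compact C2" unfolding C2_def by (rule compact_sublevel)
        show "C2 \<subseteq> K" unfolding C2_def subset_iff mem_Collect_eq K_eq using \<open>l2 < 1\<close> by force
      qed
      have S: "open S" "S \<subseteq> K" "x1 \<in> S"
      proof -
        show "open S" unfolding S_def by (rule open_sublevel)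
        show "S \<subseteq> K" unfolding S_def subset_iff mem_Collect_eq K_eq using ll by force
        show "x1 \<in> S" unfolding S_def mem_Collect_eq using ll(1) by (simp add: l0_def)
      qed
      define b where "b = M * (r * (1 - l2)) powr (\<beta> - 1)"
      have Bb: "norm (B x) \<le> b" if "x \<in> C2" for x
      proof -
        have "(r * (1 - g x)) powr (\<beta> - 1) \<le> (r * (1 - l2)) powr (\<beta> - 1)"
          using that ll r_pos \<beta> by (intro powr_mono2') (auto simp: C2_def)
        then have "M * (r * (1 - g x)) powr (\<beta> - 1) \<le> b" using M by (simp add: b_def)
        then show ?thesis using B[of x] that C2(2) by force
      qed
      have SC2: "S \<subseteq> C2" using ll by (auto simp: S_def C2_def)
      define \<Lambda> where "\<Lambda> = b + 1"
      have b0: "b \<ge> 0" using M by (simp add: b_def)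
      note uC = weak_gradient_integrable(1)[OF wg C2] and VC = weak_gradient_integrable(2)[OF wg C2]
        and VN = weak_gradient_integrable(4)[OF wg C2]
      have BC: "integrable lebesgue (\<lambda>y. indicator C2 y *\<^sub>R B y)"
        using Bli C2 by (auto simp: locally_integrable_def set_integrable_def)
      have BV: "integrable lebesgue (\<lambda>y. indicator C2 y * (B y \<bullet> V y))"
      proof -
        have "integrable lebesgue (\<lambda>y. (indicator C2 y *\<^sub>R V y) $ i * (indicator C2 y *\<^sub>R B y) $ i)" for i
        proof (rule integrable_mult_bounded[where C = b])
          show "integrable lebesgue (\<lambda>y. (indicator C2 y *\<^sub>R V y) $ i)"
            by (rule integrable_bounded_linear[OF bounded_linear_vec_nth VC])
          show "(\<lambda>y. (indicator C2 y *\<^sub>R B y) $ i) \<in> borel_measurable lebesgue"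
            by (rule borel_measurable_integrable[OF integrable_bounded_linear[OF bounded_linear_vec_nth BC]])
          show "\<bar>(indicator C2 y *\<^sub>R B y) $ i\<bar> \<le> b" for y
            using order_trans[OF component_le_norm_cart[of "B y" i] Bb[of y]] b0 by (simp add: indicator_def)
        qed
        then have "integrable lebesgue (\<lambda>y. \<Sum>i\<in>UNIV. (indicator C2 y *\<^sub>R V y) $ i * (indicator C2 y *\<^sub>R B y) $ i)"
          by (rule Bochner_Integration.integrable_sum)
        moreover have "(\<lambda>y. \<Sum>i\<in>UNIV. (indicator C2 y *\<^sub>R V y) $ i * (indicator C2 y *\<^sub>R B y) $ i)
            = (\<lambda>y. indicator C2 y * (B y \<bullet> V y))"
          by (auto simp: fun_eq_iff inner_vec_def indicator_def mult.commute)
        ultimately show ?thesis by simp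
      qed
      define I where "I = (LINT y|lebesgue. indicator C2 y * norm (V y))"
      have I: "I \<ge> 0" unfolding I_def by (intro integral_nonneg_AE) auto
      obtain h where h: "\<And>x y. x \<in> {x. g x < l3} \<Longrightarrow> y \<in> {x. g x < l3} \<Longrightarrow> norm (B x - B y) \<le> h * dist x y powr \<alpha>"
        using hold[OF ll(4)] unfolding holder_on_def by blast
      obtain \<rho>1 where \<rho>1: "\<rho>1 > 0" "ball x1 \<rho>1 \<subseteq> S - {0}" "\<And>y. y \<in> ball x1 \<rho>1 \<Longrightarrow> \<bar>u y - u x1\<bar> < \<kappa>"
        "\<And>y. y \<in> ball x1 \<rho>1 \<Longrightarrow> \<bar>w y - w x1\<bar> < \<kappa>"
      proof -
        have o: "open (S - {0})" using S(1) by (simp add: open_delete)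
        have xS: "x1 \<in> S - {0}" using S(3) x1(2) by simp
        have "continuous_on (S - {0}) u" using S(2) by (intro continuous_on_subset[OF uc]) auto
        moreover have "continuous_on (S - {0}) w" unfolding w_def pole_bound_def by (intro continuous_intros) auto
        ultimately have "isCont u x1" "isCont w x1"
          using o xS by (simp_all add: continuous_on_eq_continuous_at)
        then have "(u \<longlongrightarrow> u x1) (nhds x1)" "(w \<longlongrightarrow> w x1) (nhds x1)"
          by (simp_all only: isCont_def tendsto_nhds_iff)
        then have "\<forall>\<^sub>F y in nhds x1. dist (u y) (u x1) < \<kappa> \<and> dist (w y) (w x1) < \<kappa>"
          using \<kappa> by (auto simp: tendsto_iff eventually_conj_iff)
        then have "\<forall>\<^sub>F y in nhds x1. (dist (u y) (u x1) < \<kappa> \<and> dist (w y) (w x1) < \<kappa>) \<and> y \<in> S - {0}"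
          by (rule eventually_conj[OF _ eventually_nhds_in_open[OF o xS]])
        then obtain e where e: "e > 0" "\<And>y. dist y x1 < e \<Longrightarrow> (dist (u y) (u x1) < \<kappa> \<and> dist (w y) (w x1) < \<kappa>) \<and> y \<in> S - {0}"
          unfolding eventually_nhds_metric by blast
        have e': "dist (u y) (u x1) < \<kappa>" "dist (w y) (w x1) < \<kappa>" "y \<in> S - {0}" if "y \<in> ball x1 e" for y
          using e(2)[of y] that by (simp_all add: dist_commute)
        show ?thesis
        proof (rule that[OF e(1)])
          show "ball x1 e \<subseteq> S - {0}" using e'(3) by blast
        qed (use e' in \<open>simp_all add: dist_real_def\<close>)
      qed
      define v where "v = measure lebesgue (ball x1 (\<rho>1 / 2))"
      have v: "v > 0" unfolding v_def using \<rho>1(1) by (simp add: content_ball_pos)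
      \<comment> \<open>For radii up to \<open>s\<close> the L1 error is at most half of the mass
        that \<open>hinge\<close> of \<open>z\<close> is forced to have near \<open>x1\<close>. The
        summand 1 makes the coefficient positive.\<close>
      obtain s where s: "s > 0" "\<And>q. 0 < q \<Longrightarrow> q \<le> s \<Longrightarrow>
          (exp (\<Lambda> * d) * (\<bar>h\<bar> * I) + 1) * q powr \<alpha> \<le> exp (- \<Lambda> * d) * (hinge \<kappa> * v) / 2"
      proof (rule powr_small_exists)
        show "0 < exp (\<Lambda> * d) * (\<bar>h\<bar> * I) + 1" using I by (intro add_nonneg_pos) auto
        show "0 < exp (- \<Lambda> * d) * (hinge \<kappa> * v) / 2" using hinge_pos[OF \<kappa>] v by simp
      qed (use \<alpha> in auto)
      \<comment> \<open>In order: the barrier exists, the error is small, kernels stay near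
        \<open>x1\<close>, the set \<open>C1\<close> fits into \<open>S\<close>, and kernels centred
        in \<open>S\<close> stay in \<open>C2\<close>.\<close>
      define \<epsilon> where "\<epsilon> = Min {\<epsilon>0, s, \<rho>1 / 2, r * (l1 - l0) / 2, r * (l2 - l1)}"
      have \<epsilon>: "\<epsilon> > 0" "\<epsilon> \<le> \<epsilon>0" "\<epsilon> \<le> s" "\<epsilon> \<le> \<rho>1 / 2" "\<epsilon> \<le> r * (l1 - l0) / 2" "\<epsilon> \<le> r * (l2 - l1)"
        using \<epsilon>0 s(1) \<rho>1(1) r_pos ll by (auto simp: \<epsilon>_def)
      have \<epsilon>r: "\<epsilon> / r < l1 - l0" "\<epsilon> / r \<le> l2 - l1"
      proof -
        have "\<epsilon> < r * (l1 - l0)" using \<epsilon>(5) r_pos ll(1) mult_pos_pos[of r "l1 - l0"] by linarith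
        then show "\<epsilon> / r < l1 - l0" "\<epsilon> / r \<le> l2 - l1" using \<epsilon>(6) r_pos by (simp_all add: field_simps)
      qed
      have gl: "g y \<le> g x + \<epsilon> / r" "g x \<le> g y + \<epsilon> / r" if "y \<in> cball x \<epsilon>" for x y
      proof -
        have "norm (x - y) / r \<le> \<epsilon> / r" using that r_pos by (intro divide_right_mono) (auto simp: dist_norm)
        then show "g y \<le> g x + \<epsilon> / r" "g x \<le> g y + \<epsilon> / r"
          using g_lipschitz[of x y] g_lipschitz[of y x] by (simp_all add: norm_minus_commute)
      qed
      have cb: "cball x \<epsilon> \<subseteq> C2" if "x \<in> S" for x
      proof
        fix y assume "y \<in> cball x \<epsilon>"
        from gl(1)[OF this] show "y \<in> C2" using that \<epsilon>r(2) by (simp add: S_def C2_def)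
      qed
      obtain \<rho> :: "real ^ 'n \<Rightarrow> real" where \<rho>: "mollifier \<epsilon> \<rho>" "\<And>x. \<rho> x \<le> C / \<epsilon> ^ CARD('n)"
        using moll[OF \<epsilon>(1)] by blast
      have bp: "bump \<epsilon> \<rho>" "\<And>x. 0 \<le> \<rho> x" using \<rho>(1) by (auto simp: mollifier_def)
      obtain W P H where W: "continuous_on S W" "continuous_on S P" "continuous_on S H"
        "\<And>x i. x \<in> S \<Longrightarrow> has_partial W i (P x $ i) x"
        "\<And>x i. x \<in> S \<Longrightarrow> has_partial (\<lambda>y. P y $ i) i (H x $ i) x"
        "\<And>x. x \<in> S \<Longrightarrow> 0 \<le> W x" "\<And>x. x \<in> S \<Longrightarrow> x \<noteq> 0 \<Longrightarrow> W x \<le> w x"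
        "\<And>x. x \<in> S \<Longrightarrow> (if norm x \<le> \<epsilon> then C / \<epsilon> ^ CARD('n) else 0) \<le> - (\<Sum>i\<in>UNIV. H x $ i) + B x \<bullet> P x"
      proof -
        have l1: "l1 < 1" using ll by linarith
        from bar[OF _ l1 \<epsilon>(1,2), of B] B
        obtain W P H where "supersolution_on l1 \<epsilon> (C / \<epsilon> ^ CARD('n)) w B W P H"
          unfolding w_def by blast
        note X = this[unfolded supersolution_on_def]
        show ?thesis by (rule that[of W P H]) (use X in \<open>simp_all add: S_def\<close>)
      qed
      define f where "f = conv (\<lambda>y. indicator C2 y * u y) \<rho>"
      define F where "F = (\<lambda>x :: real ^ 'n. \<chi> i. gradient (\<lambda>y. gradient f y $ i) x $ i)"
      have fC: "class_C k f" for k unfolding f_def by (rule class_C_conv[OF uC bp(1)])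
      have fc: "continuous_on S f" "continuous_on S (gradient f)" "continuous_on S F"
      proof -
        show "continuous_on S f" using class_C_imp_continuous[OF fC[of 0]] by (rule continuous_on_subset) simp
        show "continuous_on S (gradient f)" using continuous_gradient[OF fC] by (rule continuous_on_subset) simp
        have "class_C (Suc 0) (\<lambda>y. gradient f y $ i)" for i using fC[of "Suc (Suc 0)"] by simp
        then have "continuous_on UNIV (gradient (\<lambda>y. gradient f y $ i))" for i by (rule continuous_gradient)
        then have "continuous_on S (gradient (\<lambda>y. gradient f y $ i))" for i by (rule continuous_on_subset) simp
        then show "continuous_on S F" unfolding F_def by (intro continuous_intros)
      qed
      have fp: "has_partial f i (gradient f x $ i) x" "has_partial (\<lambda>y. gradient f y $ i) i (F x $ i) x" for i x
        using fC[of "Suc (Suc 0)"] by (auto simp: F_def intro!: has_partial_gradient)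
      define z where "z = (\<lambda>x. f x - W x - \<kappa>)"
      \<comment> \<open>\<open>holder_on\<close> does not fix the sign of its constant, hence the
        absolute value.\<close>
      define \<omega> where "\<omega> = \<bar>h\<bar> * \<epsilon> powr \<alpha>"
      define e where "e = (\<lambda>x. \<omega> * conv (\<lambda>y. indicator C2 y * norm (V y)) \<rho> x)"
      have VNnn: "0 \<le> indicator C2 y * norm (V y)" for y by simp
      define C1 where "C1 = {x. g x \<le> l0 + \<epsilon> / r}"
      \<comment> \<open>Every point of the kernel about such an \<open>x\<close> lies beyond level
        \<open>l0\<close>, so the average of \<open>u\<close> is at most \<open>\<kappa>\<close>,
        while \<open>W\<close> is nonnegative.\<close>
      have zC1: "z x \<le> 0" if "x \<in> S" "x \<notin> C1" for x
      proof -
        have "f x \<le> \<kappa>" unfolding f_def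
        proof (rule conv_le[OF uC \<rho>(1)])
          fix y assume y: "y \<in> cball x \<epsilon>"
          then have "y \<in> C2" using cb that by blast
          moreover have "l0 < g y" using that(2) gl(2)[OF y] by (simp add: C1_def)
          then have "l < g y" by (simp add: l0_def)
          ultimately show "indicator C2 y * u y \<le> \<kappa>" using l(2)[of y] C2(2) by auto
        qed
        then show ?thesis using W(6)[OF that(1)] by (simp add: z_def)
      qed
      have ineq: "- (\<Sum>i\<in>UNIV. (F x - H x) $ i) + B x \<bullet> (gradient f x - P x) \<le> e x" if x: "x \<in> S" for x
      proof -
        have "B x \<bullet> gradient f x \<le> conv (\<lambda>y. indicator C2 y * (B y \<bullet> V y)) \<rho> x + e x"
          unfolding f_def e_def
        proof (rule commutator_bound[OF wg C2 BV \<rho>(1) cb[OF x]])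
          fix y assume y: "y \<in> cball x \<epsilon>"
          then have "g y < l3" "g x < l3" using cb[OF x] x ll by (auto simp: C2_def S_def)
          then have "norm (B x - B y) \<le> h * dist x y powr \<alpha>" by (intro h) auto
          also have "\<dots> \<le> \<bar>h\<bar> * dist x y powr \<alpha>" by (intro mult_right_mono) auto
          also have "\<dots> \<le> \<omega>" unfolding \<omega>_def using y \<alpha> by (intro mult_left_mono powr_mono2) auto
          finally show "norm (B x - B y) \<le> \<omega>" .
        qed
        moreover have "- (\<Sum>i\<in>UNIV. F x $ i) + conv (\<lambda>y. indicator C2 y * (B y \<bullet> V y)) \<rho> x = \<rho> x"
          using weak_equation_mollified[OF wg eq C2 BV bp(1) cb[OF x]] by (simp add: F_def f_def)
        \<comment> \<open>The source of the barrier dominates the mollified Dirac mass, so the pole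
          disappears from the inequality for \<open>z\<close> and only the commutator
          remains.\<close>
        moreover have "\<rho> x \<le> (if norm x \<le> \<epsilon> then C / \<epsilon> ^ CARD('n) else 0)"
          using \<rho>(2) bp(1) by (simp add: bump_def)
        ultimately show ?thesis using W(8)[OF x] by (simp add: sum_subtractf inner_diff_right)
      qed
      have ei: "integrable lebesgue e" "(LINT x|lebesgue. e x) = \<omega> * I"
        unfolding e_def I_def using integral_conv[OF VN VNnn \<rho>(1)] by simp_all
      have e0: "0 \<le> e x" for x
        unfolding e_def \<omega>_def using conv_ge[OF VN \<rho>(1), of x 0] VNnn by simp
      have prem: "compact C1" "C1 \<subseteq> S" "continuous_on S z"
        "continuous_on S (\<lambda>x. gradient f x - P x)" "continuous_on S (\<lambda>x. F x - H x)"
        "\<And>x. x \<in> S \<Longrightarrow> norm x \<le> d" "\<And>x. x \<in> S \<Longrightarrow> norm (B x) + 1 \<le> \<Lambda>" "1 \<le> \<Lambda>"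
      proof -
        show "compact C1" unfolding C1_def using \<epsilon>r(1) ll by (intro compact_sublevel) linarith
        show "C1 \<subseteq> S" using \<epsilon>r(1) by (auto simp: C1_def S_def)
        show "continuous_on S z" unfolding z_def by (intro continuous_intros fc W)
        show "continuous_on S (\<lambda>x. gradient f x - P x)" by (intro continuous_intros fc W)
        show "continuous_on S (\<lambda>x. F x - H x)" by (intro continuous_intros fc W)
        show "norm x \<le> d" if "x \<in> S" for x using K_d S(2) that by blast
        show "norm (B x) + 1 \<le> \<Lambda>" if "x \<in> S" for x using Bb[of x] SC2 that by (auto simp: \<Lambda>_def)
        show "1 \<le> \<Lambda>" using b0 by (simp add: \<Lambda>_def)
      qed
      have pz: "has_partial z i ((gradient f x - P x) $ i) x"
        "has_partial (\<lambda>y. (gradient f y - P y) $ i) i ((F x - H x) $ i) x" if "x \<in> S" for x i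
      proof -
        have "has_partial (\<lambda>x. f x - W x - \<kappa>) i (gradient f x $ i - P x $ i - 0) x"
          by (intro has_partial_diff has_partial_const fp W(4) that)
        then show "has_partial z i ((gradient f x - P x) $ i) x" by (simp add: z_def)
        have "has_partial (\<lambda>y. gradient f y $ i - P y $ i) i (F x $ i - H x $ i) x"
          by (intro has_partial_diff fp W(5) that)
        then show "has_partial (\<lambda>y. (gradient f y - P y) $ i) i ((F x - H x) $ i) x" by simp
      qed
      note main = integral_hinge_le[where K = K and B = B and S = S and d = d and C = C1 and z = z
          and P = "\<lambda>x. gradient f x - P x" and H = "\<lambda>x. F x - H x" and \<Lambda> = \<Lambda> and e = e]
      have hi: "integrable lebesgue (\<lambda>x. if x \<in> S then hinge (z x) else 0)"
        by (rule main(1))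
           (fact open_K Bli test S prem pz zC1 ei(1) e0 ineq)+
      have "exp (- \<Lambda> * d) * (LINT x|lebesgue. (if x \<in> S then hinge (z x) else 0)) \<le> exp (\<Lambda> * d) * (LINT x|lebesgue. e x)"
        by (rule main(2))
           (fact open_K Bli test S prem pz zC1 ei(1) e0 ineq)+
      then have hle: "exp (- \<Lambda> * d) * (LINT x|lebesgue. (if x \<in> S then hinge (z x) else 0)) \<le> exp (\<Lambda> * d) * (\<omega> * I)"
        unfolding ei(2) .
      have zlow: "\<kappa> \<le> z x" if x: "x \<in> ball x1 (\<rho>1 / 2)" for x
      proof -
        have xb: "x \<in> ball x1 \<rho>1" using x \<rho>1(1) by auto
        have xS: "x \<in> S" "x \<noteq> 0" using subsetD[OF \<rho>1(2) xb] by simp_all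
        have "w x + 2 * \<kappa> \<le> f x" unfolding f_def
        proof (rule conv_ge[OF uC \<rho>(1)])
          fix y assume y: "y \<in> cball x \<epsilon>"
          have "dist x1 y \<le> dist x1 x + dist x y" by (rule dist_triangle)
          then have yb: "y \<in> ball x1 \<rho>1" using x y \<epsilon>(4) by simp
          have "y \<in> C2" using cb[OF xS(1)] y by blast
          moreover have "w x + 2 * \<kappa> \<le> u y"
          proof -
            have "u x1 < u y + \<kappa>" "w x < w x1 + \<kappa>"
              using \<rho>1(3)[OF yb] \<rho>1(4)[OF xb] by (simp_all add: abs_less_iff)
            moreover have "4 * \<kappa> = u x1 - w x1" by (simp add: \<kappa>_def)
            ultimately show ?thesis by linarith
          qed
          ultimately show "w x + 2 * \<kappa> \<le> indicator C2 y * u y" by simp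
        qed
        then show ?thesis using W(7)[OF xS] by (simp add: z_def)
      qed
      have "hinge \<kappa> * v \<le> (LINT x|lebesgue. (if x \<in> S then hinge (z x) else 0))"
      proof -
        have "(LINT x|lebesgue. hinge \<kappa> * indicator (ball x1 (\<rho>1 / 2)) x) \<le>
            (LINT x|lebesgue. (if x \<in> S then hinge (z x) else 0))"
        proof (rule integral_mono[OF _ hi])
          show "integrable lebesgue (\<lambda>x. hinge \<kappa> * indicator (ball x1 (\<rho>1 / 2)) x)"
            using emeasure_bounded_finite[OF bounded_ball, of x1 "\<rho>1 / 2"]
            by (intro integrable_mult_right integrable_real_indicator) auto
          show "hinge \<kappa> * indicator (ball x1 (\<rho>1 / 2)) x \<le> (if x \<in> S then hinge (z x) else 0)" for x
          proof (cases "x \<in> ball x1 (\<rho>1 / 2)")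
            case True
            then have "x \<in> ball x1 \<rho>1" using \<rho>1(1) by auto
            from subsetD[OF \<rho>1(2) this] have "x \<in> S" by simp
            then show ?thesis using hinge_mono[OF zlow[OF True]] True by simp
          qed (simp add: hinge_nonneg)
        qed
        then show ?thesis by (simp add: v_def)
      qed
      then have "exp (- \<Lambda> * d) * (hinge \<kappa> * v) \<le> exp (- \<Lambda> * d) * (LINT x|lebesgue. (if x \<in> S then hinge (z x) else 0))"
        by (rule mult_left_mono) simp
      also have "\<dots> \<le> exp (\<Lambda> * d) * (\<omega> * I)" by (rule hle)
      also have "\<dots> = exp (\<Lambda> * d) * (\<bar>h\<bar> * I) * \<epsilon> powr \<alpha>" by (simp add: \<omega>_def mult_ac)
      also have "\<dots> \<le> (exp (\<Lambda> * d) * (\<bar>h\<bar> * I) + 1) * \<epsilon> powr \<alpha>" by (intro mult_right_mono) auto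
      also have "\<dots> \<le> exp (- \<Lambda> * d) * (hinge \<kappa> * v) / 2" by (rule s(2)[OF \<epsilon>(1,3)])
      finally have "exp (- \<Lambda> * d) * (hinge \<kappa> * v) \<le> exp (- \<Lambda> * d) * (hinge \<kappa> * v) / 2" .
      moreover have "exp (- \<Lambda> * d) * (hinge \<kappa> * v) > 0" using hinge_pos[OF \<kappa>] v by simp
      ultimately show False by linarith
    qed
    then show "u x1 \<le> pole_bound (C * 2 powr (m + 2)) m N x1"
      by (simp add: w_def)
  qed
qed

section \<open>From the Green's function to the comparison estimate\<close>

theorem theorem1:
  fixes K :: "(real ^ 'n) set" and R \<beta> :: real
  defines "\<delta> \<equiv> (\<lambda>x. infdist x (frontier K))"
  assumes "CARD('n) \<ge> 3"
    and "open K" and "bounded K" and "convex K" and "0 \<in> K"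
    and "R > 0" and "ball 0 R \<subseteq> interior K"
    and "0 < \<beta>" and "\<beta> < 1"
  shows "\<exists>T' :: real \<Rightarrow> real \<Rightarrow> real. \<forall>M > 0. \<forall>B D G.
      (\<forall>x\<in>K. norm (B x) * \<delta> x powr (1 - \<beta>) \<le> M) \<longrightarrow>
      has_weak_divergence K B D \<longrightarrow>
      (\<forall>x\<in>K. - (M\<^sup>2 / \<delta> x powr (2 - 2 * \<beta>)) \<le> D x \<and> D x \<le> 0) \<longrightarrow>
      (\<exists>\<alpha>>0. \<forall>U. open U \<and> connected U \<and> compact (closure U) \<and> closure U \<subseteq> K
         \<longrightarrow> holder_on \<alpha> U B) \<longrightarrow>
      dirichlet_green K B G \<longrightarrow>
      (\<forall>x\<in>K. x \<noteq> 0 \<and> norm x \<le> 1 / 2 \<longrightarrow> G x 0 \<le> T' M 1 / norm x ^ (CARD('n) - 2))"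
proof -
  obtain d where d: "\<And>x. x \<in> K \<Longrightarrow> norm x \<le> d" using \<open>bounded K\<close> by (auto simp: bounded_iff)
  \<comment> \<open>Half the radius, so that the closed ball lies in \<open>K\<close>.\<close>
  define r where "r = R / 2"
  have "cball 0 r \<subseteq> ball 0 R" using \<open>R > 0\<close> by (auto simp: r_def)
  then have "cball 0 r \<subseteq> K" using \<open>ball 0 R \<subseteq> interior K\<close> interior_subset by blast
  then interpret convex_body K r d
    using \<open>open K\<close> \<open>convex K\<close> \<open>R > 0\<close> d by unfold_locales (auto simp: r_def)
  define m where "m = (real CARD('n) - 2) / 2"
  obtain C where C: "C > 0"
    "\<And>\<epsilon>. \<epsilon> > 0 \<Longrightarrow> \<exists>\<rho> :: real ^ 'n \<Rightarrow> real. mollifier \<epsilon> \<rho> \<and> (\<forall>x. \<rho> x \<le> C / \<epsilon> ^ CARD('n))"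
    using mollifiers_exist[where 'n = 'n] by metis
  define A where "A = C * 2 powr (m + 2)"
  have A: "A > 0" using C(1) by (simp add: A_def)
  \<comment> \<open>Packs the uniform bound into a predicate of \<open>M\<close> and
    \<open>N\<close>, from which \<open>N\<close> is then chosen as a function of
    \<open>M\<close>.\<close>
  define bd where "bd = (\<lambda>M N. N \<ge> 0 \<and> (\<forall>B u V \<alpha>. \<forall>x\<in>K. pole_solution M \<beta> \<alpha> B u V \<longrightarrow> x \<noteq> 0 \<longrightarrow> u x \<le> pole_bound A m N x))"
  have "\<exists>N. bd M N" if M: "M > 0" for M
  proof (rule green_bound[OF \<open>CARD('n) \<ge> 3\<close> M \<open>0 < \<beta>\<close> \<open>\<beta> < 1\<close> C(1) _ m_def, folded A_def])
    show "\<exists>\<rho> :: real ^ 'n \<Rightarrow> real. mollifier \<epsilon> \<rho> \<and> (\<forall>x. \<rho> x \<le> C / \<epsilon> ^ CARD('n))" if "\<epsilon> > 0" for \<epsilon>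
      by (rule C(2)[OF that])
  qed (unfold bd_def, blast)
  then obtain N where bd: "\<And>M. M > 0 \<Longrightarrow> bd M (N M)" by metis
  show ?thesis
  \<comment> \<open>For \<open>norm x\<close> at most 1, each of the two powers in
    \<open>pole_bound\<close> and the constant 1 is at most \<open>norm x powr (- 2 * m)\<close>;
    this gives \<open>2 * A + N M\<close>.\<close>
  proof (intro exI[of _ "\<lambda>M _. 2 * A + N M"] allI impI ballI)
    fix M B D G x
    assume M: "M > 0"
      and B: "\<forall>x\<in>K. norm (B x) * \<delta> x powr (1 - \<beta>) \<le> M"
      and div: "has_weak_divergence K B D"
      and D: "\<forall>x\<in>K. - (M\<^sup>2 / \<delta> x powr (2 - 2 * \<beta>)) \<le> D x \<and> D x \<le> 0"
      and hold: "\<exists>\<alpha>>0. \<forall>U. open U \<and> connected U \<and> compact (closure U) \<and> closure U \<subseteq> K \<longrightarrow> holder_on \<alpha> U B"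
      and G: "dirichlet_green K B G"
      and x: "x \<in> K" "x \<noteq> 0 \<and> norm x \<le> 1 / 2"
    obtain \<alpha> where \<alpha>: "\<alpha> > 0"
      "\<And>U. open U \<Longrightarrow> connected U \<Longrightarrow> compact (closure U) \<Longrightarrow> closure U \<subseteq> K \<Longrightarrow> holder_on \<alpha> U B"
      using hold by blast
    obtain V where V: "has_weak_gradient K (\<lambda>x. G x 0) V"
      "\<And>\<phi>. \<phi> \<in> test_functions K \<Longrightarrow> (LINT x:K|lebesgue. V x \<bullet> gradient \<phi> x + (B x \<bullet> V x) * \<phi> x) = \<phi> 0"
      using G \<open>0 \<in> K\<close> unfolding dirichlet_green_def by blast
    have "pole_solution M \<beta> \<alpha> B (\<lambda>x. G x 0) V"
      unfolding pole_solution_def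
    proof (intro conjI ballI allI impI)
      show "norm (B y) \<le> M * (r * (1 - g y)) powr (\<beta> - 1)" if y: "y \<in> K" for y
      proof -
        have pos: "0 < r * (1 - g y)" using g_less_1[OF y] r_pos by simp
        have le: "r * (1 - g y) \<le> \<delta> y" unfolding \<delta>_def by (rule infdist_lower)
        \<comment> \<open>Positivity of the distance allows dividing by its power; since
          \<open>\<beta> - 1\<close> is negative, replacing the distance by the smaller
          \<open>r * (1 - g y)\<close> only increases the bound.\<close>
        have \<delta>: "0 < \<delta> y" using pos le by linarith
        have "norm (B y) * \<delta> y powr (1 - \<beta>) * \<delta> y powr (\<beta> - 1) \<le> M * \<delta> y powr (\<beta> - 1)"
          using B y by (intro mult_right_mono) auto
        moreover have "\<delta> y powr (1 - \<beta>) * \<delta> y powr (\<beta> - 1) = 1" using \<delta> by (simp add: powr_add[symmetric])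
        ultimately have "norm (B y) \<le> M * \<delta> y powr (\<beta> - 1)" by (simp add: mult.assoc)
        also have "\<dots> \<le> M * (r * (1 - g y)) powr (\<beta> - 1)"
          using M pos le \<open>\<beta> < 1\<close> by (intro mult_left_mono powr_mono2') auto
        finally show ?thesis .
      qed
      show "locally_integrable K B" using div by (simp add: has_weak_divergence_def)
      show "0 \<le> (LINT x:K|lebesgue. B x \<bullet> gradient \<phi> x)"
        if \<phi>: "\<phi> \<in> test_functions K" "\<forall>x. 0 \<le> \<phi> x" for \<phi>
      proof -
        have "0 \<le> (LINT x|lebesgue. - (indicator K x *\<^sub>R (\<phi> x * D x)))"
          using D \<phi>(2) by (intro integral_nonneg_AE) (auto simp: indicator_def mult_nonneg_nonpos)
        then show ?thesis using div \<phi>(1)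
          by (auto simp: has_weak_divergence_def set_lebesgue_integral_def)
      qed
      \<comment> \<open>Sublevel sets are admissible subdomains: open, convex and thus connected,
        with compact closure in \<open>K\<close>.\<close>
      show "holder_on \<alpha> {x. g x < l} B" if l: "l < 1" for l
      proof (rule \<alpha>(2))
        have "closure {x. g x < l} \<subseteq> {x. g x \<le> l}"
          using compact_sublevel[OF l] by (intro closure_minimal) (auto simp: compact_imp_closed)
        moreover have "{x. g x \<le> l} \<subseteq> K" unfolding subset_iff mem_Collect_eq K_eq using l by force
        ultimately show "closure {x. g x < l} \<subseteq> K" by blast
        have "bounded {x. g x < l}" by (rule bounded_subset[OF bounded_K]) (use l K_eq in force)
        then show "compact (closure {x. g x < l})" by simp
      qed (auto intro: open_sublevel convex_connected convex_sublevel)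
      show "continuous_on (K - {0}) (\<lambda>x. G x 0)" using G \<open>0 \<in> K\<close> by (auto simp: dirichlet_green_def)
      show "((\<lambda>x. G x 0) \<longlongrightarrow> 0) (at z within K)" if "z \<in> frontier K" for z
        using G \<open>0 \<in> K\<close> that by (auto simp: dirichlet_green_def)
    qed (use \<alpha>(1) V in auto)
    then have "G x 0 \<le> pole_bound A m (N M) x" using bd[OF M] x unfolding bd_def by blast
    also have "\<dots> \<le> (2 * A + N M) * norm x powr (- 2 * m)"
    proof -
      have nx: "0 < norm x" "norm x \<le> 1" using x(2) by auto
      have m0: "0 \<le> m" using \<open>CARD('n) \<ge> 3\<close> by (simp add: m_def)
      have "norm x powr (2 * (1/4 - m)) \<le> norm x powr (- 2 * m)" using nx by (intro powr_mono') auto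
      then have "A * (norm x powr (- 2 * m) + norm x powr (2 * (1/4 - m))) \<le> A * (norm x powr (- 2 * m) + norm x powr (- 2 * m))"
        using A by simp
      moreover have "norm x powr 0 \<le> norm x powr (- 2 * m)" using nx m0 by (intro powr_mono') auto
      then have "N M * 1 \<le> N M * norm x powr (- 2 * m)" using nx bd[OF M] by (intro mult_left_mono) (auto simp: bd_def)
      ultimately show ?thesis by (simp add: pole_bound_def algebra_simps)
    qed
    also have "norm x powr (- 2 * m) = 1 / norm x ^ (CARD('n) - 2)"
    proof -
      have "- 2 * m = - real (CARD('n) - 2)" using \<open>CARD('n) \<ge> 3\<close> by (simp add: m_def of_nat_diff)
      then show ?thesis using x(2) by (simp add: powr_minus_divide powr_realpow)
    qed
    finally show "G x 0 \<le> (2 * A + N M) / norm x ^ (CARD('n) - 2)" by simp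
  qed
qed

end
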